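(* Let $S_Q:\mathcal{E}_Q\to\mathcal{E}_Q$ be a random subshift of finite type over $(\Omega,\mathcal{A},\mathbb{P},\theta)$, let $\nu$ be an $S_Q$-invariant probability measure with marginal $\mathbb{P}$ on $\Omega$ and disintegration $\{\mu_\omega\}_{\omega\in\Omega}$, and let $A_n\in\mathcal{F}_0^n$, $n\in\mathbb{Z}^+$, be a sequence of sets. Suppose there are a positive random variable $D\in L^p(\mathbb{P})$ for some $p\in(0,1]$, real-valued functions $\beta_0,\beta_1$ and either $\alpha$ or $\phi$ defined on $\mathbb{N}$, such that for all $m,n$, $A\in\mathcal{F}_0^n$, $B\in\mathcal{F}_0^m$ and $\mathbb{P}$-a.e. $\omega$ the following hold. (I) For all $0\le j\le n\le k$: $\mu_\omega(A_n\cap\sigma^{-j}(A_n))\le \mu_\omega(A_n)\beta_0(j)$ and $\mu_\omega(A_n\cap\sigma^{-k}(A_n))\le\mu_\omega(A_n)\beta_1(n)$. (II) With $\varepsilon(n):=\operatorname{ess\,sup}_\omega\mu_\omega(A_n)$, one has $\lim_{n\to\infty}\varepsilon(n)=0$ and $\varepsilon(n)\neq0$ for all $n\in\mathbb{Z}^+$. (III) Either (uniform fibered mixing with rate $\alpha$) for all $g\in\mathbb{Z}^+$, $|\mu_\omega(A\cap\sigma^{-g-n}B)-\mu_\omega(A)\mu_{\theta^{n+g}\omega}(B)|\le D(\omega)\alpha(g)$; or (fibered $\phi$-mixing) for all $g\in\mathbb{Z}^+$, $|\mu_\omega(A\cap\sigma^{-g-n}B)-\mu_\omega(A)\mu_{\theta^{n+g}\omega}(B)|\le\mu_\omega(A)\phi(g)$.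 (IV) With $q_n=\min\{j\ge1: A_n\cap\sigma^{-j}A_n\ne\emptyset\}$, for $\mathbb{P}$-a.e. $\omega$ and every finite union $R$ of disjoint open bounded intervals in $[0,\infty)$, with $k_n=k_n(\omega,R)=\max\{k\ge1: T_\omega^k(A_n)\le\sup R\}$, $$\lim_{n\to\infty}\ \inf_{h\ge0}\Big[h\beta_1(n)+\Big(\sum_{j=q_n}^n\beta_0(j)\Big)+\min\big(\alpha(h)k_n^{1/p},\phi(h)\big)+(h+n)\varepsilon(n)\Big]=0,$$ where $h$ ranges over $\mathbb{N}$ and, in the minimum, only the terms for which the corresponding mixing condition in (III) holds are taken into account (so if only one of $\alpha,\phi$ is available, the minimum is just the term involving that function). Then, for $\mathbb{P}$-a.e. $\omega$, the hitting time process $$\mathcal{N}_{A_n}(\omega,x):=\sum_{k=1}^\infty 1_{A_n}(\sigma^k(x))\,\delta_{T_\omega^k(A_n)}$$ converges under the law of $\mu_\omega$, as $n\to\infty$, to a uniform Poisson point process on $[0,\infty)$. In particular, for $\mathbb{P}$-a.e. $\omega$, $$\lim_{n\to\infty}\sup_{k\ge0}\Big|\mu_\omega\big(x\in X:\tau_{A_n}(x)>k\big)-\exp\Big(-\sum_{i=1}^k\mu_{\theta^i\omega}(A_n)\Big)\Big|=0 .$$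
   Context: $\mathbb{Z}^+=\{1,2,\dots\}$, $\mathbb{N}=\{0,1,2,\dots\}$. $\bar{\mathbb{Z}}^+=\mathbb{Z}^+\cup\{\infty\}$ is the one-point compactification of $\mathbb{Z}^+$, $X=(\bar{\mathbb{Z}}^+)^{\mathbb{N}}$ with the (compact metrizable) product topology, and $\sigma:X\to X$ is the left shift. Random subshift of finite type. $(\Omega,\mathcal{A},\mathbb{P})$ is an atomless standard probability space and $\theta:\Omega\to\Omega$ is an invertible, $\mathbb{P}$-preserving, ergodic map with measurable inverse. $b:\Omega\to\mathbb{Z}^+$ is a random variable with $\ln b\in L^1(\mathbb{P})$. A random transition matrix over $\theta$ is a family $Q=\{Q(\omega)=(a_{ij}(\omega))\}_{\omega\in\Omega}$ where $Q(\omega)$ is a $b(\omega)\times b(\theta\omega)$ matrix with entries in $\{0,1\}$, with at least one non-zero entry in each row and column, such that for all $i,j\in\mathbb{Z}^+$ the map equal to $a_{ij}(\omega)$ if $i\le b(\omega)$, $j\le b(\theta\omega)$, and $0$ otherwise, is measurable. Put $\mathcal{E}_\omega=\{x=(x_0,x_1,\dots)\in X: 1\le x_i\le b(\theta^i\omega),\ a_{x_ix_{i+1}}(\theta^i\omega)=1\ \forall i\in\mathbb{N}\}$, $\mathcal{E}_Q=\{(\omega,x):\omega\in\Omega,x\in\mathcal{E}_\omega\}$ and $S_Q(\omega,x)=(\theta\omega,\sigma x)$. The map $S_Q:\mathcal{E}_Q\to\mathcal{E}_Q$ is a random subshift of finite type. The disintegration $\{\mu_\omega\}$ of $\nu$ is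 the ($\mathbb{P}$-a.s. unique) measurable family of probability measures $\mu_\omega$ on $\mathcal{E}_\omega$ with $\int h\,d\nu=\int_\Omega\int h(\omega,x)\,d\mu_\omega(x)\,d\mathbb{P}(\omega)$ for $h\in L^1(\nu)$; for measurable $A\subseteq X$ write $\mu_\omega(A)=\mu_\omega(A\cap\mathcal{E}_\omega)$. $C_n(y)=\{z\in X: z_i=y_i,\ 0\le i\le n-1\}$ is the $n$-cylinder containing $y\in X$; $\mathcal{F}_0^n$ is the sigma-algebra on $X$ generated by all $n$-cylinders. $T_\omega^k(A)=\sum_{i=1}^k\mu_{\theta^i\omega}(A)$; $\tau_A(x)=\inf\{k>0:\sigma^k(x)\in A\}$; $\delta_s$ is the Dirac mass at $s$. Point processes on $[0,\infty)$ are random elements of the space of Radon point measures on $[0,\infty)$ with the topology in which $m_k\to m$ iff $m_k(B)\to m(B)$ for all pre-compact $B\subseteq[0,\infty)$ with $m(\partial B)=0$; convergence of point processes means convergence in distribution (weak convergence) for this topology. A uniform Poisson point process is a Poisson point process on $[0,\infty)$ whose mean measure is Lebesgue measure.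
   Formalization: In (IV), a mixing term with h=0 counts only if the bound in (III) for that function also holds at g=0; as written α(0), φ(0) are unconstrained and the claim fails, e.g. for a mixture of two Bernoulli measures with φ(0)=0 and φ(g)=1 for g≥1. *)

theory Defs
  imports "HOL-Probability.Probability"
begin

section \<open>The base system\<close>

definition isomorphic_mod_0 :: "'a measure \<Rightarrow> 'b measure \<Rightarrow> bool" where
  "isomorphic_mod_0 M N \<longleftrightarrow>
     (\<exists>A\<in>null_sets M. \<exists>B\<in>null_sets N. \<exists>f g.
        f \<in> restrict_space M (space M - A) \<rightarrow>\<^sub>M restrict_space N (space N - B) \<and>
        g \<in> restrict_space N (space N - B) \<rightarrow>\<^sub>M restrict_space M (space M - A) \<and>
        (\<forall>x\<in>space M - A. g (f x) = x) \<and>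
        (\<forall>y\<in>space N - B. f (g y) = y) \<and>
        distr (restrict_space M (space M - A)) (restrict_space N (space N - B)) f =
          restrict_space N (space N - B))"

text \<open>Every Polish space is Borel isomorphic to a Borel subset of the real line, so Borel
  probability measures on the line are enough as models. Comparing completions makes the
  definition cover both conventions in use: standard Borel spaces with a Borel probability
  measure, and (complete) Lebesgue-Rokhlin spaces.\<close>

definition standard_prob_space :: "'a measure \<Rightarrow> bool" where
  "standard_prob_space M \<longleftrightarrow> prob_space M \<and>
     (\<exists>L :: real measure. prob_space L \<and> sets L = sets borel \<and>
        isomorphic_mod_0 (completion M) (completion L))"

definition atomless :: "'a measure \<Rightarrow> bool" where
  "atomless M \<longleftrightarrow>
     (\<forall>A\<in>sets M. emeasure M A > 0 \<longrightarrow>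
        (\<exists>B\<in>sets M. B \<subseteq> A \<and> 0 < emeasure M B \<and> emeasure M B < emeasure M A))"

definition measure_preserving_map :: "'a measure \<Rightarrow> ('a \<Rightarrow> 'a) \<Rightarrow> bool" where
  "measure_preserving_map M T \<longleftrightarrow> T \<in> M \<rightarrow>\<^sub>M M \<and> distr M M T = M"

definition ergodic_automorphism :: "'a measure \<Rightarrow> ('a \<Rightarrow> 'a) \<Rightarrow> bool" where
  "ergodic_automorphism M \<theta> \<longleftrightarrow>
     bij_betw \<theta> (space M) (space M) \<and>
     measure_preserving_map M \<theta> \<and>
     the_inv_into (space M) \<theta> \<in> M \<rightarrow>\<^sub>M M \<and>
     (\<forall>A\<in>sets M. \<theta> -` A \<inter> space M = A \<longrightarrow> measure M A = 0 \<or> measure M A = 1)"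


section \<open>The sequence space\<close>

text \<open>The order topology of \<^typ>\<open>enat\<close>, restricted to the values \<open>\<ge> 1\<close>, is the one-point
  compactification of the positive integers, and functions carry the product topology.\<close>

definition seqs :: "(nat \<Rightarrow> enat) set" where
  "seqs = {x. \<forall>i. 1 \<le> x i}"

definition seq_algebra :: "(nat \<Rightarrow> enat) measure" where
  "seq_algebra = restrict_space borel seqs"

definition shift :: "nat \<Rightarrow> (nat \<Rightarrow> enat) \<Rightarrow> (nat \<Rightarrow> enat)" where
  "shift k x = (\<lambda>i. x (i + k))"

definition shift_preimage :: "nat \<Rightarrow> (nat \<Rightarrow> enat) set \<Rightarrow> (nat \<Rightarrow> enat) set" where
  "shift_preimage k A = {x \<in> seqs. shift k x \<in> A}"

definition cylinder :: "nat \<Rightarrow> (nat \<Rightarrow> enat) \<Rightarrow> (nat \<Rightarrow> enat) set" where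
  "cylinder n y = {z \<in> seqs. \<forall>i<n. z i = y i}"

definition cylinder_algebra :: "nat \<Rightarrow> (nat \<Rightarrow> enat) set set" where
  "cylinder_algebra n = sigma_sets seqs {cylinder n y | y. y \<in> seqs}"

text \<open>First hitting time; the infimum of the empty set is \<open>\<infinity>\<close>.\<close>

definition hitting_time :: "(nat \<Rightarrow> enat) set \<Rightarrow> (nat \<Rightarrow> enat) \<Rightarrow> enat" where
  "hitting_time A x = Inf {enat k | k. k > 0 \<and> shift k x \<in> A}"

text \<open>For \<open>A\<close> in \<open>cylinder_algebra n\<close> nonempty and \<open>n \<ge> 1\<close> the set on the right contains \<open>n\<close>.\<close>

definition first_overlap :: "(nat \<Rightarrow> enat) set \<Rightarrow> nat" where
  "first_overlap A = (LEAST j. j \<ge> 1 \<and> A \<inter> shift_preimage j A \<noteq> {})"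


section \<open>Random subshifts of finite type\<close>

text \<open>\<open>a \<omega> i j\<close> is the entry of the matrix at \<open>\<omega>\<close>; it is only meaningful for
  \<open>1 \<le> i \<le> b \<omega>\<close> and \<open>1 \<le> j \<le> b (\<theta> \<omega>)\<close>.\<close>

definition random_transition_matrix ::
    "'a measure \<Rightarrow> ('a \<Rightarrow> 'a) \<Rightarrow> ('a \<Rightarrow> nat) \<Rightarrow> ('a \<Rightarrow> nat \<Rightarrow> nat \<Rightarrow> nat) \<Rightarrow> bool" where
  "random_transition_matrix M \<theta> b a \<longleftrightarrow>
     (\<forall>\<omega>\<in>space M.
        (\<forall>i\<in>{1..b \<omega>}. \<forall>j\<in>{1..b (\<theta> \<omega>)}. a \<omega> i j \<in> {0, 1}) \<and>
        (\<forall>i\<in>{1..b \<omega>}. \<exists>j\<in>{1..b (\<theta> \<omega>)}. a \<omega> i j \<noteq> 0) \<and>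
        (\<forall>j\<in>{1..b (\<theta> \<omega>)}. \<exists>i\<in>{1..b \<omega>}. a \<omega> i j \<noteq> 0)) \<and>
     (\<forall>i\<ge>1. \<forall>j\<ge>1.
        (\<lambda>\<omega>. if i \<le> b \<omega> \<and> j \<le> b (\<theta> \<omega>) then a \<omega> i j else 0) \<in> M \<rightarrow>\<^sub>M count_space UNIV)"

definition random_sft ::
    "'a measure \<Rightarrow> ('a \<Rightarrow> 'a) \<Rightarrow> ('a \<Rightarrow> nat) \<Rightarrow> ('a \<Rightarrow> nat \<Rightarrow> nat \<Rightarrow> nat) \<Rightarrow> bool" where
  "random_sft M \<theta> b a \<longleftrightarrow>
     standard_prob_space M \<and> atomless M \<and> ergodic_automorphism M \<theta> \<and>
     b \<in> M \<rightarrow>\<^sub>M count_space UNIV \<and> (\<forall>\<omega>\<in>space M. b \<omega> \<ge> 1) \<and>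
     integrable M (\<lambda>\<omega>. ln (real (b \<omega>))) \<and>
     random_transition_matrix M \<theta> b a"

definition fiber ::
    "('a \<Rightarrow> 'a) \<Rightarrow> ('a \<Rightarrow> nat) \<Rightarrow> ('a \<Rightarrow> nat \<Rightarrow> nat \<Rightarrow> nat) \<Rightarrow> 'a \<Rightarrow> (nat \<Rightarrow> enat) set" where
  "fiber \<theta> b a \<omega> =
     {x \<in> seqs. \<forall>i. 1 \<le> x i \<and> x i \<le> enat (b ((\<theta> ^^ i) \<omega>)) \<and>
        a ((\<theta> ^^ i) \<omega>) (the_enat (x i)) (the_enat (x (Suc i))) = 1}"

definition sft_space ::
    "'a measure \<Rightarrow> ('a \<Rightarrow> 'a) \<Rightarrow> ('a \<Rightarrow> nat) \<Rightarrow> ('a \<Rightarrow> nat \<Rightarrow> nat \<Rightarrow> nat)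
      \<Rightarrow> ('a \<times> (nat \<Rightarrow> enat)) set" where
  "sft_space M \<theta> b a = {(\<omega>, x). \<omega> \<in> space M \<and> x \<in> fiber \<theta> b a \<omega>}"

definition skew_shift :: "('a \<Rightarrow> 'a) \<Rightarrow> 'a \<times> (nat \<Rightarrow> enat) \<Rightarrow> 'a \<times> (nat \<Rightarrow> enat)" where
  "skew_shift \<theta> = (\<lambda>(\<omega>, x). (\<theta> \<omega>, shift 1 x))"

definition invariant_measure_over ::
    "'a measure \<Rightarrow> ('a \<Rightarrow> 'a) \<Rightarrow> ('a \<Rightarrow> nat) \<Rightarrow> ('a \<Rightarrow> nat \<Rightarrow> nat \<Rightarrow> nat)
      \<Rightarrow> ('a \<times> (nat \<Rightarrow> enat)) measure \<Rightarrow> bool" where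
  "invariant_measure_over M \<theta> b a \<nu> \<longleftrightarrow>
     prob_space \<nu> \<and>
     sets \<nu> = sets (restrict_space (M \<Otimes>\<^sub>M seq_algebra) (sft_space M \<theta> b a)) \<and>
     measure_preserving_map \<nu> (skew_shift \<theta>) \<and>
     distr \<nu> M fst = M"

definition disintegration ::
    "'a measure \<Rightarrow> ('a \<Rightarrow> 'a) \<Rightarrow> ('a \<Rightarrow> nat) \<Rightarrow> ('a \<Rightarrow> nat \<Rightarrow> nat \<Rightarrow> nat)
      \<Rightarrow> ('a \<times> (nat \<Rightarrow> enat)) measure \<Rightarrow> ('a \<Rightarrow> (nat \<Rightarrow> enat) measure) \<Rightarrow> bool" where
  "disintegration M \<theta> b a \<nu> \<mu> \<longleftrightarrow>
     (\<forall>\<omega>\<in>space M. prob_space (\<mu> \<omega>) \<and>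
        sets (\<mu> \<omega>) = sets (restrict_space seq_algebra (fiber \<theta> b a \<omega>))) \<and>
     (\<forall>A\<in>sets seq_algebra.
        (\<lambda>\<omega>. measure (\<mu> \<omega>) (A \<inter> fiber \<theta> b a \<omega>)) \<in> borel_measurable M) \<and>
     (\<forall>h :: 'a \<times> (nat \<Rightarrow> enat) \<Rightarrow> real. integrable \<nu> h \<longrightarrow>
        (\<integral>z. h z \<partial>\<nu>) = (\<integral>\<omega>. (\<integral>x. h (\<omega>, x) \<partial>\<mu> \<omega>) \<partial>M))"

text \<open>If \<open>\<mu>\<close> is a disintegration then \<open>space (\<mu> \<omega>)\<close> is the fiber over \<open>\<omega>\<close>.\<close>

definition fiber_measure ::
    "('a \<Rightarrow> (nat \<Rightarrow> enat) measure) \<Rightarrow> 'a \<Rightarrow> (nat \<Rightarrow> enat) set \<Rightarrow> real" where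
  "fiber_measure \<mu> \<omega> A = measure (\<mu> \<omega>) (A \<inter> space (\<mu> \<omega>))"

definition ess_sup_measure ::
    "'a measure \<Rightarrow> ('a \<Rightarrow> (nat \<Rightarrow> enat) measure) \<Rightarrow> (nat \<Rightarrow> enat) set \<Rightarrow> real" where
  "ess_sup_measure M \<mu> A = real_of_ereal (esssup M (\<lambda>\<omega>. ereal (fiber_measure \<mu> \<omega> A)))"

definition fiber_time ::
    "('a \<Rightarrow> 'a) \<Rightarrow> ('a \<Rightarrow> (nat \<Rightarrow> enat) measure) \<Rightarrow> (nat \<Rightarrow> enat) set \<Rightarrow> 'a \<Rightarrow> nat \<Rightarrow> real" where
  "fiber_time \<theta> \<mu> A \<omega> k = (\<Sum>i=1..k. fiber_measure \<mu> ((\<theta> ^^ i) \<omega>) A)"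


section \<open>Fibered mixing\<close>

definition fibered_correlation ::
    "('a \<Rightarrow> 'a) \<Rightarrow> ('a \<Rightarrow> (nat \<Rightarrow> enat) measure) \<Rightarrow> nat \<Rightarrow>
      (nat \<Rightarrow> enat) set \<Rightarrow> (nat \<Rightarrow> enat) set \<Rightarrow> 'a \<Rightarrow> real" where
  "fibered_correlation \<theta> \<mu> k A B \<omega> =
     \<bar>fiber_measure \<mu> \<omega> (A \<inter> shift_preimage k B)
       - fiber_measure \<mu> \<omega> A * fiber_measure \<mu> ((\<theta> ^^ k) \<omega>) B\<bar>"

text \<open>The set \<open>G\<close> of gaps is a parameter because the error term further below needs the bound at
  gap \<open>0\<close> as well when it is evaluated there.\<close>

definition uniform_fibered_mixing ::
    "nat set \<Rightarrow> 'a measure \<Rightarrow> ('a \<Rightarrow> 'a) \<Rightarrow> ('a \<Rightarrow> (nat \<Rightarrow> enat) measure)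
      \<Rightarrow> ('a \<Rightarrow> real) \<Rightarrow> (nat \<Rightarrow> real) \<Rightarrow> bool" where
  "uniform_fibered_mixing G M \<theta> \<mu> D \<alpha> \<longleftrightarrow>
     (\<forall>m\<ge>1. \<forall>n\<ge>1. \<forall>A\<in>cylinder_algebra n. \<forall>B\<in>cylinder_algebra m.
        AE \<omega> in M. \<forall>g\<in>G. fibered_correlation \<theta> \<mu> (g + n) A B \<omega> \<le> D \<omega> * \<alpha> g)"

definition fibered_phi_mixing ::
    "nat set \<Rightarrow> 'a measure \<Rightarrow> ('a \<Rightarrow> 'a) \<Rightarrow> ('a \<Rightarrow> (nat \<Rightarrow> enat) measure)
      \<Rightarrow> (nat \<Rightarrow> real) \<Rightarrow> bool" where
  "fibered_phi_mixing G M \<theta> \<mu> \<phi> \<longleftrightarrow>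
     (\<forall>m\<ge>1. \<forall>n\<ge>1. \<forall>A\<in>cylinder_algebra n. \<forall>B\<in>cylinder_algebra m.
        AE \<omega> in M. \<forall>g\<in>G. fibered_correlation \<theta> \<mu> (g + n) A B \<omega> \<le> fiber_measure \<mu> \<omega> A * \<phi> g)"

text \<open>The minimum of \<open>\<alpha> h * k powr (1/p)\<close> and \<open>\<phi> h\<close>, where only those terms count whose mixing
  condition holds; an omitted term is \<open>\<infinity>\<close>. For \<open>h \<ge> 1\<close> one has \<open>insert h {1..} = {1..}\<close>. For
  \<open>h = 0\<close> the bound is also required at gap \<open>0\<close>, because the condition at gaps \<open>\<ge> 1\<close> says
  nothing about \<open>\<alpha> 0\<close> and \<open>\<phi> 0\<close>: with \<open>\<phi> 0 = 0\<close> and \<open>\<phi> g = 1\<close> for \<open>g \<ge> 1\<close>, a value at \<open>0\<close>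
  that is not tied to the measure would make the term vanish for every measure.\<close>

definition mixing_error ::
    "'a measure \<Rightarrow> ('a \<Rightarrow> 'a) \<Rightarrow> ('a \<Rightarrow> (nat \<Rightarrow> enat) measure) \<Rightarrow> ('a \<Rightarrow> real) \<Rightarrow> real
      \<Rightarrow> (nat \<Rightarrow> real) \<Rightarrow> (nat \<Rightarrow> real) \<Rightarrow> nat \<Rightarrow> nat \<Rightarrow> ereal" where
  "mixing_error M \<theta> \<mu> D p \<alpha> \<phi> h k =
     min (if uniform_fibered_mixing (insert h {1..}) M \<theta> \<mu> D \<alpha>
          then ereal (\<alpha> h * real k powr (1 / p)) else \<infinity>)
         (if fibered_phi_mixing (insert h {1..}) M \<theta> \<mu> \<phi> then ereal (\<phi> h) else \<infinity>)"

definition finite_interval_union :: "real set \<Rightarrow> bool" where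
  "finite_interval_union R \<longleftrightarrow>
     (\<exists>I :: (real \<times> real) set. finite I \<and> I \<noteq> {} \<and>
        (\<forall>(c, d)\<in>I. 0 \<le> c \<and> c < d) \<and>
        disjoint_family_on (\<lambda>(c, d). {c<..<d}) I \<and>
        R = (\<Union>(c, d)\<in>I. {c<..<d}))"

text \<open>Under the hypotheses of the limit theorem, for almost every \<open>\<omega>\<close> and all large \<open>n\<close> the set
  is finite and nonempty, so that the maximum is meaningful.\<close>

definition last_time_in ::
    "('a \<Rightarrow> 'a) \<Rightarrow> ('a \<Rightarrow> (nat \<Rightarrow> enat) measure) \<Rightarrow> (nat \<Rightarrow> enat) set \<Rightarrow> 'a \<Rightarrow> real set \<Rightarrow> nat"
  where
  "last_time_in \<theta> \<mu> A \<omega> R = Max {k. k \<ge> 1 \<and> fiber_time \<theta> \<mu> A \<omega> k \<le> Sup R}"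


section \<open>Point processes on the half-line\<close>

definition half_line :: "real measure" where
  "half_line = restrict_space borel {0..}"

text \<open>The sum of the Dirac masses at \<open>s k\<close>, \<open>k \<in> K\<close>, as an image of counting measure.\<close>

definition dirac_sum :: "nat set \<Rightarrow> (nat \<Rightarrow> real) \<Rightarrow> real measure" where
  "dirac_sum K s = distr (count_space K) half_line s"

lemma emeasure_dirac_sum:
  assumes s: "\<And>k. k \<in> K \<Longrightarrow> 0 \<le> s k" and B: "B \<in> sets half_line"
  shows "emeasure (dirac_sum K s) B = (\<Sum>k. if k \<in> K then indicator B (s k) else 0)"
proof -
  have m: "s \<in> count_space K \<rightarrow>\<^sub>M half_line"
    using s by (auto simp: half_line_def space_restrict_space)
  have "emeasure (dirac_sum K s) B = emeasure (count_space K) (s -` B \<inter> K)"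
    unfolding dirac_sum_def using m B by (simp add: emeasure_distr)
  also have "\<dots> = emeasure (count_space UNIV) (s -` B \<inter> K)"
    by (simp add: emeasure_count_space)
  also have "\<dots> = (\<integral>\<^sup>+k. indicator (s -` B \<inter> K) k \<partial>count_space UNIV)"
    by simp
  also have "\<dots> = (\<Sum>k. indicator (s -` B \<inter> K) k)"
    by (rule nn_integral_count_space_nat)
  also have "\<dots> = (\<Sum>k. if k \<in> K then indicator B (s k) else 0)"
    by (intro suminf_cong) (auto simp: indicator_def)
  finally show ?thesis .
qed

definition radon_point_measures :: "real measure set" where
  "radon_point_measures =
     {m. (\<exists>K s. (\<forall>k\<in>K. 0 \<le> s k) \<and> m = dirac_sum K s) \<and>
         (\<forall>C. compact C \<and> C \<subseteq> {0..} \<longrightarrow> emeasure m C < \<infinity>)}"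

text \<open>The boundary is taken in \<open>{0..}\<close>, so that \<open>0\<close> is not a boundary point of \<open>{0..<1}\<close>.\<close>

definition vaguely_converges :: "(nat \<Rightarrow> real measure) \<Rightarrow> real measure \<Rightarrow> bool" where
  "vaguely_converges ms m \<longleftrightarrow>
     (\<forall>B\<in>sets half_line. compact (closure B) \<and> emeasure m (top_of_set {0..} frontier_of B) = 0 \<longrightarrow>
        (\<lambda>k. emeasure (ms k) B) \<longlonglongrightarrow> emeasure m B)"

text \<open>This topology is metrizable, hence determined by its convergent sequences: a set is open
  iff every sequence converging to one of its points is eventually inside it.\<close>

definition point_measure_topology :: "real measure topology" where
  "point_measure_topology = topology (\<lambda>U. U \<subseteq> radon_point_measures \<and>
     (\<forall>m\<in>U. \<forall>ms. range ms \<subseteq> radon_point_measures \<and> vaguely_converges ms m \<longrightarrow>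
        (\<forall>\<^sub>F k in sequentially. ms k \<in> U)))"

lemma openin_point_measure_topology:
  "openin point_measure_topology U \<longleftrightarrow> U \<subseteq> radon_point_measures \<and>
     (\<forall>m\<in>U. \<forall>ms. range ms \<subseteq> radon_point_measures \<and> vaguely_converges ms m \<longrightarrow>
        (\<forall>\<^sub>F k in sequentially. ms k \<in> U))"
proof -
  have "istopology (\<lambda>U. U \<subseteq> radon_point_measures \<and>
     (\<forall>m\<in>U. \<forall>ms. range ms \<subseteq> radon_point_measures \<and> vaguely_converges ms m \<longrightarrow>
        (\<forall>\<^sub>F k in sequentially. ms k \<in> U)))"
    unfolding istopology_def
  proof (intro conjI allI impI, goal_cases)
    case (1 S T)
    then show ?case by blast
  next
    case (2 S T)
    then show ?case by (auto simp: eventually_conj_iff)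
  next
    case (3 \<K>)
    then show ?case by blast
  next
    case (4 \<K>)
    show ?case
    proof (intro ballI allI impI)
      fix m ms assume m: "m \<in> \<Union>\<K>"
        and ms: "range ms \<subseteq> radon_point_measures \<and> vaguely_converges ms m"
      then obtain U where "U \<in> \<K>" "m \<in> U" by blast
      with 4 ms have "\<forall>\<^sub>F k in sequentially. ms k \<in> U" by blast
      then show "\<forall>\<^sub>F k in sequentially. ms k \<in> \<Union>\<K>"
        by eventually_elim (use \<open>U \<in> \<K>\<close> in blast)
    qed
  qed
  then show ?thesis
    unfolding point_measure_topology_def by (simp add: topology_inverse')
qed

lemma topspace_point_measure_topology: "topspace point_measure_topology = radon_point_measures"
proof
  show "topspace point_measure_topology \<subseteq> radon_point_measures"
    using openin_point_measure_topology openin_topspace by blast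
  have "openin point_measure_topology radon_point_measures"
    unfolding openin_point_measure_topology by (auto intro!: always_eventually)
  then show "radon_point_measures \<subseteq> topspace point_measure_topology"
    by (rule openin_subset)
qed

definition point_measure_algebra :: "real measure measure" where
  "point_measure_algebra =
     sigma radon_point_measures {U. openin point_measure_topology U}"

definition point_process :: "'b measure \<Rightarrow> ('b \<Rightarrow> real measure) \<Rightarrow> bool" where
  "point_process P N \<longleftrightarrow> prob_space P \<and> N \<in> P \<rightarrow>\<^sub>M point_measure_algebra"

text \<open>\<open>L\<close> is the law of the limiting process.\<close>

definition converges_in_distribution ::
    "'b measure \<Rightarrow> (nat \<Rightarrow> 'b \<Rightarrow> real measure) \<Rightarrow> real measure measure \<Rightarrow> bool" where
  "converges_in_distribution P N L \<longleftrightarrow>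
     (\<forall>f. continuous_map point_measure_topology euclideanreal f \<and>
          bounded (f ` radon_point_measures) \<longrightarrow>
        (\<lambda>n. \<integral>x. f (N n x) \<partial>P) \<longlonglongrightarrow> (\<integral>m. f m \<partial>L))"

definition uniform_poisson_law :: "real measure measure \<Rightarrow> bool" where
  "uniform_poisson_law L \<longleftrightarrow>
     prob_space L \<and> sets L = sets point_measure_algebra \<and>
     (\<forall>B\<in>sets half_line. emeasure lborel B < \<infinity> \<longrightarrow>
        (\<forall>j::nat. measure L {m \<in> space L. emeasure m B = of_nat j} =
           exp (- measure lborel B) * measure lborel B ^ j / fact j)) \<and>
     (\<forall>\<B>. finite \<B> \<and> \<B> \<subseteq> sets half_line \<and> disjoint \<B> \<longrightarrow>
        prob_space.indep_vars L (\<lambda>_. borel :: ennreal measure) (\<lambda>B m. emeasure m B) \<B>)"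

definition hitting_process ::
    "('a \<Rightarrow> 'a) \<Rightarrow> ('a \<Rightarrow> (nat \<Rightarrow> enat) measure) \<Rightarrow> (nat \<Rightarrow> enat) set \<Rightarrow> 'a \<Rightarrow> (nat \<Rightarrow> enat)
      \<Rightarrow> real measure" where
  "hitting_process \<theta> \<mu> A \<omega> x =
     dirac_sum {k. k \<ge> 1 \<and> shift k x \<in> A} (fiber_time \<theta> \<mu> A \<omega>)"

end

theory Submission
  imports Defs
begin

text \<open>
  Fix a typical \<open>\<omega>\<close>. To avoid \<open>A\<^sub>n\<close> at a finite set \<open>S\<close> of times has probability close to
  \<open>\<Prod>k\<in>S. 1 - \<mu>\<^bsub>\<theta>^k \<omega>\<^esub>(A\<^sub>n)\<close>, and hence to \<open>exp (- (\<Sum>k\<in>S. \<mu>\<^bsub>\<theta>^k \<omega>\<^esub>(A\<^sub>n)))\<close>: remove the times in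
  increasing order, open a gap of length \<open>h + n\<close> after each of them at the cost of the short returns,
  and apply mixing across the gap. In the \<open>\<alpha>\<close>-mixing case the accumulated error is
  \<open>\<alpha>(h)\<close> times the sum of \<open>D(\<theta>^k \<omega>)\<close> over the first \<open>k\<^sub>n\<close> indices, which is \<open>O(k\<^sub>n\<^sup>1\<^sup>/\<^sup>p)\<close> by the maximal
  ergodic theorem for \<open>D\<^sup>p\<close>. The avoidance probabilities of finite unions of dyadic intervals
  together with the intensities then force convergence to the Poisson process, since the occupied
  cells of a fine dyadic partition determine a point measure up to an error that vanishes with
  the mesh, and an open set of point measures is an increasing union of events that depend on
  finitely many dyadic counts.
\<close>

section \<open>Elementary inequalities\<close>

text \<open>A hit at step k is recorded at the clock value \<open>fiber_time\<close>, whose k-th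
  increment is the probability of that hit. The mean number of points in an interval is therefore
  its length up to two increments, and these are at most \<epsilon>(n). All that is required of the
  clock is that it diverges, which follows from recurrence. Void probabilities cannot see
  multiplicities. The means repair this: mean minus probability of being hit bounds the probability
  of two points in a cell. For a cell of length x the limit of this excess is below x^2, and only
  about 1/x cells meet a bounded window. The topology on point measures is given through its
  convergent sequences alone. Convergence in distribution is obtained from lower bounds for open
  sets, which inner approximation supplies, in place of a metric or a tightness argument. The mixing
  conditions hold almost everywhere for each fixed pair of sets, so the pairs in use are confined to
  a countable family before \<omega> is fixed, and every property is then taken along the whole
  orbit. The conclusion asserts that a Poisson law exists, so one is constructed.\<close>

lemma exp_minus_less_quadratic:
  assumes "0 < (x::real)"
  shows "exp (- x) < 1 - x + x\<^sup>2"
proof -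
  \<comment> \<open>It suffices that \<open>1 - x + x\<^sup>2\<close> times the quadratic Taylor
    polynomial of \<open>exp x\<close> exceeds 1. Strictness matters later, where a limit has to lie
    strictly below a threshold in order to be eventually below it.\<close>
  have "1 + x + x\<^sup>2 / 2 \<le> exp x" using exp_lower_Taylor_quadratic[of x] assms by simp
  moreover have "1 - x + x\<^sup>2 = (x - 1 / 2)\<^sup>2 + 3 / 4" by (simp add: power2_eq_square algebra_simps)
  then have "0 < 1 - x + x\<^sup>2" by (simp add: add_nonneg_pos)
  moreover have "1 < (1 - x + x\<^sup>2) * (1 + x + x\<^sup>2 / 2)"
  proof -
    have "(1 - x + x\<^sup>2) * (1 + x + x\<^sup>2 / 2) = 1 + (x\<^sup>2 / 2 + x ^ 3 / 2 + x ^ 4 / 2)"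
      by (simp add: power2_eq_square power3_eq_cube power4_eq_xxxx field_simps)
    also have "\<dots> > 1" using assms by (auto intro!: add_pos_pos)
    finally show ?thesis .
  qed
  ultimately have "1 < (1 - x + x\<^sup>2) * exp x"
    by (smt (verit) mult_left_mono)
  then show ?thesis by (simp add: exp_minus field_simps)
qed

text \<open>The fractions x/(x+y) and y/(x+y) lie in [0,1], where z \<le> z^p for p \<le> 1, and
  they add up to 1; multiplying by (x+y)^p gives the claim.\<close>

lemma powr_add_le:
  fixes x y p :: real
  assumes "0 \<le> x" "0 \<le> y" "0 < p" "p \<le> 1"
  shows "(x + y) powr p \<le> x powr p + y powr p"
proof (cases "x + y = 0")
  case False
  then have s: "0 < x + y" using assms by linarith
  have le: "z / (x + y) \<le> (z / (x + y)) powr p" if "0 \<le> z" "z \<le> x + y" for z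
    using powr_mono'[of p 1 "z / (x + y)"] that s assms by simp
  have eq: "(z / (x + y)) powr p * (x + y) powr p = z powr p" if "0 \<le> z" for z
    using that s by (simp flip: powr_mult)
  have "1 = x / (x + y) + y / (x + y)" using s by (simp add: add_divide_distrib[symmetric])
  also have "\<dots> \<le> (x / (x + y)) powr p + (y / (x + y)) powr p"
    using le[of x] le[of y] assms by linarith
  finally have "1 * (x + y) powr p \<le> ((x / (x + y)) powr p + (y / (x + y)) powr p) * (x + y) powr p"
    by (intro mult_right_mono) auto
  then show ?thesis using eq[OF assms(1)] eq[OF assms(2)] by (simp add: distrib_right)
qed (use assms in auto)

text \<open>Turns control of sums of D^p along an orbit into control of sums of D, which itself need
  not be integrable.\<close>

lemma powr_sum_le:
  fixes f :: "'a \<Rightarrow> real"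
  assumes "finite I" "\<And>i. i \<in> I \<Longrightarrow> 0 \<le> f i" "0 < p" "p \<le> 1"
  shows "(\<Sum>i\<in>I. f i) powr p \<le> (\<Sum>i\<in>I. f i powr p)"
  using assms
proof (induction I rule: finite_induct)
  case (insert i I)
  have "(\<Sum>i\<in>insert i I. f i) powr p = (f i + (\<Sum>i\<in>I. f i)) powr p" using insert by simp
  also have "\<dots> \<le> f i powr p + (\<Sum>i\<in>I. f i) powr p"
    by (rule powr_add_le) (use insert in \<open>auto intro: sum_nonneg\<close>)
  finally show ?case using insert by simp
qed simp

text \<open>All factors on both sides lie in [0,1], so the products differ by at most the sum of the
  differences of the factors, each between 0 and q^2. The sum of squares is at most the largest q
  times the sum, hence small when the hits are rare and the total mass is bounded.\<close>

lemma prod_one_minus_exp_diff: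
  fixes q :: "'a \<Rightarrow> real"
  assumes "finite I" and q: "\<And>i. i \<in> I \<Longrightarrow> 0 \<le> q i" "\<And>i. i \<in> I \<Longrightarrow> q i \<le> 1"
  shows "\<bar>(\<Prod>i\<in>I. 1 - q i) - exp (- (\<Sum>i\<in>I. q i))\<bar> \<le> (\<Sum>i\<in>I. (q i)\<^sup>2)"
proof -
  have "exp (- (\<Sum>i\<in>I. q i)) = (\<Prod>i\<in>I. exp (- q i))"
    using exp_sum[OF assms(1), of "\<lambda>i. - q i"] by (simp add: sum_negf)
  moreover have "norm ((\<Prod>i\<in>I. 1 - q i) - (\<Prod>i\<in>I. exp (- q i))) \<le> (\<Sum>i\<in>I. norm (1 - q i - exp (- q i)))"
    by (rule norm_prod_diff) (use q in auto)
  moreover have "(\<Sum>i\<in>I. norm (1 - q i - exp (- q i))) \<le> (\<Sum>i\<in>I. (q i)\<^sup>2)"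
  proof (rule sum_mono)
    fix i assume i: "i \<in> I"
    have "1 - q i \<le> exp (- q i)" using exp_ge_add_one_self[of "- q i"] by simp
    moreover have "exp (- q i) \<le> 1 - q i + (q i)\<^sup>2"
      using exp_minus_less_quadratic[of "q i"] q(1)[OF i] by (cases "q i = 0") auto
    ultimately show "norm (1 - q i - exp (- q i)) \<le> (q i)\<^sup>2" by simp
  qed
  ultimately show ?thesis by simp
qed

section \<open>Ergodic theory\<close>

lemma measure_preserving_funpow:
  assumes "measure_preserving_map M T"
  shows "measure_preserving_map M (T ^^ k)"
proof (induction k)
  case 0
  then show ?case by (simp add: measure_preserving_map_def distr_id2)
next
  case (Suc k)
  have T: "T \<in> M \<rightarrow>\<^sub>M M" "distr M M T = M"
    and Tk: "T ^^ k \<in> M \<rightarrow>\<^sub>M M" "distr M M (T ^^ k) = M"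
    using assms Suc by (auto simp: measure_preserving_map_def)
  have "distr M M (T \<circ> (T ^^ k)) = M"
    using distr_distr[OF T(1) Tk(1)] T Tk by simp
  with T Tk show ?case
    by (auto simp: measure_preserving_map_def comp_def)
qed

lemma AE_measure_preserving:
  assumes "measure_preserving_map M T" and "AE x in M. P x"
  shows "AE x in M. P (T x)"
proof -
  have T: "T \<in> M \<rightarrow>\<^sub>M M" "distr M M T = M" using assms by (auto simp: measure_preserving_map_def)
  show ?thesis by (rule AE_distrD[OF T(1), of P]) (unfold T(2), fact assms(2))
qed

text \<open>The argument visits all fibers over one orbit, while the hypotheses speak of almost
  every single fiber; since an orbit is countable, the exceptional sets can be united.\<close>

lemma AE_all_iterates:
  assumes "measure_preserving_map M T" and "AE x in M. P x"
  shows "AE x in M. \<forall>k. P ((T ^^ k) x)"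
  using AE_measure_preserving[OF measure_preserving_funpow[OF assms(1)] assms(2)]
  by (simp add: AE_all_countable)

lemma integral_measure_preserving:
  fixes f :: "'a \<Rightarrow> real"
  assumes "measure_preserving_map M T" and "f \<in> borel_measurable M"
  shows "(\<integral>x. f (T x) \<partial>M) = (\<integral>x. f x \<partial>M)"
  using assms integral_distr[of T M M f] by (simp add: measure_preserving_map_def)

lemma integrable_measure_preserving:
  fixes f :: "'a \<Rightarrow> real"
  assumes "measure_preserving_map M T" and "integrable M f"
  shows "integrable M (\<lambda>x. f (T x))"
  using assms integrable_distr[of T M M f] by (simp add: measure_preserving_map_def)

lemma measure_measure_preserving:
  assumes "measure_preserving_map M T" and "B \<in> sets M"
  shows "measure M (T -` B \<inter> space M) = measure M B"
  using assms measure_distr[of T M M B] by (simp add: measure_preserving_map_def)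

text \<open>The maximum of the ergodic sums of lengths 0 to n, obtained by peeling off the first
  point of the orbit. In this recursive form integrability is a plain induction, and the inequality
  behind the maximal theorem is one unfolding.\<close>

primrec max_ergodic_sum :: "('a \<Rightarrow> 'a) \<Rightarrow> ('a \<Rightarrow> real) \<Rightarrow> nat \<Rightarrow> 'a \<Rightarrow> real" where
  "max_ergodic_sum T f 0 x = 0"
| "max_ergodic_sum T f (Suc n) x = max 0 (f x + max_ergodic_sum T f n (T x))"

lemma max_ergodic_sum_nonneg: "0 \<le> max_ergodic_sum T f n x"
  by (cases n) auto

lemma max_ergodic_sum_mono: "max_ergodic_sum T f n x \<le> max_ergodic_sum T f (Suc n) x"
proof (induction n arbitrary: x)
  case (Suc n)
  show ?case using Suc[of "T x"] by (simp add: max_def)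
qed simp

lemma ergodic_sum_le_max_ergodic_sum:
  assumes "k \<le> n"
  shows "(\<Sum>i<k. f ((T ^^ i) x)) \<le> max_ergodic_sum T f n x"
  using assms
proof (induction k arbitrary: n x)
  case 0
  then show ?case by (simp add: max_ergodic_sum_nonneg)
next
  case (Suc k)
  obtain m where m: "n = Suc m" "k \<le> m" using Suc.prems by (cases n) auto
  have "(\<Sum>i<Suc k. f ((T ^^ i) x)) = f x + (\<Sum>i<k. f ((T ^^ i) (T x)))"
    by (simp add: sum.lessThan_Suc_shift funpow_swap1 del: sum.lessThan_Suc)
  also have "\<dots> \<le> f x + max_ergodic_sum T f m (T x)"
    using Suc.IH[OF m(2)] by simp
  finally show ?case using m by simp
qed

lemma integrable_max_ergodic_sum:
  assumes "measure_preserving_map M T" and "integrable M f"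
  shows "integrable M (max_ergodic_sum T f n)"
proof (induction n)
  case (Suc n)
  have "max_ergodic_sum T f (Suc n) = (\<lambda>x. max 0 (f x + max_ergodic_sum T f n (T x)))"
    by auto
  then show ?case
    using assms integrable_measure_preserving[OF assms(1) Suc] by simp
qed (simp add: fun_eq_iff cong: integrable_cong)

text \<open>On the set where it is positive, the maximal sum exceeds its composition with \<open>T\<close> by at
  most \<open>f\<close>; integrating gives the maximal ergodic theorem.\<close>

lemma maximal_ergodic_theorem:
  assumes T: "measure_preserving_map M T" and f: "integrable M f"
  shows "0 \<le> (\<integral>x. f x * indicator {x \<in> space M. 0 < max_ergodic_sum T f n x} x \<partial>M)"
proof -
  let ?G = "max_ergodic_sum T f n" and ?I = "indicator {x \<in> space M. 0 < max_ergodic_sum T f n x}"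
  have G: "integrable M ?G" by (rule integrable_max_ergodic_sum[OF T f])
  then have GT: "integrable M (\<lambda>x. ?G (T x))" by (rule integrable_measure_preserving[OF T])
  have [measurable]: "?G \<in> borel_measurable M" using G by auto
  have "0 = (\<integral>x. ?G x - ?G (T x) \<partial>M)"
    using G GT integral_measure_preserving[OF T, of ?G] by (simp add: Bochner_Integration.integral_diff)
  also have "\<dots> \<le> (\<integral>x. f x * ?I x \<partial>M)"
  proof (rule integral_mono)
    show "integrable M (\<lambda>x. f x * ?I x)"
      by (intro integrable_real_mult_indicator f) measurable
    fix x assume x: "x \<in> space M"
    show "?G x - ?G (T x) \<le> f x * ?I x"
    proof (cases "0 < ?G x")
      case True
      then obtain m where m: "n = Suc m" by (cases n) auto
      have "?G x = f x + max_ergodic_sum T f m (T x)" using True m by (auto simp: max_def split: if_splits)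
      then show ?thesis using max_ergodic_sum_mono[of T f m "T x"] True x m by simp
    next
      case False
      then show ?thesis
        using max_ergodic_sum_nonneg[of T f n x] max_ergodic_sum_nonneg[of T f n "T x"] by simp
    qed
  qed (use G GT in auto)
  finally show ?thesis .
qed

text \<open>The maximal theorem for f - c: an ergodic sum of f of length K exceeds cK exactly when
  that of f - c is positive. The event is thus covered by the increasing sets on which the maximal
  sum of f - c is positive, each of measure at most E(f)/c.\<close>

lemma (in prob_space) maximal_ergodic_inequality:
  assumes T: "measure_preserving_map M T" and f: "integrable M f" and f0: "\<And>x. x \<in> space M \<Longrightarrow> 0 \<le> f x"
    and c: "0 < c"
  shows "c * prob {x \<in> space M. \<exists>K. c * real K < (\<Sum>k<K. f ((T ^^ k) x))} \<le> expectation f"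
proof -
  define g where "g = (\<lambda>x. f x - c)"
  have g: "integrable M g" unfolding g_def using f by simp
  have Gm[measurable]: "max_ergodic_sum T g n \<in> borel_measurable M" for n
    using integrable_max_ergodic_sum[OF T g] by auto
  define B where "B = (\<lambda>n. {x \<in> space M. 0 < max_ergodic_sum T g n x})"
  have Bm[measurable]: "B n \<in> sets M" for n unfolding B_def by measurable
  have bound: "c * prob (B n) \<le> expectation f" for n
  proof -
    have "0 \<le> (\<integral>x. g x * indicator (B n) x \<partial>M)"
      unfolding B_def by (rule maximal_ergodic_theorem[OF T g])
    also have "\<dots> = (\<integral>x. f x * indicator (B n) x - c * indicator (B n) x \<partial>M)"
      by (simp add: g_def algebra_simps)
    also have "\<dots> = (\<integral>x. f x * indicator (B n) x \<partial>M) - c * prob (B n)"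
      using integrable_real_mult_indicator[OF Bm f]
      by (subst Bochner_Integration.integral_diff) (auto simp: emeasure_eq_measure)
    also have "(\<integral>x. f x * indicator (B n) x \<partial>M) \<le> expectation f"
      by (rule integral_mono) (use f f0 integrable_real_mult_indicator[OF Bm f] in \<open>auto simp: indicator_def\<close>)
    finally show ?thesis by simp
  qed
  have inc: "incseq B"
    unfolding B_def by (rule incseq_SucI) (use max_ergodic_sum_mono[of T g] in \<open>auto intro: less_le_trans\<close>)
  have sub: "{x \<in> space M. \<exists>K. c * real K < (\<Sum>k<K. f ((T ^^ k) x))} \<subseteq> (\<Union>n. B n)"
  proof safe
    fix x K assume x: "x \<in> space M" and "c * real K < (\<Sum>k<K. f ((T ^^ k) x))"
    then have "0 < (\<Sum>k<K. g ((T ^^ k) x))" by (simp add: g_def sum_subtractf mult.commute)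
    also have "\<dots> \<le> max_ergodic_sum T g K x" by (rule ergodic_sum_le_max_ergodic_sum) simp
    finally show "x \<in> (\<Union>n. B n)" using x by (auto simp: B_def)
  qed
  have "(\<lambda>n. c * prob (B n)) \<longlonglongrightarrow> c * prob (\<Union>n. B n)"
    by (intro tendsto_intros finite_Lim_measure_incseq inc) auto
  then have "c * prob (\<Union>n. B n) \<le> expectation f"
    by (rule LIMSEQ_le_const2) (use bound in auto)
  moreover have "c * prob {x \<in> space M. \<exists>K. c * real K < (\<Sum>k<K. f ((T ^^ k) x))} \<le> c * prob (\<Union>n. B n)"
    using sub c by (intro mult_left_mono finite_measure_mono) auto
  ultimately show ?thesis by linarith
qed

text \<open>Boundedness of the averages is all that the error estimate asks for, and it follows from
  the maximal inequality alone: a point at which every constant fails lies in all exceedance sets,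
  whose measures are at most E(f)/c for arbitrarily large c.\<close>

lemma (in prob_space) AE_bounded_ergodic_averages:
  assumes T: "measure_preserving_map M T" and f: "integrable M f" and f0: "\<And>x. x \<in> space M \<Longrightarrow> 0 \<le> f x"
  shows "AE x in M. \<exists>C. \<forall>K. (\<Sum>k<K. f ((T ^^ k) x)) \<le> C * real K"
proof -
  define B where "B c = {x \<in> space M. \<exists>K. c * real K < (\<Sum>k<K. f ((T ^^ k) x))}" for c
  have [measurable]: "T ^^ k \<in> M \<rightarrow>\<^sub>M M" for k
    using measure_preserving_funpow[OF T] by (simp add: measure_preserving_map_def)
  have [measurable]: "f \<in> borel_measurable M" using f by auto
  have Bm[measurable]: "B c \<in> sets M" for c unfolding B_def by measurable
  have "prob (\<Inter>c. B (real (Suc c))) \<le> expectation f / real (Suc c)" for c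
  proof -
    have "prob (\<Inter>c. B (real (Suc c))) \<le> prob (B (real (Suc c)))"
      by (rule finite_measure_mono) auto
    also have "\<dots> \<le> expectation f / real (Suc c)"
      using maximal_ergodic_inequality[OF T f f0, of "real (Suc c)"]
      by (simp add: B_def pos_le_divide_eq mult.commute del: of_nat_Suc)
    finally show ?thesis .
  qed
  moreover have "(\<lambda>c. expectation f / real (Suc c)) \<longlonglongrightarrow> 0"
    using LIMSEQ_Suc[OF lim_const_over_n] .
  ultimately have "prob (\<Inter>c. B (real (Suc c))) \<le> 0"
    by (intro LIMSEQ_le_const[of _ 0]) auto
  then have "prob (\<Inter>c. B (real (Suc c))) = 0" by (simp add: measure_le_0_iff)
  then have "(\<Inter>c. B (real (Suc c))) \<in> null_sets M"
    by (intro null_setsI) (auto simp: emeasure_eq_measure)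
  then show ?thesis
  proof (rule AE_I')
    show "{x \<in> space M. \<not> (\<exists>C. \<forall>K. (\<Sum>k<K. f ((T ^^ k) x)) \<le> C * real K)} \<subseteq> (\<Inter>c. B (real (Suc c)))"
      unfolding B_def by (auto simp: not_le simp del: of_nat_Suc)
  qed
qed

text \<open>The set of points that visit B infinitely often has measure at least that of B, because
  every tail event contains a preimage of B. Being invariant, it has full measure by
  ergodicity.\<close>

lemma (in prob_space) AE_recurrent:
  assumes T: "measure_preserving_map M T"
    and erg: "\<And>B. B \<in> sets M \<Longrightarrow> T -` B \<inter> space M = B \<Longrightarrow> prob B = 0 \<or> prob B = 1"
    and B: "B \<in> sets M" "0 < prob B"
  shows "AE x in M. \<exists>\<^sub>\<infinity>k. (T ^^ k) x \<in> B"
proof -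
  have Tm[measurable]: "T ^^ k \<in> M \<rightarrow>\<^sub>M M" for k
    using measure_preserving_funpow[OF T] by (simp add: measure_preserving_map_def)
  have T1[measurable]: "T \<in> M \<rightarrow>\<^sub>M M" using T by (simp add: measure_preserving_map_def)
  note B(1)[measurable]
  define H where "H m = {x \<in> space M. \<exists>k\<ge>m. (T ^^ k) x \<in> B}" for m
  define G where "G = (\<Inter>m. H m)"
  have Hm[measurable]: "H m \<in> sets M" for m unfolding H_def by measurable
  have Gm: "G \<in> sets M" unfolding G_def by auto
  have "prob B \<le> prob (H m)" for m
  proof -
    have "prob B = prob ((T ^^ m) -` B \<inter> space M)"
      by (rule measure_measure_preserving[symmetric]) (use measure_preserving_funpow[OF T] in auto)
    also have "\<dots> \<le> prob (H m)" by (rule finite_measure_mono) (auto simp: H_def)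
    finally show ?thesis .
  qed
  moreover have "(\<lambda>m. prob (H m)) \<longlonglongrightarrow> prob G"
    unfolding G_def by (rule finite_Lim_measure_decseq) (auto simp: decseq_def H_def intro: order_trans)
  ultimately have "prob B \<le> prob G" by (intro LIMSEQ_le_const[of _ "prob G"]) auto
  \<comment> \<open>Ergodicity is formulated for sets that equal their preimage exactly, so the
    invariance is shown pointwise and not just modulo null sets.\<close>
  moreover have "T -` G \<inter> space M = G"
  proof (intro set_eqI iffI)
    fix x assume x: "x \<in> T -` G \<inter> space M"
    { fix m
      have "T x \<in> H m" using x by (auto simp: G_def)
      then obtain k where "k \<ge> m" "(T ^^ Suc k) x \<in> B" by (auto simp: H_def funpow_swap1)
      then have "x \<in> H m" using x unfolding H_def by (intro CollectI conjI exI[of _ "Suc k"]) auto }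
    then show "x \<in> G" by (auto simp: G_def)
  next
    fix x assume x: "x \<in> G"
    have sp: "x \<in> space M" "T x \<in> space M"
      using x measurable_space[OF T1] by (auto simp: G_def H_def)
    { fix m
      have "x \<in> H (Suc m)" using x by (auto simp: G_def)
      then obtain k where k: "k \<ge> Suc m" "(T ^^ k) x \<in> B" by (auto simp: H_def)
      then obtain l where "k = Suc l" by (cases k) auto
      then have "T x \<in> H m" using k sp by (auto simp: H_def funpow_swap1) }
    then show "x \<in> T -` G \<inter> space M" using sp by (auto simp: G_def)
  qed
  ultimately have "prob G = 1" using erg[OF Gm] B by linarith
  then have "AE x in M. x \<in> G" using Gm by (simp add: prob_eq_1)
  then show ?thesis
    by eventually_elim (auto simp: G_def H_def INFM_nat_le)
qed

section \<open>Cylinder sets\<close>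

lemma shift_shift [simp]: "shift j (shift k x) = shift (j + k) x"
  by (simp add: shift_def add.assoc)

lemma shift_0 [simp]: "shift 0 x = x"
  by (simp add: shift_def)

lemma shift_in_seqs: "x \<in> seqs \<Longrightarrow> shift k x \<in> seqs"
  by (simp add: shift_def seqs_def)

lemma shift_preimage_shift_preimage:
  "shift_preimage k (shift_preimage j B) = shift_preimage (j + k) B"
  by (auto simp: shift_preimage_def shift_in_seqs)

text \<open>There are only countably many \<open>n\<close>-cylinders, so every set that depends only on the first
  \<open>n\<close> coordinates is a countable union of them.\<close>

lemma cylinder_algebra_iff:
  "B \<in> cylinder_algebra n \<longleftrightarrow>
    B \<subseteq> seqs \<and> (\<forall>x\<in>seqs. \<forall>y\<in>seqs. (\<forall>i<n. x i = y i) \<longrightarrow> x \<in> B \<longrightarrow> y \<in> B)"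
proof
  assume "B \<in> cylinder_algebra n"
  then show "B \<subseteq> seqs \<and> (\<forall>x\<in>seqs. \<forall>y\<in>seqs. (\<forall>i<n. x i = y i) \<longrightarrow> x \<in> B \<longrightarrow> y \<in> B)"
    unfolding cylinder_algebra_def
  proof (induction rule: sigma_sets.induct)
    case (Basic a)
    then show ?case by (auto simp: cylinder_def)
  next
    case (Compl a)
    show ?case
    proof (intro conjI ballI impI)
      fix x y assume "x \<in> seqs" "y \<in> seqs" "\<forall>i<n. x i = y i" "x \<in> seqs - a"
      moreover from this have "\<forall>i<n. y i = x i" by simp
      ultimately show "y \<in> seqs - a" using Compl.IH by blast
    qed simp
  next
    case (Union a)
    show ?case
    proof (intro conjI ballI impI)
      fix x y assume *: "x \<in> seqs" "y \<in> seqs" "\<forall>i<n. x i = y i" "x \<in> (\<Union>i. a i)"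
      then obtain k where "x \<in> a k" by blast
      with * Union.IH[of k] have "y \<in> a k" by blast
      then show "y \<in> (\<Union>i. a i)" by blast
    qed (use Union.IH in blast)
  qed simp
next
  assume B: "B \<subseteq> seqs \<and> (\<forall>x\<in>seqs. \<forall>y\<in>seqs. (\<forall>i<n. x i = y i) \<longrightarrow> x \<in> B \<longrightarrow> y \<in> B)"
  let ?c = "\<lambda>xs :: enat list. {z \<in> seqs. map z [0..<n] = xs}"
  let ?C = "(\<lambda>x. map x [0..<n]) ` B"
  have cyl: "?c (map x [0..<n]) = cylinder n x" for x :: "nat \<Rightarrow> enat"
    by (auto simp: cylinder_def)
  have "countable ?C"
    by (rule countable_subset[OF subset_UNIV]) auto
  moreover have "?c xs \<in> cylinder_algebra n" if xs: "xs \<in> ?C" for xs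
  proof -
    obtain x where x: "x \<in> B" "xs = map x [0..<n]" using xs by blast
    have "x \<in> seqs" using B x by blast
    then show ?thesis unfolding x(2) cyl cylinder_algebra_def by (intro sigma_sets.Basic) blast
  qed
  moreover have "sigma_algebra seqs (cylinder_algebra n)"
    unfolding cylinder_algebra_def by (rule sigma_algebra_sigma_sets) (auto simp: cylinder_def)
  ultimately have "(\<Union>xs\<in>?C. ?c xs) \<in> cylinder_algebra n"
    by (intro sigma_algebra.countable_UN'[of seqs]) auto
  moreover have "(\<Union>xs\<in>?C. ?c xs) = B"
  proof (intro set_eqI iffI)
    fix z assume "z \<in> (\<Union>xs\<in>?C. ?c xs)"
    then obtain x where "x \<in> B" "z \<in> seqs" "map z [0..<n] = map x [0..<n]" by auto
    moreover from this have "x \<in> seqs" using B by blast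
    moreover have "\<forall>i<n. x i = z i" using \<open>map z [0..<n] = map x [0..<n]\<close> by simp
    ultimately show "z \<in> B" using B by blast
  qed (use B in auto)
  ultimately show "B \<in> cylinder_algebra n" by simp
qed

lemma cylinder_algebra_subset_seqs: "B \<in> cylinder_algebra n \<Longrightarrow> B \<subseteq> seqs"
  by (simp add: cylinder_algebra_iff)

lemma cylinder_algebra_Int:
  "B \<in> cylinder_algebra n \<Longrightarrow> C \<in> cylinder_algebra n \<Longrightarrow> B \<inter> C \<in> cylinder_algebra n"
  unfolding cylinder_algebra_iff by blast

lemma cylinder_algebra_mono: "B \<in> cylinder_algebra n \<Longrightarrow> n \<le> m \<Longrightarrow> B \<in> cylinder_algebra m"
  unfolding cylinder_algebra_iff by (meson less_le_trans)

lemma shift_preimage_in_cylinder_algebra: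
  assumes "B \<in> cylinder_algebra n"
  shows "shift_preimage k B \<in> cylinder_algebra (n + k)"
proof -
  have "shift k y \<in> B" if "x \<in> seqs" "y \<in> seqs" "\<forall>i<n + k. x i = y i" "shift k x \<in> B" for x y
  proof -
    have "\<forall>i<n. shift k x i = shift k y i" using that by (simp add: shift_def)
    then show ?thesis using assms that shift_in_seqs unfolding cylinder_algebra_iff by blast
  qed
  then show ?thesis unfolding cylinder_algebra_iff shift_preimage_def by blast
qed

lemma cylinder_algebra_seq_algebra:
  assumes "B \<in> cylinder_algebra n"
  shows "B \<in> sets seq_algebra"
proof -
  have sp: "space seq_algebra = seqs" by (simp add: seq_algebra_def space_restrict_space)
  have [measurable]: "(\<lambda>x :: nat \<Rightarrow> enat. x i) \<in> borel_measurable borel" for i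
    by (intro borel_measurable_continuous_onI continuous_on_product_coordinates)
  have "cylinder n y \<in> sets seq_algebra" for y
  proof -
    have "{z \<in> space borel. \<forall>i<n. z i = y i} \<in> sets (borel :: (nat \<Rightarrow> enat) measure)"
      by measurable
    moreover have "cylinder n y = seqs \<inter> {z \<in> space borel. \<forall>i<n. z i = y i}"
      by (auto simp: cylinder_def)
    ultimately show ?thesis by (auto simp: seq_algebra_def sets_restrict_space)
  qed
  then have "cylinder_algebra n \<subseteq> sets seq_algebra"
    unfolding cylinder_algebra_def sp[symmetric] by (intro sets.sigma_sets_subset) auto
  with assms show ?thesis by auto
qed

text \<open>The common form of all events in question: with S = {1..k} it says that the hitting time
  exceeds k, and with S the indices whose clock value lies in a region it says that the process has
  no point there.\<close>

definition avoiding :: "(nat \<Rightarrow> enat) set \<Rightarrow> nat set \<Rightarrow> (nat \<Rightarrow> enat) set" where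
  "avoiding B S = {x \<in> seqs. \<forall>i\<in>S. shift i x \<notin> B}"

lemma avoiding_in_cylinder_algebra:
  assumes "B \<in> cylinder_algebra n" "finite S"
  shows "\<exists>m\<ge>1. avoiding B S \<in> cylinder_algebra m"
proof -
  \<comment> \<open>\<open>insert 0\<close> keeps the maximum meaningful for empty S, and
    \<open>Suc\<close> makes m positive even for n = 0, because the mixing conditions are stated for
    cylinder lengths at least 1.\<close>
  define m where "m = n + Suc (Max (insert 0 S))"
  have le: "i + n \<le> m" if "i \<in> S" for i
  proof -
    have "i \<le> Max (insert 0 S)" using that assms by (intro Max_ge) auto
    then show ?thesis unfolding m_def by simp
  qed
  have "avoiding B S \<in> cylinder_algebra m"
    unfolding cylinder_algebra_iff
  proof (intro conjI ballI impI)
    fix x y assume *: "x \<in> seqs" "y \<in> seqs" "\<forall>i<m. x i = y i" "x \<in> avoiding B S"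
    have "shift i y \<notin> B" if i: "i \<in> S" for i
    proof
      assume "shift i y \<in> B"
      moreover have "\<forall>j<n. shift i y j = shift i x j"
        using le[OF i] * by (auto simp: shift_def)
      ultimately have "shift i x \<in> B"
        using assms(1) * shift_in_seqs unfolding cylinder_algebra_iff by blast
      with * i show False by (auto simp: avoiding_def)
    qed
    with * show "y \<in> avoiding B S" by (auto simp: avoiding_def)
  qed (auto simp: avoiding_def)
  then show ?thesis by (intro exI[of _ m]) (auto simp: m_def)
qed

lemma shift_preimage_avoiding:
  "shift_preimage k (avoiding B S) = avoiding B ((\<lambda>i. i + k) ` S)"
  by (auto simp: shift_preimage_def avoiding_def shift_in_seqs)

section \<open>Fiber measures\<close>

locale random_sft_measure =
  fixes M :: "'a measure" and \<theta> :: "'a \<Rightarrow> 'a"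
    and b :: "'a \<Rightarrow> nat" and a :: "'a \<Rightarrow> nat \<Rightarrow> nat \<Rightarrow> nat"
    and \<nu> :: "('a \<times> (nat \<Rightarrow> enat)) measure" and \<mu> :: "'a \<Rightarrow> (nat \<Rightarrow> enat) measure"
  assumes sft: "random_sft M \<theta> b a"
    and inv: "invariant_measure_over M \<theta> b a \<nu>"
    and dis: "disintegration M \<theta> b a \<nu> \<mu>"
begin

abbreviation "fm \<equiv> fiber_measure \<mu>"

sublocale prob_space M
  using sft by (simp add: random_sft_def standard_prob_space_def)

section \<open>Measures of sets in a fiber\<close>

lemma theta: "measure_preserving_map M \<theta>" "inj_on \<theta> (space M)" "the_inv_into (space M) \<theta> \<in> M \<rightarrow>\<^sub>M M"
  "\<And>B. B \<in> sets M \<Longrightarrow> \<theta> -` B \<inter> space M = B \<Longrightarrow> prob B = 0 \<or> prob B = 1"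
  using sft by (auto simp: random_sft_def ergodic_automorphism_def bij_betw_def)

lemma funpow_theta_measurable [measurable]: "\<theta> ^^ k \<in> M \<rightarrow>\<^sub>M M"
  using measure_preserving_funpow[OF theta(1)] by (simp add: measure_preserving_map_def)

lemma theta_measurable [measurable]: "\<theta> \<in> M \<rightarrow>\<^sub>M M"
  using theta(1) by (simp add: measure_preserving_map_def)

lemma funpow_theta_space: "\<omega> \<in> space M \<Longrightarrow> (\<theta> ^^ k) \<omega> \<in> space M"
  using measurable_space[OF funpow_theta_measurable] .

lemma space_seq_algebra [simp]: "space seq_algebra = seqs"
  by (simp add: seq_algebra_def space_restrict_space)

lemma fiber_subset_seqs: "fiber \<theta> b a \<omega> \<subseteq> seqs"
  by (auto simp: fiber_def)

lemma prob_space_fiber: "\<omega> \<in> space M \<Longrightarrow> prob_space (\<mu> \<omega>)"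
  using dis by (simp add: disintegration_def)

lemma sets_fiber: "\<omega> \<in> space M \<Longrightarrow> sets (\<mu> \<omega>) = sets (restrict_space seq_algebra (fiber \<theta> b a \<omega>))"
  using dis by (simp add: disintegration_def)

lemma space_fiber: "\<omega> \<in> space M \<Longrightarrow> space (\<mu> \<omega>) = fiber \<theta> b a \<omega>"
  using sets_eq_imp_space_eq[OF sets_fiber] fiber_subset_seqs by (simp add: space_restrict_space Int_absorb2)

lemma seq_algebra_fiber:
  "\<omega> \<in> space M \<Longrightarrow> B \<in> sets seq_algebra \<Longrightarrow> B \<inter> space (\<mu> \<omega>) \<in> sets (\<mu> \<omega>)"
  by (simp add: sets_fiber space_fiber sets_restrict_space Int_commute)

lemma measurable_fiber_measure:
  assumes "B \<in> sets seq_algebra"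
  shows "(\<lambda>\<omega>. fm \<omega> B) \<in> borel_measurable M"
proof -
  have "(\<lambda>\<omega>. measure (\<mu> \<omega>) (B \<inter> fiber \<theta> b a \<omega>)) \<in> borel_measurable M"
    using dis assms by (simp add: disintegration_def)
  then show ?thesis
    by (subst measurable_cong[where g="\<lambda>\<omega>. measure (\<mu> \<omega>) (B \<inter> fiber \<theta> b a \<omega>)"])
       (simp_all add: fiber_measure_def space_fiber)
qed

lemma fm_nonneg: "0 \<le> fm \<omega> B"
  by (simp add: fiber_measure_def)

lemma fm_le_1: "\<omega> \<in> space M \<Longrightarrow> fm \<omega> B \<le> 1"
  using prob_space.prob_le_1[OF prob_space_fiber] by (simp add: fiber_measure_def)

lemma fm_mono:
  assumes "\<omega> \<in> space M" "C \<in> sets seq_algebra" "B \<subseteq> C"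
  shows "fm \<omega> B \<le> fm \<omega> C"
proof -
  interpret P: prob_space "\<mu> \<omega>" by (rule prob_space_fiber) fact
  show ?thesis
    unfolding fiber_measure_def
    by (rule P.finite_measure_mono) (use assms seq_algebra_fiber in auto)
qed

lemma fm_subadditive:
  assumes \<omega>: "\<omega> \<in> space M" and "finite I" and C: "C \<in> sets seq_algebra"
    and F: "\<And>i. i \<in> I \<Longrightarrow> F i \<in> sets seq_algebra" and sub: "B \<subseteq> C \<union> (\<Union>i\<in>I. F i)"
  shows "fm \<omega> B \<le> fm \<omega> C + (\<Sum>i\<in>I. fm \<omega> (F i))"
proof -
  interpret P: prob_space "\<mu> \<omega>" by (rule prob_space_fiber) fact
  let ?S = "space (\<mu> \<omega>)"
  have m: "C \<inter> ?S \<in> P.events" "\<And>i. i \<in> I \<Longrightarrow> F i \<inter> ?S \<in> P.events"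
    using seq_algebra_fiber[OF \<omega>] C F by auto
  have U: "(\<Union>i\<in>I. F i \<inter> ?S) \<in> P.events" using m(2) \<open>finite I\<close> by (intro sets.finite_UN) auto
  have "fm \<omega> B \<le> P.prob ((C \<inter> ?S) \<union> (\<Union>i\<in>I. F i \<inter> ?S))"
    unfolding fiber_measure_def by (rule P.finite_measure_mono) (use sub m U in auto)
  also have "\<dots> \<le> P.prob (C \<inter> ?S) + P.prob (\<Union>i\<in>I. F i \<inter> ?S)"
    by (rule measure_Un_le) (use m U in auto)
  also have "P.prob (\<Union>i\<in>I. F i \<inter> ?S) \<le> (\<Sum>i\<in>I. P.prob (F i \<inter> ?S))"
    by (rule P.finite_measure_subadditive_finite) (use m \<open>finite I\<close> in auto)
  finally show ?thesis by (simp add: fiber_measure_def)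
qed

lemma fm_Diff:
  assumes \<omega>: "\<omega> \<in> space M" and "B \<in> sets seq_algebra" "C \<in> sets seq_algebra"
  shows "fm \<omega> (B - C) = fm \<omega> B - fm \<omega> (C \<inter> B)"
proof -
  interpret P: prob_space "\<mu> \<omega>" by (rule prob_space_fiber) fact
  have "(B - C) \<inter> space (\<mu> \<omega>) = B \<inter> space (\<mu> \<omega>) - (C \<inter> B) \<inter> space (\<mu> \<omega>)" by auto
  then show ?thesis
    unfolding fiber_measure_def using assms seq_algebra_fiber[OF \<omega>]
    by (simp only:) (intro P.finite_measure_Diff, auto)
qed

section \<open>Equivariance of the disintegration\<close>

lemma space_nu: "space \<nu> = sft_space M \<theta> b a"
proof -
  have "space \<nu> = space (restrict_space (M \<Otimes>\<^sub>M seq_algebra) (sft_space M \<theta> b a))"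
    using inv by (intro sets_eq_imp_space_eq) (simp add: invariant_measure_over_def)
  then show ?thesis
    using fiber_subset_seqs by (auto simp: space_restrict_space space_pair_measure sft_space_def)
qed

lemma rectangle_measurable:
  assumes "E \<in> sets M" "B \<in> sets seq_algebra"
  shows "(E \<times> B) \<inter> sft_space M \<theta> b a \<in> sets \<nu>"
  using inv assms by (auto simp: invariant_measure_over_def sets_restrict_space)

text \<open>The disintegration formula for an indicator. Letting E vary with B fixed determines the
  function \<omega> \<mapsto> \<open>fm \<omega> B\<close> up to null sets.\<close>

lemma measure_rectangle:
  assumes E: "E \<in> sets M" and B: "B \<in> sets seq_algebra"
  shows "measure \<nu> ((E \<times> B) \<inter> sft_space M \<theta> b a) = (\<integral>\<omega>. indicator E \<omega> * fm \<omega> B \<partial>M)"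
proof -
  interpret N: prob_space \<nu> using inv by (simp add: invariant_measure_over_def)
  let ?R = "(E \<times> B) \<inter> sft_space M \<theta> b a"
  have R: "?R \<in> sets \<nu>" by (rule rectangle_measurable[OF E B])
  then have "?R \<subseteq> space \<nu>" by (rule sets.sets_into_space)
  then have "measure \<nu> ?R = (\<integral>z. indicat_real ?R z \<partial>\<nu>)" by (simp add: Int_absorb2)
  also have "\<dots> = (\<integral>\<omega>. (\<integral>x. indicat_real ?R (\<omega>, x) \<partial>\<mu> \<omega>) \<partial>M)"
  proof -
    have "integrable \<nu> (indicat_real ?R)"
      by (rule N.integrable_const_bound[where B=1]) (use R in auto)
    then show ?thesis using dis unfolding disintegration_def by blast
  qed
  also have "\<dots> = (\<integral>\<omega>. indicator E \<omega> * fm \<omega> B \<partial>M)"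
  proof (rule Bochner_Integration.integral_cong[OF refl])
    fix \<omega> assume \<omega>: "\<omega> \<in> space M"
    have "(\<integral>x. indicat_real ?R (\<omega>, x) \<partial>\<mu> \<omega>) = (\<integral>x. indicator E \<omega> * indicator (B \<inter> space (\<mu> \<omega>)) x \<partial>\<mu> \<omega>)"
      by (rule Bochner_Integration.integral_cong[OF refl])
         (auto simp: indicator_def sft_space_def space_fiber[OF \<omega>] \<omega>)
    then show "(\<integral>x. indicat_real ?R (\<omega>, x) \<partial>\<mu> \<omega>) = indicator E \<omega> * fm \<omega> B"
      by (simp add: fiber_measure_def Int_assoc)
  qed
  finally show ?thesis .
qed

text \<open>Invariance of \<nu> is tested on rectangles over E. Because \<theta> is invertible,
  every measurable E is the \<theta>-preimage of a measurable set, so both sides have equal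
  integrals over every E and agree almost everywhere. Without invertibility only the conditional
  expectation of the left side would be identified.\<close>

lemma fm_shift_preimage_1:
  assumes B: "B \<in> cylinder_algebra n"
  shows "AE \<omega> in M. fm \<omega> (shift_preimage 1 B) = fm (\<theta> \<omega>) B"
proof -
  let ?E = "sft_space M \<theta> b a"
  have B1: "B \<in> sets seq_algebra" "shift_preimage 1 B \<in> sets seq_algebra"
    using B shift_preimage_in_cylinder_algebra[OF B, of 1] by (auto intro: cylinder_algebra_seq_algebra)
  define f g where "f \<omega> = fm \<omega> (shift_preimage 1 B)" and "g \<omega> = fm (\<theta> \<omega>) B" for \<omega>
  have fgm[measurable]: "f \<in> borel_measurable M" "g \<in> borel_measurable M"
    unfolding f_def g_def using measurable_fiber_measure[OF B1(2)]
      measurable_compose[OF theta_measurable measurable_fiber_measure[OF B1(1)]] by auto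
  have fi: "integrable M f" "integrable M g"
    by (rule integrable_const_bound[where B=1], use fm_le_1 fm_nonneg measurable_space[OF theta_measurable] fgm in \<open>auto simp: f_def g_def\<close>)+
  have skew: "measure_preserving_map \<nu> (skew_shift \<theta>)" using inv by (simp add: invariant_measure_over_def)
  then have skew_sp: "skew_shift \<theta> z \<in> ?E" if "z \<in> ?E" for z
    using that measurable_space[of "skew_shift \<theta>" \<nu> \<nu> z] by (simp add: measure_preserving_map_def space_nu)
  have eq: "(\<integral>\<omega>. indicator E \<omega> * f \<omega> \<partial>M) = (\<integral>\<omega>. indicator E \<omega> * g \<omega> \<partial>M)" if E: "E \<in> sets M" for E
  proof -
    \<comment> \<open>The image of E under \<theta>, written as a preimage under the inverse map to
      make it measurable.\<close>
    define E' where "E' = the_inv_into (space M) \<theta> -` E \<inter> space M"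
    have E': "E' \<in> sets M" unfolding E'_def by (rule measurable_sets[OF theta(3) E])
    have E'_iff: "\<theta> \<omega> \<in> E' \<longleftrightarrow> \<omega> \<in> E" if "\<omega> \<in> space M" for \<omega>
      using that measurable_space[OF theta_measurable that] by (simp add: E'_def the_inv_into_f_f[OF theta(2)])
    have "(\<integral>\<omega>. indicator E \<omega> * f \<omega> \<partial>M) = measure \<nu> ((E \<times> shift_preimage 1 B) \<inter> ?E)"
      unfolding f_def by (rule measure_rectangle[OF E B1(2), symmetric])
    also have "(E \<times> shift_preimage 1 B) \<inter> ?E = skew_shift \<theta> -` ((E' \<times> B) \<inter> ?E) \<inter> space \<nu>"
    proof (intro set_eqI iffI)
      fix z assume z: "z \<in> (E \<times> shift_preimage 1 B) \<inter> ?E"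
      then show "z \<in> skew_shift \<theta> -` ((E' \<times> B) \<inter> ?E) \<inter> space \<nu>"
        using skew_sp[of z] E'_iff by (auto simp: space_nu skew_shift_def shift_preimage_def sft_space_def)
    next
      fix z assume z: "z \<in> skew_shift \<theta> -` ((E' \<times> B) \<inter> ?E) \<inter> space \<nu>"
      then show "z \<in> (E \<times> shift_preimage 1 B) \<inter> ?E"
        using E'_iff fiber_subset_seqs by (fastforce simp: space_nu skew_shift_def shift_preimage_def sft_space_def)
    qed
    also have "measure \<nu> \<dots> = measure \<nu> ((E' \<times> B) \<inter> ?E)"
      by (rule measure_measure_preserving[OF skew rectangle_measurable[OF E' B1(1)]])
    also have "\<dots> = (\<integral>\<omega>. indicator E' \<omega> * fm \<omega> B \<partial>M)" by (rule measure_rectangle[OF E' B1(1)])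
    also have "\<dots> = (\<integral>\<omega>. indicator E' (\<theta> \<omega>) * fm (\<theta> \<omega>) B \<partial>M)"
      by (rule integral_measure_preserving[OF theta(1), symmetric])
         (use E' measurable_fiber_measure[OF B1(1)] in measurable)
    also have "\<dots> = (\<integral>\<omega>. indicator E \<omega> * g \<omega> \<partial>M)"
      by (rule Bochner_Integration.integral_cong[OF refl]) (simp add: g_def indicator_def E'_iff)
    finally show ?thesis .
  qed
  \<comment> \<open>Integrate over the set where the inequality fails: there the difference is
    positive, yet its integral vanishes. Applying this in both directions gives equality almost
    everywhere.\<close>
  have le: "AE \<omega> in M. u \<omega> \<le> v \<omega>"
    if um[measurable]: "u \<in> borel_measurable M" and vm[measurable]: "v \<in> borel_measurable M"
      and u: "integrable M u" and v: "integrable M v"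
      and uv: "\<And>E. E \<in> sets M \<Longrightarrow> (\<integral>\<omega>. indicator E \<omega> * u \<omega> \<partial>M) = (\<integral>\<omega>. indicator E \<omega> * v \<omega> \<partial>M)"
    for u v :: "'a \<Rightarrow> real"
  proof -
    let ?D = "{\<omega> \<in> space M. v \<omega> < u \<omega>}"
    have Dm: "?D \<in> sets M" by measurable
    have int: "integrable M (\<lambda>\<omega>. indicator ?D \<omega> * u \<omega>)" "integrable M (\<lambda>\<omega>. indicator ?D \<omega> * v \<omega>)"
      using integrable_real_mult_indicator[OF Dm u] integrable_real_mult_indicator[OF Dm v]
      by (simp_all add: mult.commute)
    then have "(\<integral>\<omega>. indicator ?D \<omega> * u \<omega> - indicator ?D \<omega> * v \<omega> \<partial>M) = 0"
      using uv[OF Dm] by simp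
    then have "AE \<omega> in M. indicator ?D \<omega> * u \<omega> - indicator ?D \<omega> * v \<omega> = 0"
      by (subst (asm) integral_nonneg_eq_0_iff_AE) (use int in \<open>auto simp: indicator_def\<close>)
    then show ?thesis
      by (rule AE_mp) (auto intro!: AE_I2 simp: indicator_def split: if_splits)
  qed
  have "AE \<omega> in M. f \<omega> \<le> g \<omega>" "AE \<omega> in M. g \<omega> \<le> f \<omega>"
    by (rule le; use fi eq in auto)+
  then show ?thesis by eventually_elim (simp add: f_def g_def)
qed

lemma fm_shift_preimage:
  assumes B: "B \<in> cylinder_algebra n"
  shows "AE \<omega> in M. fm \<omega> (shift_preimage k B) = fm ((\<theta> ^^ k) \<omega>) B"
proof (induction k)
  case 0
  have "shift_preimage 0 B = B" using cylinder_algebra_subset_seqs[OF B] by (auto simp: shift_preimage_def)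
  then show ?case by simp
next
  case (Suc k)
  have "AE \<omega> in M. fm \<omega> (shift_preimage 1 (shift_preimage k B)) = fm (\<theta> \<omega>) (shift_preimage k B)"
    by (rule fm_shift_preimage_1[OF shift_preimage_in_cylinder_algebra[OF B]])
  moreover have "AE \<omega> in M. fm (\<theta> \<omega>) (shift_preimage k B) = fm ((\<theta> ^^ k) (\<theta> \<omega>)) B"
    by (rule AE_measure_preserving[OF theta(1) Suc])
  ultimately show ?case
    by eventually_elim (simp add: shift_preimage_shift_preimage funpow_swap1)
qed

text \<open>The essential supremum lies between 0 and 1, so its conversion to a real number loses
  nothing. The lower bound uses that M has positive total mass.\<close>

lemma AE_fm_le_ess_sup:
  assumes B: "B \<in> sets seq_algebra"
  shows "AE \<omega> in M. fm \<omega> B \<le> ess_sup_measure M \<mu> B"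
proof -
  let ?f = "\<lambda>\<omega>. ereal (fm \<omega> B)"
  have fm: "?f \<in> borel_measurable M" using measurable_fiber_measure[OF B] by simp
  have le: "AE \<omega> in M. ?f \<omega> \<le> esssup M ?f" by (rule esssup_AE)
  have "esssup M ?f \<le> ereal 1"
    by (rule esssup_I[OF fm]) (use fm_le_1 in auto)
  moreover have "0 \<le> esssup M ?f"
  proof -
    have "AE \<omega> in M. 0 \<le> esssup M ?f"
      using le by eventually_elim (use fm_nonneg in \<open>meson ereal_less_eq(5) order_trans\<close>)
    then show ?thesis by simp
  qed
  ultimately have "esssup M ?f = ereal (ess_sup_measure M \<mu> B)"
    unfolding ess_sup_measure_def by (intro ereal_real'[symmetric]) auto
  then show ?thesis using le by simp
qed

text \<open>A nonzero essential supremum yields a level 1/(N+1) that is exceeded with positive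
  probability, hence infinitely often along almost every orbit. A bounded clock would be a
  convergent series, whose terms tend to 0. Divergence makes the process locally finite and the
  maximum in \<open>last_time_in\<close> one over a finite set.\<close>

lemma fiber_time_at_top:
  assumes B: "B \<in> sets seq_algebra" and ne: "ess_sup_measure M \<mu> B \<noteq> 0"
  shows "AE \<omega> in M. filterlim (fiber_time \<theta> \<mu> B \<omega>) at_top sequentially"
proof -
  have fmm[measurable]: "(\<lambda>\<omega>. fm \<omega> B) \<in> borel_measurable M" by (rule measurable_fiber_measure[OF B])
  define H where "H N = {\<omega> \<in> space M. 1 / real (Suc N) < fm \<omega> B}" for N
  have Hm: "H N \<in> sets M" for N unfolding H_def by measurable
  have "\<exists>N. 0 < prob (H N)"
  proof (rule ccontr)
    assume "\<nexists>N. 0 < prob (H N)"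
    then have "prob (H N) = 0" for N using measure_nonneg[of M "H N"] by (metis less_eq_real_def)
    then have "H N \<in> null_sets M" for N using Hm by (intro null_setsI) (auto simp: emeasure_eq_measure)
    then have "(\<Union>N. H N) \<in> null_sets M" by (intro null_sets_UN) auto
    then have "AE \<omega> in M. fm \<omega> B = 0"
    proof (rule AE_I')
      show "{\<omega> \<in> space M. fm \<omega> B \<noteq> 0} \<subseteq> (\<Union>N. H N)"
      proof
        fix \<omega> assume \<omega>: "\<omega> \<in> {\<omega> \<in> space M. fm \<omega> B \<noteq> 0}"
        then have "0 < fm \<omega> B" using fm_nonneg[of \<omega> B] by auto
        then obtain N where "1 / real (Suc N) < fm \<omega> B" using nat_approx_posE by blast
        then show "\<omega> \<in> (\<Union>N. H N)" using \<omega> by (auto simp: H_def)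
      qed
    qed
    then have "esssup M (\<lambda>\<omega>. ereal (fm \<omega> B)) = esssup M (\<lambda>\<omega>. 0)"
      by (intro esssup_AE_cong) auto
    also have "\<dots> = 0" by (intro esssup_const) (simp add: emeasure_space_1)
    finally show False using ne by (simp add: ess_sup_measure_def)
  qed
  then obtain N where N: "0 < prob (H N)" by blast
  have "AE \<omega> in M. \<exists>\<^sub>\<infinity>k. (\<theta> ^^ k) \<omega> \<in> H N"
    by (rule AE_recurrent[OF theta(1) theta(4) Hm N])
  then show ?thesis
  proof eventually_elim
    case (elim \<omega>)
    let ?f = "\<lambda>i. fm ((\<theta> ^^ i) \<omega>) B"
    show ?case
      unfolding filterlim_at_top
    proof (rule allI, rule ccontr)
      fix Z assume not: "\<not> (\<forall>\<^sub>F k in sequentially. Z \<le> fiber_time \<theta> \<mu> B \<omega> k)"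
      have mono: "fiber_time \<theta> \<mu> B \<omega> k \<le> fiber_time \<theta> \<mu> B \<omega> l" if "k \<le> l" for k l
        unfolding fiber_time_def by (rule sum_mono2) (use that fm_nonneg in auto)
      have bd: "fiber_time \<theta> \<mu> B \<omega> k \<le> Z" for k
      proof (rule ccontr)
        assume "\<not> fiber_time \<theta> \<mu> B \<omega> k \<le> Z"
        then have "\<forall>l\<ge>k. Z \<le> fiber_time \<theta> \<mu> B \<omega> l" using mono[of k] by force
        then show False using not by (auto simp: eventually_sequentially)
      qed
      have "summable (\<lambda>i. ?f (Suc i))"
      proof (rule summableI_nonneg_bounded[where x=Z])
        fix n
        have "(\<Sum>i<n. ?f (Suc i)) = fiber_time \<theta> \<mu> B \<omega> n"
          unfolding fiber_time_def by (simp add: sum.atLeast1_atMost_eq)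
        then show "(\<Sum>i<n. ?f (Suc i)) \<le> Z" using bd by simp
      qed (use fm_nonneg in auto)
      then have "(\<lambda>i. ?f (Suc i)) \<longlonglongrightarrow> 0" by (rule summable_LIMSEQ_zero)
      then have "?f \<longlonglongrightarrow> 0" by (rule LIMSEQ_imp_Suc)
      then have "\<forall>\<^sub>F i in sequentially. ?f i < 1 / real (Suc N)"
        by (rule order_tendstoD(2)) simp
      then have "\<forall>\<^sub>\<infinity>i. (\<theta> ^^ i) \<omega> \<notin> H N"
        unfolding cofinite_eq_sequentially by eventually_elim (auto simp: H_def)
      then show False using elim by (simp add: frequently_def)
    qed
  qed
qed

end

section \<open>Avoidance probabilities\<close>

context random_sft_measure
begin

lemma avoiding_seq_algebra:
  "B \<in> cylinder_algebra n \<Longrightarrow> finite S \<Longrightarrow> avoiding B S \<in> sets seq_algebra"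
  using avoiding_in_cylinder_algebra cylinder_algebra_seq_algebra by blast

text \<open>Dropping the constraints in the next \<open>h + n\<close> steps changes the probabilities by at most the
  short returns and the hits in that window; the remaining constraint is almost independent of \<open>B\<close>.\<close>

lemma avoiding_step:
  assumes \<omega>: "\<omega> \<in> space M" and n: "1 \<le> n" and B: "B \<in> cylinder_algebra n" and S: "finite S" "0 \<notin> S"
    and e: "\<And>i. fm \<omega> (shift_preimage i B) \<le> e"
    and short: "\<And>j. j \<le> n \<Longrightarrow> fm \<omega> (B \<inter> shift_preimage j B) \<le> fm \<omega> B * \<beta>\<^sub>0 j"
    and long: "\<And>k. n \<le> k \<Longrightarrow> fm \<omega> (B \<inter> shift_preimage k B) \<le> fm \<omega> B * \<beta>\<^sub>1"
    and mix: "\<And>S'. finite S' \<Longrightarrow> \<bar>fm \<omega> (B \<inter> shift_preimage (h + n) (avoiding B S'))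
      - fm \<omega> B * fm \<omega> (shift_preimage (h + n) (avoiding B S'))\<bar> \<le> \<delta>"
  shows "\<bar>fm \<omega> (B \<inter> avoiding B S) - fm \<omega> B * fm \<omega> (avoiding B S)\<bar>
    \<le> fm \<omega> B * (real h * \<beta>\<^sub>1 + (\<Sum>j=first_overlap B..n. \<beta>\<^sub>0 j) + real (h + n) * e) + \<delta>"
proof -
  define S1 where "S1 = S \<inter> {..<h + n}"
  define S2 where "S2 = S \<inter> {h + n..}"
  have S12: "S = S1 \<union> S2" "finite S1" "finite S2" "S1 \<subseteq> {1..<h + n}"
    using S unfolding S1_def S2_def by (auto simp: Suc_le_eq intro!: gr0I)
  let ?p = "fm \<omega> B" and ?r = "\<lambda>i. fm \<omega> (B \<inter> shift_preimage i B)"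
  have Bm: "B \<in> sets seq_algebra" by (rule cylinder_algebra_seq_algebra[OF B])
  have sm: "shift_preimage i B \<in> sets seq_algebra" for i
    by (rule cylinder_algebra_seq_algebra[OF shift_preimage_in_cylinder_algebra[OF B]])
  have am: "avoiding B T \<in> sets seq_algebra" if "finite T" for T
    by (rule avoiding_seq_algebra[OF B that])
  have e0: "0 \<le> e" using e[of 0] fm_nonneg[of \<omega>] by (rule order_trans[rotated])
  have r0: "0 \<le> ?r i" for i by (rule fm_nonneg)
  \<comment> \<open>The late constraints are a shift by h + n of constraints counted from the end of
    the gap. Truncated subtraction is exact on \<open>S2\<close>, whose elements are at least h +
    n.\<close>
  have shift: "shift_preimage (h + n) (avoiding B ((\<lambda>i. i - (h + n)) ` S2)) = avoiding B S2"
  proof -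
    have "(\<lambda>i. i + (h + n)) ` (\<lambda>i. i - (h + n)) ` S2 = S2"
      unfolding image_image by (force simp: S2_def image_iff)
    then show ?thesis by (simp add: shift_preimage_avoiding)
  qed
  have mix2: "\<bar>fm \<omega> (B \<inter> avoiding B S2) - ?p * fm \<omega> (avoiding B S2)\<bar> \<le> \<delta>"
    using mix[of "(\<lambda>i. i - (h + n)) ` S2"] S12 by (simp add: shift)
  have hits: "avoiding B S2 \<subseteq> avoiding B S \<union> (\<Union>i\<in>S1. shift_preimage i B)"
    by (auto simp: avoiding_def shift_preimage_def S12(1))
  have sub: "avoiding B S \<subseteq> avoiding B S2" by (auto simp: avoiding_def S12(1))
  \<comment> \<open>The window is cut at lag n, since lags up to n are governed by
    \<open>\<beta>\<^sub>0\<close> and larger lags by \<open>\<beta>\<^sub>1\<close>.\<close>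
  have "(\<Sum>i\<in>S1. ?r i) \<le> (\<Sum>i\<in>{1..n} \<union> {n<..<h + n}. ?r i)"
    by (rule sum_mono2) (use S12 r0 in auto)
  also have "\<dots> = (\<Sum>i=1..n. ?r i) + (\<Sum>i\<in>{n<..<h + n}. ?r i)"
    by (rule sum.union_disjoint) auto
  finally have R0: "(\<Sum>i\<in>S1. ?r i) \<le> (\<Sum>i=1..n. ?r i) + (\<Sum>i\<in>{n<..<h + n}. ?r i)" .
  have R1: "(\<Sum>i=1..n. ?r i) \<le> ?p * (\<Sum>j=first_overlap B..n. \<beta>\<^sub>0 j)"
  proof -
    \<comment> \<open>By minimality of \<open>first_overlap\<close> these intersections are empty as
      sets, so the sum of \<open>\<beta>\<^sub>0\<close> may start at the first overlap.\<close>
    have zero: "?r i = 0" if "1 \<le> i" "i < first_overlap B" for i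
    proof -
      have "B \<inter> shift_preimage i B = {}"
        using not_less_Least[of i "\<lambda>j. j \<ge> 1 \<and> B \<inter> shift_preimage j B \<noteq> {}"] that
        by (auto simp: first_overlap_def)
      then show ?thesis by (simp add: fiber_measure_def)
    qed
    have "(\<Sum>i=1..n. ?r i) = (\<Sum>i\<in>{1..n} \<inter> {first_overlap B..}. ?r i)"
      by (rule sum.mono_neutral_right) (auto intro!: zero)
    also have "\<dots> \<le> (\<Sum>i=first_overlap B..n. ?r i)"
      by (rule sum_mono2) (use r0 in auto)
    also have "\<dots> \<le> (\<Sum>i=first_overlap B..n. ?p * \<beta>\<^sub>0 i)"
      by (rule sum_mono) (use short in auto)
    finally show ?thesis by (simp add: sum_distrib_left)
  qed
  have R2: "(\<Sum>i\<in>{n<..<h + n}. ?r i) \<le> ?p * (real h * \<beta>\<^sub>1)"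
  proof -
    have "(\<Sum>i\<in>{n<..<h + n}. ?r i) \<le> (\<Sum>i\<in>{n<..<h + n}. ?p * \<beta>\<^sub>1)"
      by (rule sum_mono) (use long in auto)
    also have "\<dots> = real (h - 1) * (?p * \<beta>\<^sub>1)" by (simp add: of_nat_diff)
    \<comment> \<open>The sign of \<open>?p * \<beta>\<^sub>1\<close> comes from the return bound
      itself, which dominates a probability.\<close>
    also have "\<dots> \<le> real h * (?p * \<beta>\<^sub>1)"
      using order_trans[OF r0 long[of n]] by (intro mult_right_mono) auto
    finally show ?thesis by (simp add: algebra_simps)
  qed
  have R: "(\<Sum>i\<in>S1. ?r i) \<le> ?p * (real h * \<beta>\<^sub>1 + (\<Sum>j=first_overlap B..n. \<beta>\<^sub>0 j))"
    using R0 R1 R2 by (simp only: distrib_left)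
  have "(\<Sum>i\<in>S1. fm \<omega> (shift_preimage i B)) \<le> real (card S1) * e"
    using sum_bounded_above[of S1 "\<lambda>i. fm \<omega> (shift_preimage i B)" e] e by simp
  also have "\<dots> \<le> real (h + n) * e"
    using card_mono[OF _ S12(4)] e0 by (intro mult_right_mono) auto
  finally have H: "(\<Sum>i\<in>S1. fm \<omega> (shift_preimage i B)) \<le> real (h + n) * e" .
  have 1: "fm \<omega> (B \<inter> avoiding B S) \<le> fm \<omega> (B \<inter> avoiding B S2)"
    by (rule fm_mono[OF \<omega>]) (use sub Bm am S12 in auto)
  have 2: "fm \<omega> (B \<inter> avoiding B S2) \<le> fm \<omega> (B \<inter> avoiding B S) + (\<Sum>i\<in>S1. ?r i)"
    by (rule fm_subadditive[OF \<omega> S12(2)]) (use hits Bm am S12 sm S in auto)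
  have 3: "fm \<omega> (avoiding B S) \<le> fm \<omega> (avoiding B S2)"
    by (rule fm_mono[OF \<omega>]) (use sub am S12 in auto)
  have 4: "fm \<omega> (avoiding B S2) \<le> fm \<omega> (avoiding B S) + (\<Sum>i\<in>S1. fm \<omega> (shift_preimage i B))"
    by (rule fm_subadditive[OF \<omega> S12(2)]) (use hits am S12 sm S in auto)
  have p0: "0 \<le> ?p" by (rule fm_nonneg)
  have pS: "?p * fm \<omega> (avoiding B S) \<le> ?p * fm \<omega> (avoiding B S2)"
    using 3 p0 by (rule mult_left_mono)
  have "?p * fm \<omega> (avoiding B S2) \<le> ?p * (fm \<omega> (avoiding B S) + real (h + n) * e)"
    using 4 H p0 by (intro mult_left_mono) auto
  then have pS2: "?p * fm \<omega> (avoiding B S2) \<le> ?p * fm \<omega> (avoiding B S) + ?p * (real (h + n) * e)"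
    by (simp add: distrib_left)
  have X0: "0 \<le> ?p * (real h * \<beta>\<^sub>1 + (\<Sum>j=first_overlap B..n. \<beta>\<^sub>0 j))"
    using R r0 by (meson order_trans sum_nonneg)
  have Y0: "0 \<le> ?p * (real (h + n) * e)" using p0 e0 by simp
  have "?p * (real h * \<beta>\<^sub>1 + (\<Sum>j=first_overlap B..n. \<beta>\<^sub>0 j) + real (h + n) * e) =
      ?p * (real h * \<beta>\<^sub>1 + (\<Sum>j=first_overlap B..n. \<beta>\<^sub>0 j)) + ?p * (real (h + n) * e)"
    by (rule distrib_left)
  then show ?thesis using 1 2 pS pS2 R mix2 X0 Y0 by linarith
qed

text \<open>The induction adds a new earliest time k. The event "hit at k, avoid S" is then the
  k-fold shift of an event in the fiber over \<theta>^k \<omega> in which all constraints lie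
  strictly in the future, so the one-step estimate applies there. The previous error is multiplied
  by 1 - q, which lies in [0,1]; hence the errors only add up.\<close>

lemma avoiding_product:
  assumes \<omega>: "\<omega> \<in> space M" and B: "B \<in> cylinder_algebra n" and S: "finite S"
    and eqv: "\<And>k S. finite S \<Longrightarrow> fm \<omega> (shift_preimage k (avoiding B S)) = fm ((\<theta> ^^ k) \<omega>) (avoiding B S)"
      "\<And>k S. finite S \<Longrightarrow> fm \<omega> (shift_preimage k (B \<inter> avoiding B S)) = fm ((\<theta> ^^ k) \<omega>) (B \<inter> avoiding B S)"
    and step: "\<And>k S. finite S \<Longrightarrow> 0 \<notin> S \<Longrightarrow> \<bar>fm ((\<theta> ^^ k) \<omega>) (B \<inter> avoiding B S)
      - fm ((\<theta> ^^ k) \<omega>) B * fm ((\<theta> ^^ k) \<omega>) (avoiding B S)\<bar> \<le> c k"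
  shows "\<bar>fm \<omega> (avoiding B S) - (\<Prod>k\<in>S. 1 - fm ((\<theta> ^^ k) \<omega>) B)\<bar> \<le> (\<Sum>k\<in>S. c k)"
  using S
proof (induction S rule: finite_linorder_min_induct)
  case empty
  have "fm \<omega> (avoiding B {}) = 1"
    using prob_space.prob_space[OF prob_space_fiber[OF \<omega>]] fiber_subset_seqs[of \<omega>]
    by (simp add: avoiding_def fiber_measure_def space_fiber[OF \<omega>] Int_absorb1)
  then show ?case by simp
next
  case (insert k S)
  let ?q = "fm ((\<theta> ^^ k) \<omega>) B" and ?T = "(\<lambda>i. i - k) ` S"
  have T: "finite ?T" "0 \<notin> ?T" using insert by auto
  have "(\<lambda>i. i + k) ` ?T = S" using insert.hyps(2) by (force simp: image_image image_iff)
  then have V: "avoiding B S = shift_preimage k (avoiding B ?T)" by (simp add: shift_preimage_avoiding)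
  have I: "shift_preimage k B \<inter> avoiding B S = shift_preimage k (B \<inter> avoiding B ?T)"
    unfolding V by (auto simp: shift_preimage_def)
  have "avoiding B (insert k S) = avoiding B S - shift_preimage k B"
    by (auto simp: avoiding_def shift_preimage_def)
  then have "fm \<omega> (avoiding B (insert k S)) = fm \<omega> (avoiding B S) - fm \<omega> (shift_preimage k B \<inter> avoiding B S)"
    using fm_Diff[OF \<omega> avoiding_seq_algebra[OF B insert.hyps(1)]
        cylinder_algebra_seq_algebra[OF shift_preimage_in_cylinder_algebra[OF B]], of k] by simp
  also have "fm \<omega> (shift_preimage k B \<inter> avoiding B S) = fm ((\<theta> ^^ k) \<omega>) (B \<inter> avoiding B ?T)"
    unfolding I by (rule eqv(2)[OF T(1)])
  finally have 1: "fm \<omega> (avoiding B (insert k S)) = fm \<omega> (avoiding B S) - fm ((\<theta> ^^ k) \<omega>) (B \<inter> avoiding B ?T)" .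
  have 2: "\<bar>fm ((\<theta> ^^ k) \<omega>) (B \<inter> avoiding B ?T) - ?q * fm \<omega> (avoiding B S)\<bar> \<le> c k"
    using step[OF T, of k] unfolding V eqv(1)[OF T(1)] .
  have q: "0 \<le> ?q" "?q \<le> 1" using fm_nonneg fm_le_1 funpow_theta_space[OF \<omega>] by auto
  let ?P = "\<Prod>k\<in>S. 1 - fm ((\<theta> ^^ k) \<omega>) B"
  have "\<bar>(1 - ?q) * (fm \<omega> (avoiding B S) - ?P)\<bar> \<le> 1 * (\<Sum>k\<in>S. c k)"
    unfolding abs_mult using q insert.IH by (intro mult_mono) auto
  then have 3: "\<bar>(fm \<omega> (avoiding B S) - ?q * fm \<omega> (avoiding B S)) - (1 - ?q) * ?P\<bar> \<le> (\<Sum>k\<in>S. c k)"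
    by (simp add: algebra_simps)
  have "k \<notin> S" using insert.hyps(2) by blast
  then have "(\<Prod>k\<in>insert k S. 1 - fm ((\<theta> ^^ k) \<omega>) B) = (1 - ?q) * ?P" "(\<Sum>k\<in>insert k S. c k) = c k + (\<Sum>k\<in>S. c k)"
    using insert.hyps(1) by auto
  then show ?case using 1 2 3 by linarith
qed

end

context random_sft_measure
begin

text \<open>The threshold for n depends on d and \<eta> but not on S. This uniformity is essential,
  because the index sets of a fixed time region change with n, and because the hitting time
  statement takes a supremum over k.\<close>

definition avoidance_asymptotics :: "(nat \<Rightarrow> (nat \<Rightarrow> enat) set) \<Rightarrow> 'a \<Rightarrow> bool" where
  "avoidance_asymptotics A \<omega> \<longleftrightarrow> (\<forall>d::nat. 0 < d \<longrightarrow> (\<forall>\<eta>>0. \<forall>\<^sub>F n in sequentially. \<forall>S. finite S \<longrightarrow>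
      S \<subseteq> {k. 1 \<le> k \<and> fiber_time \<theta> \<mu> (A n) \<omega> k \<le> real d} \<longrightarrow>
      \<bar>fm \<omega> (avoiding (A n) S) - exp (- (\<Sum>k\<in>S. fm ((\<theta> ^^ k) \<omega>) (A n)))\<bar> \<le> \<eta>))"

text \<open>Probability enters only in collecting null sets; after \<omega> is fixed the argument is
  deterministic. The bound for n and S has three contributions: short returns and hits in the gap,
  the mixing error summed over S, and the passage from the product to the exponential.\<close>

lemma AE_avoidance_asymptotics:
  fixes A :: "nat \<Rightarrow> (nat \<Rightarrow> enat) set"
  assumes A: "\<forall>n\<ge>1. A n \<in> cylinder_algebra n"
    and p: "0 < p" "p \<le> 1"
    and D: "\<forall>\<omega>\<in>space M. 0 < D \<omega>" "integrable M (\<lambda>\<omega>. D \<omega> powr p)"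
    and I: "\<forall>n\<ge>1. AE \<omega> in M.
        (\<forall>j\<le>n. fm \<omega> (A n \<inter> shift_preimage j (A n)) \<le> fm \<omega> (A n) * \<beta>\<^sub>0 j) \<and>
        (\<forall>k\<ge>n. fm \<omega> (A n \<inter> shift_preimage k (A n)) \<le> fm \<omega> (A n) * \<beta>\<^sub>1 n)"
    and II: "(\<lambda>n. ess_sup_measure M \<mu> (A n)) \<longlonglongrightarrow> 0" "\<forall>n\<ge>1. ess_sup_measure M \<mu> (A n) \<noteq> 0"
    and IV: "AE \<omega> in M. \<forall>R. finite_interval_union R \<longrightarrow>
        (\<lambda>n. INF h :: nat.
            ereal (real h * \<beta>\<^sub>1 n) + ereal (\<Sum>j=first_overlap (A n)..n. \<beta>\<^sub>0 j)
            + mixing_error M \<theta> \<mu> D p \<alpha> \<phi> h (last_time_in \<theta> \<mu> (A n) \<omega> R)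
            + ereal (real (h + n) * ess_sup_measure M \<mu> (A n))) \<longlonglongrightarrow> 0"
  shows "AE \<omega> in M. avoidance_asymptotics A \<omega>"
proof -
  define e where "e n = ess_sup_measure M \<mu> (A n)" for n
  let ?uni = "\<lambda>h. uniform_fibered_mixing (insert h {1..}) M \<theta> \<mu> D \<alpha>"
  let ?phi = "\<lambda>h. fibered_phi_mixing (insert h {1..}) M \<theta> \<mu> \<phi>"
  have An: "A n \<in> cylinder_algebra n" if "n \<in> {1..}" for n using A that by simp
  have As: "A n \<in> sets seq_algebra" if "n \<in> {1..}" for n
    by (rule cylinder_algebra_seq_algebra[OF An[OF that]])
  \<comment> \<open>There are countably many finite sets of times, so the null sets belonging to all
    avoidance events can be united.\<close>
  have cf: "countable (Collect finite :: nat set set)" by (rule countable_Collect_finite)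
  have eqv: "AE \<omega> in M. \<forall>n\<in>{1..}. \<forall>S\<in>Collect finite. \<forall>k.
      fm \<omega> (shift_preimage k (avoiding (A n) S)) = fm ((\<theta> ^^ k) \<omega>) (avoiding (A n) S) \<and>
      fm \<omega> (shift_preimage k (A n \<inter> avoiding (A n) S)) = fm ((\<theta> ^^ k) \<omega>) (A n \<inter> avoiding (A n) S) \<and>
      fm \<omega> (shift_preimage k (A n)) = fm ((\<theta> ^^ k) \<omega>) (A n)"
  proof (simp only: AE_ball_countable[OF countableI_type] AE_ball_countable[OF cf] AE_all_countable, intro ballI allI)
    fix n k S assume n: "n \<in> {1::nat..}" and S: "S \<in> Collect (finite :: nat set \<Rightarrow> bool)"
    obtain m where m: "m \<ge> 1" "avoiding (A n) S \<in> cylinder_algebra m"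
      using avoiding_in_cylinder_algebra[OF An[OF n]] S by blast
    have "A n \<inter> avoiding (A n) S \<in> cylinder_algebra (max n m)"
      by (intro cylinder_algebra_Int) (use An[OF n] m in \<open>auto intro: cylinder_algebra_mono\<close>)
    from fm_shift_preimage[OF this, of k] fm_shift_preimage[OF m(2), of k] fm_shift_preimage[OF An[OF n], of k]
    show "AE \<omega> in M. fm \<omega> (shift_preimage k (avoiding (A n) S)) = fm ((\<theta> ^^ k) \<omega>) (avoiding (A n) S) \<and>
      fm \<omega> (shift_preimage k (A n \<inter> avoiding (A n) S)) = fm ((\<theta> ^^ k) \<omega>) (A n \<inter> avoiding (A n) S) \<and>
      fm \<omega> (shift_preimage k (A n)) = fm ((\<theta> ^^ k) \<omega>) (A n)"
      by eventually_elim auto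
  qed
  have mixu: "AE \<omega> in M. \<forall>n\<in>{1..}. \<forall>S\<in>Collect finite. \<forall>h\<in>{h. ?uni h}.
      fibered_correlation \<theta> \<mu> (h + n) (A n) (avoiding (A n) S) \<omega> \<le> D \<omega> * \<alpha> h"
  proof (simp only: AE_ball_countable[OF countableI_type] AE_ball_countable[OF cf], intro ballI)
    fix n h S assume n: "n \<in> {1::nat..}" and S: "S \<in> Collect (finite :: nat set \<Rightarrow> bool)" and h: "h \<in> {h. ?uni h}"
    obtain m where m: "m \<ge> 1" "avoiding (A n) S \<in> cylinder_algebra m"
      using avoiding_in_cylinder_algebra[OF An[OF n]] S by blast
    have "AE \<omega> in M. \<forall>g\<in>insert h {1..}. fibered_correlation \<theta> \<mu> (g + n) (A n) (avoiding (A n) S) \<omega> \<le> D \<omega> * \<alpha> g"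
      using h m An[OF n] n unfolding uniform_fibered_mixing_def by auto
    then show "AE \<omega> in M. fibered_correlation \<theta> \<mu> (h + n) (A n) (avoiding (A n) S) \<omega> \<le> D \<omega> * \<alpha> h"
      by eventually_elim simp
  qed
  have mixp: "AE \<omega> in M. \<forall>n\<in>{1..}. \<forall>S\<in>Collect finite. \<forall>h\<in>{h. ?phi h}.
      fibered_correlation \<theta> \<mu> (h + n) (A n) (avoiding (A n) S) \<omega> \<le> fm \<omega> (A n) * \<phi> h"
  proof (simp only: AE_ball_countable[OF countableI_type] AE_ball_countable[OF cf], intro ballI)
    fix n h S assume n: "n \<in> {1::nat..}" and S: "S \<in> Collect (finite :: nat set \<Rightarrow> bool)" and h: "h \<in> {h. ?phi h}"
    obtain m where m: "m \<ge> 1" "avoiding (A n) S \<in> cylinder_algebra m"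
      using avoiding_in_cylinder_algebra[OF An[OF n]] S by blast
    have "AE \<omega> in M. \<forall>g\<in>insert h {1..}. fibered_correlation \<theta> \<mu> (g + n) (A n) (avoiding (A n) S) \<omega> \<le> fm \<omega> (A n) * \<phi> g"
      using h m An[OF n] n unfolding fibered_phi_mixing_def by auto
    then show "AE \<omega> in M. fibered_correlation \<theta> \<mu> (h + n) (A n) (avoiding (A n) S) \<omega> \<le> fm \<omega> (A n) * \<phi> h"
      by eventually_elim simp
  qed
  have ret: "AE \<omega> in M. \<forall>n\<in>{1..}.
        (\<forall>j\<le>n. fm \<omega> (A n \<inter> shift_preimage j (A n)) \<le> fm \<omega> (A n) * \<beta>\<^sub>0 j) \<and>
        (\<forall>k\<ge>n. fm \<omega> (A n \<inter> shift_preimage k (A n)) \<le> fm \<omega> (A n) * \<beta>\<^sub>1 n)"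
    by (simp only: AE_ball_countable[OF countableI_type], intro ballI) (use I in auto)
  have bound: "AE \<omega> in M. \<forall>n\<in>{1..}. fm \<omega> (A n) \<le> e n"
    unfolding e_def by (simp only: AE_ball_countable[OF countableI_type], intro ballI AE_fm_le_ess_sup As)
  have time: "AE \<omega> in M. \<forall>n\<in>{1..}. filterlim (fiber_time \<theta> \<mu> (A n) \<omega>) at_top sequentially"
    by (simp only: AE_ball_countable[OF countableI_type], intro ballI fiber_time_at_top As) (use II in auto)
  have avg: "AE \<omega> in M. \<exists>C. \<forall>K. (\<Sum>k<K. D ((\<theta> ^^ k) \<omega>) powr p) \<le> C * real K"
    by (rule AE_bounded_ergodic_averages[OF theta(1) D(2)]) simp
  note iter = AE_all_iterates[OF theta(1)]
  show ?thesis
    using iter[OF eqv] iter[OF mixu] iter[OF mixp] iter[OF ret] iter[OF bound] time avg IV AE_space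
  proof eventually_elim
    case (elim \<omega>)
    note eqv = elim(1)[rule_format] and mixu = elim(2)[rule_format] and mixp = elim(3)[rule_format]
      and ret = elim(4)[rule_format] and bound = elim(5)[rule_format] and time = elim(6)[rule_format]
      and IV = elim(8)[rule_format] and \<omega> = elim(9)
    obtain C where C: "\<And>K. (\<Sum>k<K. D ((\<theta> ^^ k) \<omega>) powr p) \<le> C * real K" using elim(7) by blast
    have C0: "0 \<le> C" using order_trans[OF _ C[of 1]] by simp
    show ?case
      unfolding avoidance_asymptotics_def
    proof (intro allI impI)
      fix d :: nat and \<eta> :: real assume d: "0 < d" and \<eta>: "0 < \<eta>"
      \<comment> \<open>The total weight of the errors in units of \<gamma>: one d each for the
        returns, the \<phi>-mixing error and the squares, and \<open>(2 * C) powr (1 / p)\<close>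
        for the \<alpha>-mixing error.\<close>
      define c where "c = 3 * real d + (2 * C) powr (1 / p)"
      have c: "0 < c" unfolding c_def using d by (intro add_pos_nonneg) auto
      define \<gamma> where "\<gamma> = \<eta> / c"
      have \<gamma>: "0 < \<gamma>" "c * \<gamma> = \<eta>" using c \<eta> by (simp_all add: \<gamma>_def)
      \<comment> \<open>The interval acts through its supremum d: \<open>last_time_in\<close>
        becomes the last index whose clock value is at most d, so every admissible S lies below
        it.\<close>
      let ?R = "{0<..<real d}"
      have "finite_interval_union ?R"
        unfolding finite_interval_union_def
        by (rule exI[of _ "{(0, real d)}"]) (use d in \<open>auto simp: disjoint_family_on_def\<close>)
      from IV[OF this] have lim: "(\<lambda>n. INF h :: nat.
            ereal (real h * \<beta>\<^sub>1 n) + ereal (\<Sum>j=first_overlap (A n)..n. \<beta>\<^sub>0 j)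
            + mixing_error M \<theta> \<mu> D p \<alpha> \<phi> h (last_time_in \<theta> \<mu> (A n) \<omega> ?R)
            + ereal (real (h + n) * e n)) \<longlonglongrightarrow> 0" by (simp add: e_def)
      have "\<forall>\<^sub>F n in sequentially. (INF h :: nat.
            ereal (real h * \<beta>\<^sub>1 n) + ereal (\<Sum>j=first_overlap (A n)..n. \<beta>\<^sub>0 j)
            + mixing_error M \<theta> \<mu> D p \<alpha> \<phi> h (last_time_in \<theta> \<mu> (A n) \<omega> ?R)
            + ereal (real (h + n) * e n)) < ereal \<gamma>"
        using lim by (rule order_tendstoD(2)) (use \<gamma> in simp)
      moreover have "\<forall>\<^sub>F n in sequentially. e n < \<gamma>"
        using II(1) \<gamma>(1) unfolding e_def by (rule order_tendstoD(2))
      moreover have "\<forall>\<^sub>F n in sequentially. 1 \<le> n" by (rule eventually_ge_at_top)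
      ultimately show "\<forall>\<^sub>F n in sequentially. \<forall>S. finite S \<longrightarrow>
          S \<subseteq> {k. 1 \<le> k \<and> fiber_time \<theta> \<mu> (A n) \<omega> k \<le> real d} \<longrightarrow>
          \<bar>fm \<omega> (avoiding (A n) S) - exp (- (\<Sum>k\<in>S. fm ((\<theta> ^^ k) \<omega>) (A n)))\<bar> \<le> \<eta>"
      proof eventually_elim
        case (elim n)
        let ?T = "fiber_time \<theta> \<mu> (A n) \<omega>" and ?p = "\<lambda>k. fm ((\<theta> ^^ k) \<omega>) (A n)"
        define K where "K = last_time_in \<theta> \<mu> (A n) \<omega> ?R"
        have n: "n \<in> {1..}" using elim(3) by simp
        have p0: "0 \<le> ?p k" for k by (rule fm_nonneg)
        have e0: "0 \<le> e n" using order_trans[OF p0 bound[OF n]] .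
        obtain h where h: "ereal (real h * \<beta>\<^sub>1 n) + ereal (\<Sum>j=first_overlap (A n)..n. \<beta>\<^sub>0 j)
            + mixing_error M \<theta> \<mu> D p \<alpha> \<phi> h K + ereal (real (h + n) * e n) < ereal \<gamma>"
          using elim(1) unfolding INF_less_iff K_def by blast
        have T_mono: "?T k \<le> ?T l" if "k \<le> l" for k l
          unfolding fiber_time_def by (rule sum_mono2) (use that fm_nonneg in auto)
        \<comment> \<open>A fiber over the orbit that gives \<open>A n\<close> positive measure.
          Dividing the return bounds and the \<phi>-mixing bound by this measure shows that the
          rates in them are nonnegative.\<close>
        obtain k\<^sub>0 where k0: "0 < ?p k\<^sub>0"
        proof -
          have "\<forall>\<^sub>F k in sequentially. 1 \<le> ?T k" using time[OF n] by (simp add: filterlim_at_top)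
          then obtain k where "1 \<le> ?T k" by (auto simp: eventually_sequentially)
          then have "?T k \<noteq> 0" by linarith
          then have "\<not> (\<forall>i\<in>{1..k}. ?p i = 0)" unfolding fiber_time_def by (auto intro: sum.neutral)
          then obtain i where "?p i \<noteq> 0" by blast
          then show ?thesis using that[of i] p0[of i] by (simp add: less_le)
        qed
        have \<beta>1: "0 \<le> \<beta>\<^sub>1 n"
          using order_trans[OF fm_nonneg ret[OF n, of k\<^sub>0, THEN conjunct2, rule_format, of n]] k0
          by (simp add: zero_le_mult_iff)
        have \<beta>0: "0 \<le> \<beta>\<^sub>0 j" if "j \<le> n" for j
          using order_trans[OF fm_nonneg ret[OF n, of k\<^sub>0, THEN conjunct1, rule_format, of j]] k0 that
          by (simp add: zero_le_mult_iff)
        define X where "X = real h * \<beta>\<^sub>1 n + (\<Sum>j=first_overlap (A n)..n. \<beta>\<^sub>0 j) + real (h + n) * e n"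
        have X0: "0 \<le> X" unfolding X_def using \<beta>1 \<beta>0 e0 by (intro add_nonneg_nonneg sum_nonneg) auto
        have D0: "0 < D ((\<theta> ^^ k) \<omega>)" for k using D(1) funpow_theta_space[OF \<omega>] by auto
        \<comment> \<open>A mixing bound dominates an absolute value, so dividing by D > 0 gives the
          sign of the rate; any avoidance event serves, here the one with no constraint.\<close>
        have \<alpha>0: "0 \<le> \<alpha> h" if "?uni h"
        proof -
          have "0 \<le> D ((\<theta> ^^ 0) \<omega>) * \<alpha> h"
            using order_trans[OF _ mixu[OF n, of "{}" h 0]] that by (simp add: fibered_correlation_def)
          then show ?thesis using D0[of 0] by (simp add: zero_le_mult_iff)
        qed
        have \<phi>0: "0 \<le> \<phi> h" if "?phi h"
        proof -
          have "0 \<le> ?p k\<^sub>0 * \<phi> h"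
            using order_trans[OF _ mixp[OF n, of "{}" h k\<^sub>0]] that by (simp add: fibered_correlation_def)
          then show ?thesis using k0 by (simp add: zero_le_mult_iff)
        qed
        have "0 \<le> mixing_error M \<theta> \<mu> D p \<alpha> \<phi> h K"
          using \<alpha>0 \<phi>0 by (auto simp: mixing_error_def)
        moreover have "ereal (real h * \<beta>\<^sub>1 n) + ereal (\<Sum>j=first_overlap (A n)..n. \<beta>\<^sub>0 j)
            + mixing_error M \<theta> \<mu> D p \<alpha> \<phi> h K + ereal (real (h + n) * e n) = ereal X + mixing_error M \<theta> \<mu> D p \<alpha> \<phi> h K"
          unfolding X_def plus_ereal.simps(1)[symmetric] by (simp only: ac_simps)
        \<comment> \<open>Both summands are nonnegative, so each is below \<gamma>. In particular
          the mixing error is finite, which means that one of the mixing conditions really holds at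
          gap h.\<close>
        ultimately have X\<gamma>: "X < \<gamma>" and me: "mixing_error M \<theta> \<mu> D p \<alpha> \<phi> h K < ereal \<gamma>"
          using h X0 by (cases "mixing_error M \<theta> \<mu> D p \<alpha> \<phi> h K"; simp)+
        show ?case
        proof (intro allI impI)
          fix S assume S: "finite S" "S \<subseteq> {k. 1 \<le> k \<and> ?T k \<le> real d}"
          \<comment> \<open>The mixing error \<delta> is left open, so that the estimate serves both
            kinds of mixing.\<close>
          have bd: "\<bar>fm \<omega> (avoiding (A n) S) - exp (- (\<Sum>k\<in>S. ?p k))\<bar> \<le> (\<Sum>k\<in>S. ?p k * X + \<delta> k) + (\<Sum>k\<in>S. (?p k)\<^sup>2)"
            if \<delta>: "\<And>k S. finite S \<Longrightarrow> fibered_correlation \<theta> \<mu> (h + n) (A n) (avoiding (A n) S) ((\<theta> ^^ k) \<omega>) \<le> \<delta> k" for \<delta>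
          proof -
            have "\<bar>fm \<omega> (avoiding (A n) S) - (\<Prod>k\<in>S. 1 - ?p k)\<bar> \<le> (\<Sum>k\<in>S. ?p k * X + \<delta> k)"
            proof (rule avoiding_product[OF \<omega> An[OF n] S(1)])
              fix k and S' :: "nat set" assume S': "finite S'"
              show "fm \<omega> (shift_preimage k (avoiding (A n) S')) = fm ((\<theta> ^^ k) \<omega>) (avoiding (A n) S')"
                "fm \<omega> (shift_preimage k (A n \<inter> avoiding (A n) S')) = fm ((\<theta> ^^ k) \<omega>) (A n \<inter> avoiding (A n) S')"
                using eqv[OF n, of S' 0 k] S' by simp_all
            next
              fix k and S' :: "nat set" assume S': "finite S'" "0 \<notin> S'"
              show "\<bar>fm ((\<theta> ^^ k) \<omega>) (A n \<inter> avoiding (A n) S') - ?p k * fm ((\<theta> ^^ k) \<omega>) (avoiding (A n) S')\<bar> \<le> ?p k * X + \<delta> k"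
                unfolding X_def
              proof (rule avoiding_step[OF funpow_theta_space[OF \<omega>] _ An[OF n] S'])
                show "1 \<le> n" using n by simp
                show "fm ((\<theta> ^^ k) \<omega>) (shift_preimage i (A n)) \<le> e n" for i
                  using eqv[OF n, of "{}" k i] bound[OF n, of "i + k"] by (simp add: funpow_add)
                show "fm ((\<theta> ^^ k) \<omega>) (A n \<inter> shift_preimage j (A n)) \<le> ?p k * \<beta>\<^sub>0 j" if "j \<le> n" for j
                  using ret[OF n, of k] that by blast
                show "fm ((\<theta> ^^ k) \<omega>) (A n \<inter> shift_preimage j (A n)) \<le> ?p k * \<beta>\<^sub>1 n" if "n \<le> j" for j
                  using ret[OF n, of k] that by blast
                show "\<bar>fm ((\<theta> ^^ k) \<omega>) (A n \<inter> shift_preimage (h + n) (avoiding (A n) S''))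
                    - ?p k * fm ((\<theta> ^^ k) \<omega>) (shift_preimage (h + n) (avoiding (A n) S''))\<bar> \<le> \<delta> k"
                  if "finite S''" for S''
                  using \<delta>[OF that, of k] eqv[OF n, of S'' k "h + n"] that by (simp add: fibered_correlation_def)
              qed
            qed
            moreover have "\<bar>(\<Prod>k\<in>S. 1 - ?p k) - exp (- (\<Sum>k\<in>S. ?p k))\<bar> \<le> (\<Sum>k\<in>S. (?p k)\<^sup>2)"
              by (rule prod_one_minus_exp_diff[OF S(1)]) (use p0 fm_le_1 funpow_theta_space[OF \<omega>] in auto)
            ultimately show ?thesis by linarith
          qed
          show "\<bar>fm \<omega> (avoiding (A n) S) - exp (- (\<Sum>k\<in>S. ?p k))\<bar> \<le> \<eta>"
          \<comment> \<open>For empty S the index set behind K may be empty and its maximum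
            unspecified. Both quantities are then equal to 1.\<close>
          proof (cases "S = {}")
            case True
            have "fm \<omega> (avoiding (A n) {}) = 1"
              using prob_space.prob_space[OF prob_space_fiber[OF \<omega>]] fiber_subset_seqs[of \<omega>]
              by (simp add: avoiding_def fiber_measure_def space_fiber[OF \<omega>] Int_absorb1)
            then show ?thesis using True \<eta> by simp
          next
            case False
            let ?L = "{k. k \<ge> 1 \<and> ?T k \<le> real d}"
            have "\<forall>\<^sub>F k in sequentially. real d + 1 \<le> ?T k" using time[OF n] by (simp add: filterlim_at_top)
            then obtain k1 where k1: "\<And>k. k \<ge> k1 \<Longrightarrow> real d + 1 \<le> ?T k" by (auto simp: eventually_sequentially)
            have "?L \<subseteq> {..<k1}" using k1 by (force simp: not_less[symmetric])
            then have L: "finite ?L" "?L \<noteq> {}" using S(2) False by (auto intro: finite_subset)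
            have "Sup ?R = real d" using d by simp
            then have "K = Max ?L" by (simp add: K_def last_time_in_def)
            then have K: "K \<in> ?L" "\<And>k. k \<in> ?L \<Longrightarrow> k \<le> K" using Max_in[OF L] Max_ge[OF L(1)] by auto
            have SK: "S \<subseteq> {1..K}" using S(2) K(2) by auto
            have Sp: "(\<Sum>k\<in>S. ?p k) \<le> real d"
            proof -
              have "(\<Sum>k\<in>S. ?p k) \<le> (\<Sum>k=1..K. ?p k)" by (rule sum_mono2) (use SK p0 in auto)
              also have "\<dots> = ?T K" by (simp add: fiber_time_def)
              finally show ?thesis using K(1) by simp
            qed
            have sq: "(\<Sum>k\<in>S. (?p k)\<^sup>2) \<le> \<gamma> * real d"
            proof -
              have "(\<Sum>k\<in>S. (?p k)\<^sup>2) \<le> (\<Sum>k\<in>S. \<gamma> * ?p k)"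
                unfolding power2_eq_square
              proof (intro sum_mono mult_right_mono p0)
                show "?p k \<le> \<gamma>" for k using bound[OF n, of k] elim(2) by linarith
              qed
              also have "\<dots> = \<gamma> * (\<Sum>k\<in>S. ?p k)" by (simp add: sum_distrib_left)
              also have "\<dots> \<le> \<gamma> * real d" using Sp \<gamma> by (intro mult_left_mono) auto
              finally show ?thesis .
            qed
            have pX: "(\<Sum>k\<in>S. ?p k * X) \<le> \<gamma> * real d"
            proof -
              have "(\<Sum>k\<in>S. ?p k * X) = (\<Sum>k\<in>S. ?p k) * X" by (simp add: sum_distrib_right)
              also have "\<dots> \<le> real d * \<gamma>" using Sp X0 X\<gamma> sum_nonneg[of S ?p] p0 by (intro mult_mono) auto
              finally show ?thesis by (simp add: mult.commute)
            qed
            have "(?uni h \<and> \<alpha> h * real K powr (1 / p) < \<gamma>) \<or> (?phi h \<and> \<phi> h < \<gamma>)"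
              using me by (auto simp: mixing_error_def min_less_iff_disj split: if_splits)
            then have "\<exists>\<delta>. (\<forall>k S. finite S \<longrightarrow> fibered_correlation \<theta> \<mu> (h + n) (A n) (avoiding (A n) S) ((\<theta> ^^ k) \<omega>) \<le> \<delta> k)
                \<and> (\<Sum>k\<in>S. \<delta> k) \<le> \<gamma> * (real d + (2 * C) powr (1 / p))"
            proof
              assume u: "?uni h \<and> \<alpha> h * real K powr (1 / p) < \<gamma>"
              have K1: "1 \<le> K" using K(1) by simp
              \<comment> \<open>Only D^p is integrable. Passing to p-th powers, using the bounded
                averages of D^p and taking the root again gives a sum of order K^(1/p), which is the
                factor that accompanies \<alpha> in the hypothesis.\<close>
              have "(\<Sum>k\<in>S. D ((\<theta> ^^ k) \<omega>)) powr p \<le> (\<Sum>k\<in>S. D ((\<theta> ^^ k) \<omega>) powr p)"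
                by (rule powr_sum_le[OF S(1) _ p]) (use D0 in \<open>auto intro: less_imp_le\<close>)
              \<comment> \<open>The averages start at time 0 and S ends at K, whence K + 1 terms.
                Since K \<ge> 1 this is at most 2K, the origin of the 2 in the constant
                \<open>c\<close>.\<close>
              also have "\<dots> \<le> (\<Sum>k<Suc K. D ((\<theta> ^^ k) \<omega>) powr p)"
                by (rule sum_mono2) (use SK in auto)
              also have "\<dots> \<le> C * real (Suc K)" by (rule C)
              also have "\<dots> \<le> C * (2 * real K)" using C0 K1 by (intro mult_left_mono) auto
              finally have "((\<Sum>k\<in>S. D ((\<theta> ^^ k) \<omega>)) powr p) powr (1 / p) \<le> (2 * C * real K) powr (1 / p)"
                using p by (intro powr_mono2) (auto simp: mult.assoc mult.left_commute)
              moreover have "((\<Sum>k\<in>S. D ((\<theta> ^^ k) \<omega>)) powr p) powr (1 / p) = (\<Sum>k\<in>S. D ((\<theta> ^^ k) \<omega>))"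
                using p D0 by (simp add: powr_powr sum_nonneg less_imp_le)
              moreover have "(2 * C * real K) powr (1 / p) = (2 * C) powr (1 / p) * real K powr (1 / p)"
                by (rule powr_mult)
              ultimately have "(\<Sum>k\<in>S. D ((\<theta> ^^ k) \<omega>)) \<le> (2 * C) powr (1 / p) * real K powr (1 / p)" by simp
              then have "(\<Sum>k\<in>S. D ((\<theta> ^^ k) \<omega>)) * \<alpha> h \<le> ((2 * C) powr (1 / p) * real K powr (1 / p)) * \<alpha> h"
                using \<alpha>0 u by (intro mult_right_mono) auto
              also have "\<dots> = (2 * C) powr (1 / p) * (\<alpha> h * real K powr (1 / p))" by (simp add: ac_simps)
              also have "\<dots> \<le> (2 * C) powr (1 / p) * \<gamma>" using u by (intro mult_left_mono) auto
              also have "\<dots> \<le> \<gamma> * (real d + (2 * C) powr (1 / p))" using \<gamma> by (simp add: algebra_simps)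
              finally show ?thesis
                using mixu[OF n] u by (intro exI[of _ "\<lambda>k. D ((\<theta> ^^ k) \<omega>) * \<alpha> h"]) (auto simp: sum_distrib_right)
            next
              assume u: "?phi h \<and> \<phi> h < \<gamma>"
              have "(\<Sum>k\<in>S. ?p k) * \<phi> h \<le> real d * \<gamma>"
                using Sp u \<phi>0 p0 by (intro mult_mono) auto
              also have "\<dots> \<le> \<gamma> * (real d + (2 * C) powr (1 / p))" using \<gamma> by (simp add: algebra_simps)
              finally show ?thesis
                using mixp[OF n] u by (intro exI[of _ "\<lambda>k. ?p k * \<phi> h"]) (auto simp: sum_distrib_right)
            qed
            then obtain \<delta> where \<delta>: "\<And>k S. finite S \<Longrightarrow> fibered_correlation \<theta> \<mu> (h + n) (A n) (avoiding (A n) S) ((\<theta> ^^ k) \<omega>) \<le> \<delta> k"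
              "(\<Sum>k\<in>S. \<delta> k) \<le> \<gamma> * (real d + (2 * C) powr (1 / p))" by blast
            have "\<bar>fm \<omega> (avoiding (A n) S) - exp (- (\<Sum>k\<in>S. ?p k))\<bar>
                \<le> \<gamma> * real d + \<gamma> * (real d + (2 * C) powr (1 / p)) + \<gamma> * real d"
              using bd[OF \<delta>(1)] \<delta>(2) pX sq by (simp add: sum.distrib)
            also have "\<dots> = c * \<gamma>" by (simp add: c_def algebra_simps)
            finally show ?thesis using \<gamma> by simp
          qed
        qed
      qed
    qed
  qed
qed

end

section \<open>Point measures and dyadic cells\<close>

lemma sets_half_line: "B \<in> sets half_line \<longleftrightarrow> B \<in> sets borel \<and> B \<subseteq> {0..}"
  by (auto simp: half_line_def sets_restrict_space_iff)

lemma space_half_line [simp]: "space half_line = {0..}"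
  by (simp add: half_line_def space_restrict_space)

lemma sets_dirac_sum [simp]: "sets (dirac_sum K s) = sets half_line"
  by (simp add: dirac_sum_def)

lemma emeasure_dirac_sum_count:
  assumes "\<And>k. k \<in> K \<Longrightarrow> 0 \<le> s k" and "B \<in> sets half_line"
  shows "emeasure (dirac_sum K s) B = emeasure (count_space K) {k \<in> K. s k \<in> B}"
proof -
  have "s \<in> count_space K \<rightarrow>\<^sub>M half_line" using assms(1) by auto
  moreover have "s -` B \<inter> K = {k \<in> K. s k \<in> B}" by auto
  ultimately show ?thesis unfolding dirac_sum_def using assms(2) by (simp add: emeasure_distr)
qed

lemma dirac_sum_radon_iff:
  assumes s: "\<And>k. k \<in> K \<Longrightarrow> 0 \<le> s k"
  shows "dirac_sum K s \<in> radon_point_measures \<longleftrightarrow> (\<forall>c. finite {k \<in> K. s k \<le> c})"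
proof -
  have *: "emeasure (dirac_sum K s) C < \<infinity> \<longleftrightarrow> finite {k \<in> K. s k \<in> C}" if "C \<in> sets half_line" for C
    using s that by (simp add: emeasure_dirac_sum_count emeasure_count_space top_unique less_top[symmetric])
  have "(\<forall>C. compact C \<and> C \<subseteq> {0..} \<longrightarrow> emeasure (dirac_sum K s) C < \<infinity>)
      \<longleftrightarrow> (\<forall>c. finite {k \<in> K. s k \<le> c})"
  proof (intro iffI allI impI)
    fix c assume "\<forall>C. compact C \<and> C \<subseteq> {0..} \<longrightarrow> emeasure (dirac_sum K s) C < \<infinity>"
    then have "emeasure (dirac_sum K s) {0..c} < \<infinity>" by simp
    moreover have "{0..c} \<in> sets half_line" by (auto simp: sets_half_line)
    ultimately have "finite {k \<in> K. s k \<in> {0..c}}" using * by blast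
    moreover have "{k \<in> K. s k \<in> {0..c}} = {k \<in> K. s k \<le> c}" using s by auto
    ultimately show "finite {k \<in> K. s k \<le> c}" by simp
  next
    fix C :: "real set" assume fin: "\<forall>c. finite {k \<in> K. s k \<le> c}" and C: "compact C \<and> C \<subseteq> {0..}"
    then obtain c where "\<forall>x\<in>C. x \<le> c"
      by (metis bounded_has_Sup(1) compact_imp_bounded empty_iff)
    then have "finite {k \<in> K. s k \<in> C}" by (intro finite_subset[OF _ fin[rule_format, of c]]) auto
    moreover have "C \<in> sets half_line"
      using C by (auto simp: sets_half_line intro: borel_closed compact_imp_closed)
    ultimately show "emeasure (dirac_sum K s) C < \<infinity>" using * by blast
  qed
  moreover have "\<exists>J t. (\<forall>k\<in>J. 0 \<le> t k) \<and> dirac_sum K s = dirac_sum J t" using s by blast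
  ultimately show ?thesis by (simp add: radon_point_measures_def)
qed

lemma radon_point_measureE:
  assumes "m \<in> radon_point_measures"
  obtains K s where "\<And>k. k \<in> K \<Longrightarrow> 0 \<le> s k" "m = dirac_sum K s" "\<And>c. finite {k \<in> K. s k \<le> c}"
proof -
  obtain K s where "\<forall>k\<in>K. 0 \<le> s k" "m = dirac_sum K s"
    using assms unfolding radon_point_measures_def by blast
  then show ?thesis
    using assms that[of K s] dirac_sum_radon_iff[of K s] by simp
qed

lemma sets_radon_point_measure [simp]: "m \<in> radon_point_measures \<Longrightarrow> sets m = sets half_line"
  by (erule radon_point_measureE) simp

lemma emeasure_radon_point_measure:
  assumes "m \<in> radon_point_measures" "B \<in> sets half_line" "B \<subseteq> {..c}"
  shows "\<exists>N. emeasure m B = of_nat N"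
  using assms(1)
proof (rule radon_point_measureE)
  fix K and s :: "nat \<Rightarrow> real"
  assume s: "\<And>k. k \<in> K \<Longrightarrow> 0 \<le> s k" "m = dirac_sum K s" "\<And>c. finite {k \<in> K. s k \<le> c}"
  have "finite {k \<in> K. s k \<in> B}" by (rule finite_subset[OF _ s(3)[of c]]) (use assms in auto)
  then have "emeasure m B = of_nat (card {k \<in> K. s k \<in> B})"
    using s assms by (simp add: emeasure_dirac_sum_count emeasure_count_space)
  then show ?thesis by blast
qed

section \<open>Dyadic cells\<close>

definition cell :: "nat \<Rightarrow> nat \<Rightarrow> real set" where
  "cell K j = {real j / 2 ^ K ..< real (Suc j) / 2 ^ K}"

text \<open>With membership expressed by a floor, disjointness, covering and refinement of cells
  become statements about integers.\<close>

lemma mem_cell_iff: "x \<in> cell K j \<longleftrightarrow> 0 \<le> x \<and> nat \<lfloor>x * 2 ^ K\<rfloor> = j"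
proof
  assume x: "x \<in> cell K j"
  then have "real j \<le> x * 2 ^ K" "x * 2 ^ K < real j + 1"
    by (auto simp: cell_def field_simps)
  then have "\<lfloor>x * 2 ^ K\<rfloor> = int j" by (intro floor_unique) auto
  moreover have "0 \<le> real j / 2 ^ K" by simp
  then have "0 \<le> x" using x unfolding cell_def by (meson atLeastLessThan_iff order_trans)
  ultimately show "0 \<le> x \<and> nat \<lfloor>x * 2 ^ K\<rfloor> = j" by simp
next
  assume x: "0 \<le> x \<and> nat \<lfloor>x * 2 ^ K\<rfloor> = j"
  then have "\<lfloor>x * 2 ^ K\<rfloor> = int j" by (auto simp: nat_eq_iff)
  then have "real j \<le> x * 2 ^ K" "x * 2 ^ K < real j + 1" by linarith+
  then show "x \<in> cell K j" by (auto simp: cell_def field_simps)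
qed

lemma cell_half_line [simp, measurable]: "cell K j \<in> sets half_line"
proof -
  have "cell K j \<subseteq> {0..}" by (auto simp: mem_cell_iff)
  then show ?thesis by (simp add: sets_half_line cell_def)
qed

lemma cell_bounded: "cell K j \<subseteq> {..real (Suc j)}"
proof
  fix x assume "x \<in> cell K j"
  then have "x < real (Suc j) / 2 ^ K" by (simp add: cell_def)
  also have "\<dots> \<le> real (Suc j) / 1" by (intro divide_left_mono) auto
  finally show "x \<in> {..real (Suc j)}" by simp
qed

lemma emeasure_lborel_cell: "emeasure lborel (cell K j) = ennreal (1 / 2 ^ K)"
proof -
  have "real (Suc j) / 2 ^ K - real j / 2 ^ K = 1 / 2 ^ K" by (simp add: field_simps)
  moreover have "real j / 2 ^ K \<le> real (Suc j) / 2 ^ K" by (simp add: divide_right_mono)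
  ultimately show ?thesis by (simp add: cell_def del: of_nat_Suc)
qed

lemma measure_lborel_cell: "measure lborel (cell K j) = 1 / 2 ^ K"
  by (simp add: measure_def emeasure_lborel_cell)

lemma disjoint_cells: "disjoint_family (cell K)"
proof -
  have "cell K i \<inter> cell K j = {}" if "i \<noteq> j" for i j
    using that by (auto simp: mem_cell_iff)
  then show ?thesis by (simp add: disjoint_family_on_def)
qed

lemma dist_cell: "x \<in> cell K j \<Longrightarrow> y \<in> cell K j \<Longrightarrow> \<bar>x - y\<bar> < 1 / 2 ^ K"
  by (simp add: cell_def add_divide_distrib abs_less_iff)

lemma UN_cells: "(\<Union>j<L * 2 ^ K. cell K j) = {0..<real L}"
proof (intro set_eqI iffI)
  fix x assume "x \<in> {0..<real L}"
  then have x: "0 \<le> x" "x * 2 ^ K < real L * 2 ^ K" by auto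
  then have "nat \<lfloor>x * 2 ^ K\<rfloor> < L * 2 ^ K" by (simp add: nat_less_iff floor_less_iff)
  then show "x \<in> (\<Union>j<L * 2 ^ K. cell K j)" using x by (auto simp: mem_cell_iff)
next
  fix x assume "x \<in> (\<Union>j<L * 2 ^ K. cell K j)"
  then have x: "0 \<le> x" "nat \<lfloor>x * 2 ^ K\<rfloor> < L * 2 ^ K" by (auto simp: mem_cell_iff)
  then have "x * 2 ^ K < real L * 2 ^ K" by (simp add: nat_less_iff floor_less_iff)
  then show "x \<in> {0..<real L}" using x by simp
qed

text \<open>The floor of y / 2^r is the integer quotient of the floor of y by 2^r.\<close>

lemma mem_cell_refine: "x \<in> cell (K + r) i \<Longrightarrow> x \<in> cell K (i div 2 ^ r)"
proof -
  assume "x \<in> cell (K + r) i"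
  then have x: "0 \<le> x" "int i = \<lfloor>x * 2 ^ (K + r)\<rfloor>" by (auto simp: mem_cell_iff nat_eq_iff)
  have "\<lfloor>x * 2 ^ K\<rfloor> = \<lfloor>(x * 2 ^ (K + r)) / real_of_int (2 ^ r)\<rfloor>" by (simp add: power_add)
  also have "\<dots> = \<lfloor>x * 2 ^ (K + r)\<rfloor> div 2 ^ r"
    by (rule floor_divide_real_eq_div) simp
  also have "\<dots> = int (i div 2 ^ r)" using x by (simp add: zdiv_int)
  finally show ?thesis using x by (simp add: mem_cell_iff)
qed

lemma cell_eq_UN_subcells:
  assumes "j < L * 2 ^ K"
  shows "cell K j = (\<Union>i\<in>{i. i < L * 2 ^ (K + r) \<and> i div 2 ^ r = j}. cell (K + r) i)"
proof (intro set_eqI iffI)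
  fix x assume x: "x \<in> cell K j"
  then have "x \<in> {0..<real L}" using assms unfolding UN_cells[symmetric, of _ K] by blast
  then obtain i where i: "i < L * 2 ^ (K + r)" "x \<in> cell (K + r) i"
    unfolding UN_cells[symmetric, of _ "K + r"] by blast
  then have "i div 2 ^ r = j" using mem_cell_refine[OF i(2)] x by (simp add: mem_cell_iff)
  with i show "x \<in> (\<Union>i\<in>{i. i < L * 2 ^ (K + r) \<and> i div 2 ^ r = j}. cell (K + r) i)" by blast
qed (use mem_cell_refine in auto)

lemma emeasure_cell_subcells:
  assumes "m \<in> radon_point_measures" "j < L * 2 ^ K"
  shows "emeasure m (cell K j) =
    (\<Sum>i | i < L * 2 ^ (K + r) \<and> i div 2 ^ r = j. emeasure m (cell (K + r) i))"
  unfolding cell_eq_UN_subcells[OF assms(2), of r]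
  by (rule sum_emeasure[symmetric])
     (use assms disjoint_cells[of "K + r"] in \<open>auto simp: disjoint_family_on_def\<close>)

lemma not_in_frontier_of:
  assumes "x \<in> {0..}" "x \<notin> top_of_set {0..} frontier_of B"
  shows "\<exists>\<delta>>0. \<forall>y\<ge>0. \<bar>y - x\<bar> < \<delta> \<longrightarrow> (y \<in> B \<longleftrightarrow> x \<in> (B :: real set))"
proof -
  have "\<exists>T. openin (top_of_set {0..}) T \<and> x \<in> T \<and> (T \<subseteq> B \<or> T \<inter> B = {})"
  proof (cases "x \<in> top_of_set {0..} interior_of B")
    case True
    then show ?thesis by (auto simp: interior_of_def)
  next
    case False
    then have "x \<notin> top_of_set {0..} closure_of B" using assms by (auto simp: frontier_of_def)
    then show ?thesis using assms(1) by (auto simp: in_closure_of)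
  qed
  then obtain U where U: "open U" "x \<in> U" "{0..} \<inter> U \<subseteq> B \<or> {0..} \<inter> U \<inter> B = {}"
    unfolding openin_open by blast
  then obtain \<delta> where \<delta>: "\<delta> > 0" "\<And>y. dist y x < \<delta> \<Longrightarrow> y \<in> U"
    by (metis open_dist)
  show ?thesis
  proof (intro exI[of _ \<delta>] conjI allI impI \<delta>(1))
    fix y :: real assume y: "0 \<le> y" "\<bar>y - x\<bar> < \<delta>"
    then have "y \<in> U" using \<delta>(2) by (simp add: dist_real_def)
    then show "(y \<in> B) = (x \<in> B)" using U y assms(1) by auto
  qed
qed

text \<open>Near B the measure m has finitely many atoms, none on the boundary of B, so some
  \<delta> works for all of them: points within \<delta> of an atom lie in B exactly if the atom
  does. Once the mesh is below \<delta>, a cell that carries mass and meets B is contained in B. The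
  counts of B then agree exactly, not only in the limit.\<close>

lemma vaguely_converges_of_cells:
  assumes m: "m \<in> radon_point_measures" and ms: "\<And>K. ms K \<in> radon_point_measures"
    and eq: "\<And>K j. j < K * 2 ^ K \<Longrightarrow> emeasure (ms K) (cell K j) = emeasure m (cell K j)"
  shows "vaguely_converges ms m"
  unfolding vaguely_converges_def
proof (intro ballI impI)
  fix B assume B: "B \<in> sets half_line"
    and *: "compact (closure B) \<and> emeasure m (top_of_set {0..} frontier_of B) = 0"
  let ?F = "top_of_set {0..} frontier_of B"
  have "bounded B" using * bounded_closure_image bounded_subset closure_subset compact_imp_bounded by metis
  then obtain c where "\<forall>x\<in>B. \<bar>x\<bar> \<le> c" by (auto simp: bounded_iff)
  then have Bc: "B \<subseteq> {0..<real c'}" if "c < real c'" for c'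
    using B that by (force simp: sets_half_line)
  \<comment> \<open>The margin of 1 is there because an atom sharing a cell with a point of B may
    exceed the bound c by less than \<delta> \<le> 1.\<close>
  obtain c' where c': "c + 1 < real c'" using reals_Archimedean2 by blast
  obtain J s where s: "\<And>k. k \<in> J \<Longrightarrow> 0 \<le> s k" "m = dirac_sum J s" "\<And>c. finite {k \<in> J. s k \<le> c}"
    using radon_point_measureE[OF m] by blast
  have "closedin (top_of_set {0..}) ?F" by (rule closedin_frontier_of)
  then have "closed ?F \<and> ?F \<subseteq> {0..}" using closedin_closed_eq[OF closed_atLeast] by blast
  then have "?F \<in> sets half_line" by (auto simp: sets_half_line)
  then have "emeasure (count_space J) {k \<in> J. s k \<in> ?F} = 0"
    using * s by (simp add: emeasure_dirac_sum_count)
  then have "{k \<in> J. s k \<in> ?F} = {}" by (subst (asm) emeasure_count_space_eq_0) auto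
  then have "\<exists>\<delta>>0. \<forall>y\<ge>0. \<bar>y - s k\<bar> < \<delta> \<longrightarrow> (y \<in> B \<longleftrightarrow> s k \<in> B)" if "k \<in> J" for k
    using that s(1) by (intro not_in_frontier_of) auto
  then obtain d where d: "\<And>k. k \<in> J \<Longrightarrow> d k > 0"
    "\<And>k y. k \<in> J \<Longrightarrow> 0 \<le> y \<Longrightarrow> \<bar>y - s k\<bar> < d k \<Longrightarrow> (y \<in> B \<longleftrightarrow> s k \<in> B)" by metis
  \<comment> \<open>Inserting 1 gives the minimum a nonempty set and ensures \<delta> \<le>
    1.\<close>
  define \<delta> where "\<delta> = Min (insert 1 (d ` {k \<in> J. s k \<le> real c'}))"
  have \<delta>: "\<delta> > 0" "\<delta> \<le> 1" "\<And>k. k \<in> J \<Longrightarrow> s k \<le> real c' \<Longrightarrow> \<delta> \<le> d k"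
    unfolding \<delta>_def using s(3) d(1) by (auto simp: Min_gr_iff)
  have "\<forall>\<^sub>F K in sequentially. emeasure (ms K) B = emeasure m B"
  proof -
    have "(\<lambda>K. 1 / 2 ^ K :: real) \<longlonglongrightarrow> 0" by real_asymp
    then have "\<forall>\<^sub>F K in sequentially. 1 / 2 ^ K < \<delta>" using \<delta>(1) by (rule order_tendstoD(2))
    moreover have "\<forall>\<^sub>F K in sequentially. c' \<le> K" by (rule eventually_ge_at_top)
    ultimately show ?thesis
    proof eventually_elim
      case (elim K)
      have BK: "B \<subseteq> {0..<real K}" using Bc[of K] c' elim by simp
      have split: "emeasure m' B = (\<Sum>j<K * 2 ^ K. emeasure m' (B \<inter> cell K j))"
        if m': "m' \<in> radon_point_measures" for m'
      proof -
        have "B = (\<Union>j<K * 2 ^ K. B \<inter> cell K j)"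
          using BK unfolding UN_cells[symmetric, of K K] by blast
        moreover have "(\<Sum>j<K * 2 ^ K. emeasure m' (B \<inter> cell K j)) = emeasure m' (\<Union>j<K * 2 ^ K. B \<inter> cell K j)"
          by (rule sum_emeasure)
             (use m' B disjoint_cells[of K] in \<open>auto simp: disjoint_family_on_def\<close>)
        ultimately show ?thesis by simp
      qed
      have "emeasure (ms K) (B \<inter> cell K j) = emeasure m (B \<inter> cell K j)" if j: "j < K * 2 ^ K" for j
      proof (cases "B \<inter> cell K j = {} \<or> emeasure m (cell K j) = 0")
        case True
        then show ?thesis
        proof
          assume 0: "emeasure m (cell K j) = 0"
          then have "emeasure (ms K) (cell K j) = 0" using eq j by simp
          have "emeasure (ms K) (B \<inter> cell K j) = 0"
            by (rule emeasure_eq_0[OF _ \<open>emeasure (ms K) (cell K j) = 0\<close>]) (use ms in auto)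
          moreover have "emeasure m (B \<inter> cell K j) = 0"
            by (rule emeasure_eq_0[OF _ 0]) (use m in auto)
          ultimately show ?thesis by simp
        qed simp
      next
        case False
        then obtain x where x: "x \<in> B" "x \<in> cell K j" by blast
        have "emeasure (count_space J) {k \<in> J. s k \<in> cell K j} \<noteq> 0"
          using False s by (simp add: emeasure_dirac_sum_count)
        then have "{k \<in> J. s k \<in> cell K j} \<noteq> {}" by (metis emeasure_empty)
        then obtain k where k: "k \<in> J" "s k \<in> cell K j" by blast
        have "x \<le> c" using x \<open>\<forall>x\<in>B. \<bar>x\<bar> \<le> c\<close> by force
        have close: "\<bar>y - s k\<bar> < \<delta>" if "y \<in> cell K j" for y
          using dist_cell[OF that k(2)] elim by linarith
        have "s k \<le> real c'" using close[OF x(2)] \<delta>(2) \<open>x \<le> c\<close> c' by linarith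
        then have "y \<in> B \<longleftrightarrow> s k \<in> B" if "y \<in> cell K j" for y
          using d(2)[OF k(1), of y] close[OF that] \<delta>(3)[OF k(1)] that by (force simp: mem_cell_iff)
        then have "B \<inter> cell K j = cell K j" using x by blast
        then show ?thesis using eq[OF j] by simp
      qed
      then show ?case using split[OF m] split[OF ms] by simp
    qed
  qed
  then show "(\<lambda>K. emeasure (ms K) B) \<longlonglongrightarrow> emeasure m B"
    by (rule tendsto_eventually)
qed

text \<open>One parameter governs both the window [0,K) and the mesh 2^-K. Measures whose K-th
  profile agrees with that of m for every K therefore converge vaguely to m.\<close>

definition profile :: "nat \<Rightarrow> real measure \<Rightarrow> ennreal list" where
  "profile K m = map (\<lambda>j. emeasure m (cell K j)) [0..<K * 2 ^ K]"

lemma profile_eq_iff: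
  "profile K m = profile K m' \<longleftrightarrow> (\<forall>j<K * 2 ^ K. emeasure m (cell K j) = emeasure m' (cell K j))"
  by (auto simp: profile_def)

lemma profile_eq_antimono:
  assumes "m \<in> radon_point_measures" "m' \<in> radon_point_measures"
    and "profile (Suc K) m = profile (Suc K) m'"
  shows "profile K m = profile K m'"
  unfolding profile_eq_iff
proof (intro allI impI)
  fix j assume j: "j < K * 2 ^ K"
  have "emeasure m (cell (K + 1) i) = emeasure m' (cell (K + 1) i)" if "i < K * 2 ^ (K + 1)" for i
  proof -
    have "i < Suc K * 2 ^ Suc K" using that by (rule order_less_le_trans) simp
    then show ?thesis using assms(3) by (simp add: profile_eq_iff)
  qed
  then show "emeasure m (cell K j) = emeasure m' (cell K j)"
    unfolding emeasure_cell_subcells[OF assms(1) j, of 1] emeasure_cell_subcells[OF assms(2) j, of 1]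
    by (intro sum.cong) auto
qed

lemma profile_in_lists:
  assumes m: "m \<in> radon_point_measures"
  shows "profile K m \<in> lists (range of_nat)"
proof -
  have "emeasure m (cell K j) \<in> range of_nat" for j
    using emeasure_radon_point_measure[OF m cell_half_line cell_bounded, of K j] by auto
  then show ?thesis by (auto simp: profile_def in_lists_conv_set simp del: range_eqI)
qed

lemma countable_lists_of_nat: "countable (lists (range of_nat) :: ennreal list set)"
  by (intro countable_lists) auto

text \<open>A point measure lies in an open set \<open>U\<close> iff, for some \<open>K\<close>, every point measure with the
  same \<open>K\<close>-th profile lies in \<open>U\<close>: otherwise there would be a sequence outside \<open>U\<close> that converges
  to it.\<close>

definition inner_profiles :: "real measure set \<Rightarrow> nat \<Rightarrow> ennreal list set" where
  "inner_profiles U K = {v. \<forall>m\<in>radon_point_measures. profile K m = v \<longrightarrow> m \<in> U}"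

lemma inner_profiles_mono:
  assumes "K \<le> L" "m \<in> radon_point_measures" "profile K m \<in> inner_profiles U K"
  shows "profile L m \<in> inner_profiles U L"
  using assms
proof (induction L rule: dec_induct)
  case (step L)
  then show ?case using profile_eq_antimono[of _ m L] unfolding inner_profiles_def by blast
qed

lemma open_point_measure_set:
  assumes "openin point_measure_topology U"
  shows "U = (\<Union>K. {m \<in> radon_point_measures. profile K m \<in> inner_profiles U K})"
proof (intro set_eqI iffI)
  fix m assume m: "m \<in> U"
  have U: "U \<subseteq> radon_point_measures"
    "\<And>ms. range ms \<subseteq> radon_point_measures \<Longrightarrow> vaguely_converges ms m \<Longrightarrow> \<forall>\<^sub>F k in sequentially. ms k \<in> U"
    using assms m by (simp_all add: openin_point_measure_topology)
  have "\<exists>K. profile K m \<in> inner_profiles U K"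
  proof (rule ccontr)
    assume "\<nexists>K. profile K m \<in> inner_profiles U K"
    then have "\<forall>K. \<exists>m'. m' \<in> radon_point_measures \<and> profile K m' = profile K m \<and> m' \<notin> U"
      unfolding inner_profiles_def by blast
    then obtain ms where ms: "\<And>K. ms K \<in> radon_point_measures" "\<And>K. profile K (ms K) = profile K m"
      "\<And>K. ms K \<notin> U" by metis
    have "vaguely_converges ms m"
      by (rule vaguely_converges_of_cells) (use ms m U(1) in \<open>auto simp: profile_eq_iff\<close>)
    then show False using U(2)[of ms] ms by auto
  qed
  then show "m \<in> (\<Union>K. {m \<in> radon_point_measures. profile K m \<in> inner_profiles U K})"
    using m U(1) by blast
qed (auto simp: inner_profiles_def)

section \<open>Borel sets of point measures and measurability of counts\<close>

lemma space_point_measure_algebra [simp]: "space point_measure_algebra = radon_point_measures"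
  unfolding point_measure_algebra_def
  by (rule space_measure_of) (auto simp: openin_point_measure_topology)

lemma sets_point_measure_algebra:
  "sets point_measure_algebra = sigma_sets radon_point_measures {U. openin point_measure_topology U}"
  unfolding point_measure_algebra_def
  by (rule sets_measure_of) (auto simp: openin_point_measure_topology)

lemma open_in_point_measure_algebra:
  "openin point_measure_topology U \<Longrightarrow> U \<in> sets point_measure_algebra"
  by (simp add: sets_point_measure_algebra)

text \<open>Profiles of Radon point measures are lists of natural numbers. There are only countably
  many of these, so an arbitrary V is allowed.\<close>

lemma measurable_profile_set:
  assumes f: "\<And>x. x \<in> space P \<Longrightarrow> f x \<in> radon_point_measures"
    and [measurable]: "\<And>j. (\<lambda>x. emeasure (f x) (cell K j)) \<in> borel_measurable P"
  shows "{x \<in> space P. profile K (f x) \<in> V} \<in> sets P"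
proof -
  have "{x \<in> space P. profile K (f x) \<in> V} =
      (\<Union>v\<in>lists (range of_nat) \<inter> {v\<in>V. length v = K * 2 ^ K}.
        {x \<in> space P. \<forall>j<K * 2 ^ K. emeasure (f x) (cell K j) = v ! j})"
    (is "_ = (\<Union>v\<in>?V. _)")
  proof (intro set_eqI iffI)
    fix x assume "x \<in> {x \<in> space P. profile K (f x) \<in> V}"
    then show "x \<in> (\<Union>v\<in>?V. {x \<in> space P. \<forall>j<K * 2 ^ K. emeasure (f x) (cell K j) = v ! j})"
      using profile_in_lists[OF f]
      by (intro UN_I[of "profile K (f x)"]) (auto simp: profile_def)
  next
    fix x assume "x \<in> (\<Union>v\<in>?V. {x \<in> space P. \<forall>j<K * 2 ^ K. emeasure (f x) (cell K j) = v ! j})"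
    then obtain v where v: "v \<in> V" "length v = K * 2 ^ K" "x \<in> space P"
      "\<And>j. j < K * 2 ^ K \<Longrightarrow> emeasure (f x) (cell K j) = v ! j" by auto
    then have "profile K (f x) = v" by (intro nth_equalityI) (auto simp: profile_def)
    then show "x \<in> {x \<in> space P. profile K (f x) \<in> V}" using v by simp
  qed
  moreover have "(\<Union>v\<in>?V. {x \<in> space P. \<forall>j<K * 2 ^ K. emeasure (f x) (cell K j) = v ! j}) \<in> sets P"
    by (intro sets.countable_UN' countable_subset[OF _ countable_lists_of_nat]) auto
  ultimately show ?thesis by simp
qed

text \<open>An open set is a countable union of profile events, so the counts of dyadic cells decide
  measurability.\<close>

lemma measurable_point_measure_algebraI:
  assumes f: "\<And>x. x \<in> space P \<Longrightarrow> f x \<in> radon_point_measures"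
    and m: "\<And>K j. (\<lambda>x. emeasure (f x) (cell K j)) \<in> borel_measurable P"
  shows "f \<in> P \<rightarrow>\<^sub>M point_measure_algebra"
  unfolding point_measure_algebra_def
proof (rule measurable_measure_of)
  fix U assume "U \<in> {U. openin point_measure_topology U}"
  then have U: "U = (\<Union>K. {m \<in> radon_point_measures. profile K m \<in> inner_profiles U K})"
    by (intro open_point_measure_set) simp
  have "f -` U \<inter> space P = (\<Union>K. {x \<in> space P. profile K (f x) \<in> inner_profiles U K})"
    by (subst U) (use f in auto)
  then show "f -` U \<inter> space P \<in> sets P"
    using measurable_profile_set[OF f m] by auto
qed (use f in \<open>auto simp: openin_point_measure_topology\<close>)

text \<open>Lower semicontinuity: mass above c in [0,d) is already present in [0,t) for some t < d.
  Since m has countably many atoms, t can be moved off them, and then [0,t) is a continuity set,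
  because its boundary in the half-line is at most {t}.\<close>

lemma openin_initial_mass:
  "openin point_measure_topology {m \<in> radon_point_measures. c < emeasure m {0..<d}}"
  unfolding openin_point_measure_topology
proof (intro conjI ballI allI impI)
  fix m ms assume m: "m \<in> {m \<in> radon_point_measures. c < emeasure m {0..<d}}"
    and ms: "range ms \<subseteq> radon_point_measures \<and> vaguely_converges ms m"
  have hl: "{0..<t} \<in> sets half_line" for t :: real by (auto simp: sets_half_line)
  have mono: "emeasure m' {0..<s} \<le> emeasure m' {0..<t}" if "s \<le> t" "m' \<in> radon_point_measures"
    for m' s t by (rule emeasure_mono) (use that hl in auto)
  obtain J s where s: "\<And>k. k \<in> J \<Longrightarrow> 0 \<le> s k" "m = dirac_sum J s" "\<And>c. finite {k \<in> J. s k \<le> c}"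
    using m radon_point_measureE[of m] by blast
  have d: "0 < d"
  proof (rule ccontr)
    assume "\<not> 0 < d"
    then have "{0..<d} = {}" by auto
    then show False using m by simp
  qed
  have "(\<lambda>n. emeasure m {0..<d - 1 / real (Suc n)}) \<longlonglongrightarrow> emeasure m (\<Union>n. {0..<d - 1 / real (Suc n)})"
    by (rule Lim_emeasure_incseq)
       (use m hl in \<open>auto simp: incseq_def field_simps intro: order_less_le_trans\<close>)
  moreover have "(\<Union>n. {0..<d - 1 / real (Suc n)}) = {0..<d}"
  proof (intro set_eqI iffI)
    fix x assume x: "x \<in> {0..<d}"
    then obtain n where "1 / real (Suc n) < d - x" using nat_approx_posE[of "d - x"] by auto
    then show "x \<in> (\<Union>n. {0..<d - 1 / real (Suc n)})" using x by (intro UN_I[of n]) auto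
  next
    fix x assume "x \<in> (\<Union>n. {0..<d - 1 / real (Suc n)})"
    then obtain n where "0 \<le> x" "x < d - 1 / real (Suc n)" by auto
    moreover have "0 < 1 / real (Suc n)" by simp
    ultimately have "0 \<le> x" "x < d" by linarith+
    then show "x \<in> {0..<d}" by simp
  qed
  ultimately have "\<forall>\<^sub>F n in sequentially. c < emeasure m {0..<d - 1 / real (Suc n)}"
    using m by (intro order_tendstoD(1)) auto
  then obtain n where n: "c < emeasure m {0..<d - 1 / real (Suc n)}"
    by (auto simp: eventually_sequentially)
  have "0 < 1 / real (Suc n)" by simp
  then have "uncountable {d - 1 / real (Suc n)<..<d}" by (simp add: uncountable_open_interval)
  then have "uncountable ({d - 1 / real (Suc n)<..<d} - s ` J)"
    by (rule uncountable_minus_countable) simp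
  then obtain t where t: "d - 1 / real (Suc n) < t" "t < d" "t \<notin> s ` J"
    by (metis DiffD1 DiffD2 countable_empty equals0I greaterThanLessThan_iff)
  have "top_of_set {0..} frontier_of {0..<t} \<subseteq> {t}"
  proof -
    have "{0..<t} = {0..} \<inter> {..<t}" "{0..t} = {0..} \<inter> {..t}" by auto
    then have "openin (top_of_set {0..}) {0..<t}" "closedin (top_of_set {0..}) {0..t}"
      by (metis open_lessThan openin_open_Int) (metis closed_atMost closedin_closed_Int \<open>{0..t} = {0..} \<inter> {..t}\<close>)
    then have "top_of_set {0..} interior_of {0..<t} = {0..<t}" "top_of_set {0..} closure_of {0..<t} \<subseteq> {0..t}"
      using closure_of_minimal[of "{0..<t}" "{0..t}" "top_of_set {0..}"]
      by (auto simp only: interior_of_openin ivl_subset atLeastLessThan_subseteq_atLeastAtMost_iff)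
    then show ?thesis by (force simp: frontier_of_def)
  qed
  then have "emeasure m (top_of_set {0..} frontier_of {0..<t}) = 0"
  proof -
    assume sub: "top_of_set {0..} frontier_of {0..<t} \<subseteq> {t}"
    show ?thesis
    proof (cases "0 \<le> t")
      case True
      have "emeasure m {t} = emeasure (count_space J) {k \<in> J. s k \<in> {t}}"
        unfolding s(2) by (rule emeasure_dirac_sum_count) (use s True in \<open>auto simp: sets_half_line\<close>)
      also have "{k \<in> J. s k \<in> {t}} = {}" using t by auto
      finally show ?thesis
        by (intro emeasure_eq_0[OF _ _ sub]) (use m True in \<open>auto simp: sets_half_line\<close>)
    next
      case False
      then have "{0..<t} = {}" by auto
      then show ?thesis by simp
    qed
  qed
  moreover have "compact (closure {0..<t})"
    by (simp add: compact_closure bounded_subset[OF bounded_closed_interval[of 0 t]] subset_eq)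
  ultimately have "(\<lambda>k. emeasure (ms k) {0..<t}) \<longlonglongrightarrow> emeasure m {0..<t}"
    using ms hl unfolding vaguely_converges_def by blast
  moreover have "c < emeasure m {0..<t}" using n mono[of "d - 1 / real (Suc n)" t m] t m by force
  ultimately have "\<forall>\<^sub>F k in sequentially. c < emeasure (ms k) {0..<t}" by (rule order_tendstoD(1))
  then show "\<forall>\<^sub>F k in sequentially. ms k \<in> {m \<in> radon_point_measures. c < emeasure m {0..<d}}"
  proof eventually_elim
    case (elim k)
    have "ms k \<in> radon_point_measures" using ms by auto
    then show ?case using elim mono[of t d "ms k"] t by (auto intro: order_less_le_trans)
  qed
qed auto

lemma measurable_emeasure_initial:
  "(\<lambda>m. emeasure m {0..<d}) \<in> borel_measurable point_measure_algebra"
proof (rule borel_measurableI_greater)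
  fix c
  have "{m \<in> space point_measure_algebra. c < emeasure m {0..<d}} \<in> sets point_measure_algebra"
    using open_in_point_measure_algebra[OF openin_initial_mass] by simp
  then show "{m \<in> space point_measure_algebra. c < emeasure m {0..<d}} \<in> sets point_measure_algebra" .
qed

lemma half_line_sigma_sets: "sets half_line = sigma_sets {0..} (range (\<lambda>d. {0..<d::real}))"
proof -
  have "sets (borel :: real measure) = sigma_sets UNIV (range lessThan)"
    by (subst borel_Iio) (simp add: sets_measure_of)
  then have "sets half_line = sigma_sets {0..} ((\<inter>) {0..} ` range (lessThan :: real \<Rightarrow> _))"
    unfolding half_line_def sets_restrict_space
    by (simp only: \<open>sets borel = _\<close>) (rule sigma_sets_Int, auto simp flip: \<open>sets borel = _\<close>)
  also have "(\<inter>) {0..} ` range lessThan = range (\<lambda>d. {0..<d::real})"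
    by (auto simp: image_image atLeastLessThan_def atLeast_def lessThan_def Int_def)
  finally show ?thesis .
qed

text \<open>A Dynkin argument starting from initial intervals, whose counts are measurable by lower
  semicontinuity. It runs inside [0,n), where counts are finite and complements become differences;
  the supremum over n removes the truncation.\<close>

lemma measurable_emeasure_point_measure [measurable]:
  assumes B: "B \<in> sets half_line"
  shows "(\<lambda>m. emeasure m B) \<in> borel_measurable point_measure_algebra"
proof -
  have hl: "{0..<t} \<in> sets half_line" for t :: real by (auto simp: sets_half_line)
  have fin: "emeasure m (B \<inter> {0..<real n}) \<noteq> \<infinity>" if "m \<in> radon_point_measures" "B \<in> sets half_line" for m n B
    using emeasure_radon_point_measure[OF that(1), of "B \<inter> {0..<real n}" "real n"] that hl[of "real n"]
    by (force simp: top_unique)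
  have "(\<lambda>m. emeasure m (B \<inter> {0..<real n})) \<in> borel_measurable point_measure_algebra" for n
  proof -
    have "Int_stable (range (\<lambda>d. {0..<d::real}))"
      by (auto simp: Int_stable_def)
    moreover have "range (\<lambda>d. {0..<d::real}) \<subseteq> Pow {0..}" by auto
    moreover have "B \<in> sigma_sets {0..} (range (\<lambda>d. {0..<d::real}))"
      using B unfolding half_line_sigma_sets .
    ultimately show ?thesis
    proof (induction rule: sigma_sets_induct_disjoint)
      case (basic B)
      then obtain d where "B = {0..<d}" by blast
      then have "B \<inter> {0..<real n} = {0..<min d (real n)}" by auto
      then show ?case by (simp add: measurable_emeasure_initial)
    next
      case empty
      then show ?case by simp
    next
      case (compl B)
      then have B: "B \<in> sets half_line" unfolding half_line_sigma_sets by simp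
      have "emeasure m (({0..} - B) \<inter> {0..<real n}) = emeasure m {0..<real n} - emeasure m (B \<inter> {0..<real n})"
        if "m \<in> radon_point_measures" for m
      proof -
        have "({0..} - B) \<inter> {0..<real n} = {0..<real n} - (B \<inter> {0..<real n})" by auto
        then show ?thesis using fin[OF that B, of n] that B hl
          by (simp add: emeasure_Diff sets.Int)
      qed
      then show ?case using compl measurable_emeasure_initial[of "real n"]
        by (subst measurable_cong[where g="\<lambda>m. emeasure m {0..<real n} - emeasure m (B \<inter> {0..<real n})"]) auto
    next
      case (union F)
      then have F: "F i \<in> sets half_line" for i unfolding half_line_sigma_sets by auto
      have "emeasure m ((\<Union>i. F i) \<inter> {0..<real n}) = (\<Sum>i. emeasure m (F i \<inter> {0..<real n}))"
        if "m \<in> radon_point_measures" for m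
      proof -
        have "(\<Union>i. F i) \<inter> {0..<real n} = (\<Union>i. F i \<inter> {0..<real n})" by auto
        moreover have "(\<Sum>i. emeasure m (F i \<inter> {0..<real n})) = emeasure m (\<Union>i. F i \<inter> {0..<real n})"
        proof (rule suminf_emeasure)
          show "disjoint_family (\<lambda>i. F i \<inter> {0..<real n})"
            using union(1) unfolding disjoint_family_on_def by blast
        qed (use F hl that in auto)
        ultimately show ?thesis by simp
      qed
      then show ?case using union
        by (subst measurable_cong[where g="\<lambda>m. \<Sum>i. emeasure m (F i \<inter> {0..<real n})"]) auto
    qed
  qed
  moreover have "emeasure m B = (SUP n. emeasure m (B \<inter> {0..<real n}))"
    if "m \<in> radon_point_measures" for m
  proof -
    have "(SUP n. emeasure m (B \<inter> {0..<real n})) = emeasure m (\<Union>n. B \<inter> {0..<real n})"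
      by (rule SUP_emeasure_incseq) (use B hl that in \<open>auto simp: incseq_def\<close>)
    moreover have "(\<Union>n. B \<inter> {0..<real n}) = B"
      using B reals_Archimedean2 by (auto simp: sets_half_line) blast
    ultimately show ?thesis by simp
  qed
  ultimately show ?thesis
    by (subst measurable_cong[where g="\<lambda>m. SUP n. emeasure m (B \<inter> {0..<real n})"]) auto
qed

section \<open>Convergence to the Poisson process\<close>

text \<open>The portmanteau criterion on the line, applied to the two open rays at x. At a
  continuity point the ray \<open>{..<x}\<close> carries all of the distribution function, and
  \<open>{x<..}\<close> gives the upper bound through its complement.\<close>

lemma weak_conv_m_if_open:
  fixes Q :: "nat \<Rightarrow> real measure"
  assumes "\<And>n. real_distribution (Q n)" "real_distribution L"
    and op: "\<And>U c. open U \<Longrightarrow> c < measure L U \<Longrightarrow> \<forall>\<^sub>F n in sequentially. c < measure (Q n) U"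
  shows "weak_conv_m Q L"
  unfolding weak_conv_m_def weak_conv_def
proof (intro allI impI)
  fix x assume cont: "isCont (cdf L) x"
  interpret L: real_distribution L by fact
  interpret Q: real_distribution "Q n" for n by fact
  have "{..x} = {..<x} \<union> {x}" by auto
  then have "cdf L x = measure L {..<x} + measure L {x}"
    unfolding cdf_def by (simp only:) (rule L.finite_measure_Union, auto)
  then have L1: "cdf L x = measure L {..<x}" using cont by (simp add: L.isCont_cdf)
  have compl: "cdf L x = 1 - measure L {x<..}" "cdf (Q n) x = 1 - measure (Q n) {x<..}" for n
  proof -
    have "UNIV - {x<..} = {..x}" by auto
    then show "cdf L x = 1 - measure L {x<..}" "cdf (Q n) x = 1 - measure (Q n) {x<..}"
      using L.prob_compl[of "{x<..}"] Q.prob_compl[of "{x<..}" n] by (simp_all add: cdf_def)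
  qed
  show "(\<lambda>n. cdf (Q n) x) \<longlonglongrightarrow> cdf L x"
  proof (rule order_tendstoI)
    fix c assume "c < cdf L x"
    then have "\<forall>\<^sub>F n in sequentially. c < measure (Q n) {..<x}" using op[of "{..<x}" c] L1 by simp
    then show "\<forall>\<^sub>F n in sequentially. c < cdf (Q n) x"
    proof eventually_elim
      case (elim n)
      have "measure (Q n) {..<x} \<le> cdf (Q n) x"
        unfolding cdf_def by (rule Q.finite_measure_mono) auto
      with elim show ?case by linarith
    qed
  next
    fix c assume "cdf L x < c"
    then have "\<forall>\<^sub>F n in sequentially. 1 - c < measure (Q n) {x<..}"
      using op[of "{x<..}" "1 - c"] compl by simp
    then show "\<forall>\<^sub>F n in sequentially. cdf (Q n) x < c"
      by eventually_elim (use compl in simp)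
  qed
qed

lemma openin_vimage_point_measure:
  assumes "continuous_map point_measure_topology euclideanreal f" "open U"
  shows "openin point_measure_topology (f -` U \<inter> radon_point_measures)"
proof -
  have "f -` U \<inter> radon_point_measures = {m \<in> topspace point_measure_topology. f m \<in> U}"
    by (auto simp: topspace_point_measure_topology)
  then show ?thesis using assms by (simp add: openin_continuous_map_preimage)
qed

lemma continuous_point_measure_measurable:
  assumes "continuous_map point_measure_topology euclideanreal f"
  shows "f \<in> borel_measurable point_measure_algebra"
  by (rule borel_measurableI)
     (simp add: openin_vimage_point_measure[OF assms] open_in_point_measure_algebra)

text \<open>The portmanteau criterion for point measures, reduced to the line by pushing all laws
  forward under f: preimages of open sets of reals are open, so the lower bounds carry over.\<close>

lemma integral_tendsto_if_open:
  assumes Q: "\<And>n. prob_space (Q n)" "\<And>n. sets (Q n) = sets point_measure_algebra"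
    and L: "prob_space L" "sets L = sets point_measure_algebra"
    and op: "\<And>U c. openin point_measure_topology U \<Longrightarrow> c < measure L U \<Longrightarrow>
      \<forall>\<^sub>F n in sequentially. c < measure (Q n) U"
    and f: "continuous_map point_measure_topology euclideanreal f" "bounded (f ` radon_point_measures)"
  shows "(\<lambda>n. \<integral>m. f m \<partial>Q n) \<longlonglongrightarrow> (\<integral>m. f m \<partial>L)"
proof -
  have sp: "space (Q n) = radon_point_measures" "space L = radon_point_measures" for n
    using sets_eq_imp_space_eq[OF Q(2)] sets_eq_imp_space_eq[OF L(2)] by simp_all
  note pre = openin_vimage_point_measure[OF f(1)]
  have "f \<in> borel_measurable point_measure_algebra"
    by (rule continuous_point_measure_measurable[OF f(1)])
  then have fm: "f \<in> borel_measurable (Q n)" "f \<in> borel_measurable L" for n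
    using measurable_cong_sets[OF Q(2) refl] measurable_cong_sets[OF L(2) refl] by blast+
  have R: "real_distribution (distr (Q n) borel f)" "real_distribution (distr L borel f)" for n
    using Q L fm by (auto intro!: prob_space.real_distribution_distr)
  have meas: "measure (distr (Q n) borel f) U = measure (Q n) (f -` U \<inter> radon_point_measures)"
    "measure (distr L borel f) U = measure L (f -` U \<inter> radon_point_measures)" if "open U" for U n
    using that fm by (simp_all add: measure_distr sp)
  have conv: "weak_conv_m (\<lambda>n. distr (Q n) borel f) (distr L borel f)"
    by (rule weak_conv_m_if_open[OF R]) (simp add: meas op pre)
  obtain B where B: "\<And>m. m \<in> radon_point_measures \<Longrightarrow> \<bar>f m\<bar> \<le> B"
    using f(2) by (auto simp: bounded_iff)
  \<comment> \<open>On the range of f this clamp is the identity, which makes the identity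
    accessible as a bounded continuous test function on the line.\<close>
  define g where "g = (\<lambda>x. max (- \<bar>B\<bar>) (min \<bar>B\<bar> x))"
  have gm: "g \<in> borel_measurable borel" unfolding g_def by measurable
  have "isCont g x" for x unfolding g_def by (intro continuous_intros)
  moreover have "norm (g x) \<le> \<bar>B\<bar>" for x by (auto simp: g_def)
  ultimately have "(\<lambda>n. integral\<^sup>L (distr (Q n) borel f) g) \<longlonglongrightarrow> integral\<^sup>L (distr L borel f) g"
    by (rule weak_conv_imp_integral_bdd_continuous_conv[OF R conv])
  moreover have gf: "g (f m) = f m" if "m \<in> radon_point_measures" for m
    using B[OF that] by (auto simp: g_def)
  then have "integral\<^sup>L (distr (Q n) borel f) g = (\<integral>m. f m \<partial>Q n)"
    "integral\<^sup>L (distr L borel f) g = (\<integral>m. f m \<partial>L)" for n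
    using gm fm by (auto simp: integral_distr sp intro!: Bochner_Integration.integral_cong)
  ultimately show ?thesis by simp
qed

lemma borel_measurable_emeasure_point_measure:
  "sets Q = sets point_measure_algebra \<Longrightarrow> B \<in> sets half_line \<Longrightarrow>
    (\<lambda>m. emeasure m B) \<in> borel_measurable Q"
  using measurable_emeasure_point_measure[of B] measurable_cong_sets[of Q point_measure_algebra] by blast

lemma profile_set_measurable:
  "{m \<in> radon_point_measures. profile K m \<in> V} \<in> sets point_measure_algebra"
  using measurable_profile_set[of point_measure_algebra "\<lambda>m. m" K V] by simp

text \<open>U is approximated from inside twice under L: by an event about a single profile level K,
  then by finitely many values of that profile. On finitely many values the convergence of single
  probabilities adds up. A lower bound is enough for open sets, so mass at the discarded values does
  no harm.\<close>

lemma open_liminf_if_profiles: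
  assumes Q: "\<And>n. prob_space (Q n)" "\<And>n. sets (Q n) = sets point_measure_algebra"
    and L: "prob_space L" "sets L = sets point_measure_algebra"
    and conv: "\<And>K v. (\<lambda>n. measure (Q n) {m \<in> radon_point_measures. profile K m = v})
      \<longlonglongrightarrow> measure L {m \<in> radon_point_measures. profile K m = v}"
    and U: "openin point_measure_topology U" and c: "c < measure L U"
  shows "\<forall>\<^sub>F n in sequentially. c < measure (Q n) U"
proof -
  interpret L: prob_space L by fact
  interpret Q: prob_space "Q n" for n by fact
  define W where "W K V = {m \<in> radon_point_measures. profile K m \<in> V}" for K V
  have Wm: "W K V \<in> sets L" "W K V \<in> sets (Q n)" for K V n
    using profile_set_measurable unfolding W_def by (simp_all add: Q L)
  have "(\<lambda>K. measure L (W K (inner_profiles U K))) \<longlonglongrightarrow> measure L (\<Union>K. W K (inner_profiles U K))"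
    by (rule L.finite_Lim_measure_incseq)
       (use Wm inner_profiles_mono in \<open>auto simp: incseq_def W_def\<close>)
  then have "(\<lambda>K. measure L (W K (inner_profiles U K))) \<longlonglongrightarrow> measure L U"
    using open_point_measure_set[OF U] by (simp add: W_def)
  then have "\<forall>\<^sub>F K in sequentially. c < measure L (W K (inner_profiles U K))"
    using c by (rule order_tendstoD(1))
  then obtain K where K: "c < measure L (W K (inner_profiles U K))"
    by (auto simp: eventually_sequentially)
  define C where "C = inner_profiles U K \<inter> lists (range of_nat)"
  define F where "F i = {v \<in> C. to_nat_on C v < i}" for i
  have C: "countable C" unfolding C_def using countable_lists_of_nat by (rule countable_subset[rotated]) auto
  have F: "finite (F i)" for i
    by (rule inj_on_finite[of "to_nat_on C" _ "{..<i}"])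
       (use inj_on_to_nat_on[OF C] in \<open>auto simp: F_def inj_on_def\<close>)
  have "W K (inner_profiles U K) = (\<Union>i. W K (F i))"
    using profile_in_lists by (auto simp: W_def F_def C_def)
  moreover have "(\<lambda>i. measure L (W K (F i))) \<longlonglongrightarrow> measure L (\<Union>i. W K (F i))"
  proof (rule L.finite_Lim_measure_incseq)
    show "range (\<lambda>i. W K (F i)) \<subseteq> sets L" using Wm by blast
  qed (auto simp: incseq_def W_def F_def)
  ultimately have "\<forall>\<^sub>F i in sequentially. c < measure L (W K (F i))"
    using K by (intro order_tendstoD(1)) auto
  then obtain i where i: "c < measure L (W K (F i))"
    by (auto simp: eventually_sequentially)
  have split: "W K (F i) = (\<Union>v\<in>F i. W K {v})" by (auto simp: W_def)
  have disj: "disjoint_family_on (\<lambda>v. W K {v}) (F i)" by (auto simp: disjoint_family_on_def W_def)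
  have "measure L (W K (F i)) = (\<Sum>v\<in>F i. measure L (W K {v}))"
    "measure (Q n) (W K (F i)) = (\<Sum>v\<in>F i. measure (Q n) (W K {v}))" for n
    unfolding split using disj Wm F
    by (auto intro!: L.finite_measure_finite_Union Q.finite_measure_finite_Union)
  moreover have "(\<lambda>n. \<Sum>v\<in>F i. measure (Q n) (W K {v})) \<longlonglongrightarrow> (\<Sum>v\<in>F i. measure L (W K {v}))"
    by (intro tendsto_sum) (use conv in \<open>simp add: W_def\<close>)
  ultimately have "(\<lambda>n. measure (Q n) (W K (F i))) \<longlonglongrightarrow> measure L (W K (F i))" by simp
  then have "\<forall>\<^sub>F n in sequentially. c < measure (Q n) (W K (F i))"
    using i by (rule order_tendstoD(1))
  then show ?thesis
  proof eventually_elim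
    case (elim n)
    have "measure (Q n) (W K (F i)) \<le> measure (Q n) U"
      by (rule Q.finite_measure_mono)
         (use open_in_point_measure_algebra[OF U] Q in \<open>auto simp: W_def F_def C_def inner_profiles_def\<close>)
    with elim show ?case by linarith
  qed
qed

text \<open>The information contained in void probabilities: which cells are hit, but not how
  often.\<close>

definition occupied :: "nat \<Rightarrow> nat \<Rightarrow> real measure \<Rightarrow> nat set" where
  "occupied K J m = {j. j < J \<and> emeasure m (cell K j) \<noteq> 0}"

lemma occupied_subset_iff:
  assumes "m \<in> radon_point_measures"
  shows "occupied K J m \<subseteq> S \<longleftrightarrow> emeasure m (\<Union>j\<in>{..<J} - S. cell K j) = 0"
proof -
  have "emeasure m (\<Union>j\<in>{..<J} - S. cell K j) = (\<Sum>j\<in>{..<J} - S. emeasure m (cell K j))"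
    by (rule sum_emeasure[symmetric])
       (use assms disjoint_cells[of K] in \<open>auto simp: disjoint_family_on_def\<close>)
  then show ?thesis by (auto simp: occupied_def)
qed

lemma occupied_measurable:
  assumes "sets Q = sets point_measure_algebra"
  shows "{m \<in> radon_point_measures. P (occupied K J m)} \<in> sets Q"
proof -
  have sp: "space Q = radon_point_measures" using sets_eq_imp_space_eq[OF assms] by simp
  have [measurable]: "(\<lambda>m. emeasure m (cell K j)) \<in> borel_measurable Q" for j
    by (rule borel_measurable_emeasure_point_measure[OF assms]) simp
  have "{m \<in> radon_point_measures. P (occupied K J m)} =
      (\<Union>S\<in>{S. S \<subseteq> {..<J} \<and> P S}. {m \<in> space Q. \<forall>j<J. emeasure m (cell K j) \<noteq> 0 \<longleftrightarrow> j \<in> S})"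
  proof (intro set_eqI iffI)
    fix m assume "m \<in> {m \<in> radon_point_measures. P (occupied K J m)}"
    then show "m \<in> (\<Union>S\<in>{S. S \<subseteq> {..<J} \<and> P S}. {m \<in> space Q. \<forall>j<J. emeasure m (cell K j) \<noteq> 0 \<longleftrightarrow> j \<in> S})"
      by (intro UN_I[of "occupied K J m"]) (auto simp: occupied_def sp)
  next
    fix m assume "m \<in> (\<Union>S\<in>{S. S \<subseteq> {..<J} \<and> P S}. {m \<in> space Q. \<forall>j<J. emeasure m (cell K j) \<noteq> 0 \<longleftrightarrow> j \<in> S})"
    then obtain S where S: "S \<subseteq> {..<J}" "P S" "m \<in> radon_point_measures"
      "\<And>j. j < J \<Longrightarrow> emeasure m (cell K j) \<noteq> 0 \<longleftrightarrow> j \<in> S" by (auto simp: sp)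
    then have "occupied K J m = S" by (auto simp: occupied_def)
    then show "m \<in> {m \<in> radon_point_measures. P (occupied K J m)}" using S by simp
  qed
  moreover have "finite {S. S \<subseteq> {..<J} \<and> P S}" by (rule finite_subset[of _ "Pow {..<J}"]) auto
  ultimately show ?thesis by (auto intro!: sets.finite_UN)
qed

lemma occupied_sum:
  assumes "prob_space Q" "sets Q = sets point_measure_algebra" "finite \<S>"
  shows "measure Q {m \<in> radon_point_measures. occupied K J m \<in> \<S>}
    = (\<Sum>S\<in>\<S>. measure Q {m \<in> radon_point_measures. occupied K J m = S})"
proof -
  interpret prob_space Q by fact
  have "{m \<in> radon_point_measures. occupied K J m \<in> \<S>}
      = (\<Union>S\<in>\<S>. {m \<in> radon_point_measures. occupied K J m = S})" by auto
  then show ?thesis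
    using assms occupied_measurable[OF assms(2)]
    by (simp only:) (intro finite_measure_finite_Union, auto simp: disjoint_family_on_def)
qed

text \<open>The void probability of the cells outside S is the probability that the occupied set is
  contained in S, that is, a sum over all subsets of S. Induction over proper subsets solves for the
  term of S itself, a recursive Moebius inversion.\<close>

lemma occupied_tendsto:
  assumes Q: "\<And>n. prob_space (Q n)" "\<And>n. sets (Q n) = sets point_measure_algebra"
    and L: "prob_space L" "sets L = sets point_measure_algebra"
    and void: "\<And>K S. finite S \<Longrightarrow>
      (\<lambda>n. measure (Q n) {m \<in> radon_point_measures. emeasure m (\<Union>j\<in>S. cell K j) = 0})
        \<longlonglongrightarrow> measure L {m \<in> radon_point_measures. emeasure m (\<Union>j\<in>S. cell K j) = 0}"
    and "finite S"
  shows "(\<lambda>n. measure (Q n) {m \<in> radon_point_measures. occupied K J m = S})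
    \<longlonglongrightarrow> measure L {m \<in> radon_point_measures. occupied K J m = S}"
  using \<open>finite S\<close>
proof (induction S rule: finite_psubset_induct)
  case (psubset S)
  have fin: "finite {T. T \<subset> S}" "finite (Pow S)" using psubset by (auto intro: finite_subset[of _ "Pow S"])
  have eq: "measure P {m \<in> radon_point_measures. occupied K J m = S}
    = measure P {m \<in> radon_point_measures. emeasure m (\<Union>j\<in>{..<J} - S. cell K j) = 0}
      - (\<Sum>T | T \<subset> S. measure P {m \<in> radon_point_measures. occupied K J m = T})"
    if "prob_space P" "sets P = sets point_measure_algebra" for P
  proof -
    have "{m \<in> radon_point_measures. emeasure m (\<Union>j\<in>{..<J} - S. cell K j) = 0}
        = {m \<in> radon_point_measures. occupied K J m \<in> Pow S}"
      using occupied_subset_iff[of _ K J S] unfolding Pow_iff by blast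
    then have "measure P {m \<in> radon_point_measures. emeasure m (\<Union>j\<in>{..<J} - S. cell K j) = 0}
        = (\<Sum>T\<in>Pow S. measure P {m \<in> radon_point_measures. occupied K J m = T})"
      using occupied_sum[OF that fin(2)] by simp
    moreover have "Pow S = insert S {T. T \<subset> S}" by auto
    ultimately show ?thesis using fin by simp
  qed
  show ?case
    unfolding eq[OF Q] eq[OF L]
    by (intro tendsto_diff tendsto_sum void psubset.IH) auto
qed

text \<open>The counts at level K that would result if every occupied cell of level K + r held
  exactly one point.\<close>

definition coarse_profile :: "nat \<Rightarrow> nat \<Rightarrow> nat set \<Rightarrow> ennreal list" where
  "coarse_profile K r S = map (\<lambda>j. of_nat (card {i \<in> S. i div 2 ^ r = j})) [0..<K * 2 ^ K]"

lemma profile_eq_coarse_profile: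
  assumes m: "m \<in> radon_point_measures"
    and le: "\<And>i. i < K * 2 ^ (K + r) \<Longrightarrow> emeasure m (cell (K + r) i) < 2"
  shows "profile K m = coarse_profile K r (occupied (K + r) (K * 2 ^ (K + r)) m)"
  unfolding profile_def coarse_profile_def
proof (rule map_cong[OF refl])
  fix j assume "j \<in> set [0..<K * 2 ^ K]"
  then have j: "j < K * 2 ^ K" by simp
  let ?J = "{i. i < K * 2 ^ (K + r) \<and> i div 2 ^ r = j}"
  let ?O = "{i \<in> occupied (K + r) (K * 2 ^ (K + r)) m. i div 2 ^ r = j}"
  have 01: "emeasure m (cell (K + r) i) = (if i \<in> ?O then 1 else 0)" if i: "i \<in> ?J" for i
  proof -
    obtain N where N: "emeasure m (cell (K + r) i) = of_nat N"
      using emeasure_radon_point_measure[OF m cell_half_line cell_bounded] by blast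
    then have "N < 2" using le[of i] i by simp
    then have "N = 0 \<or> N = 1" by auto
    then show ?thesis using N i by (auto simp: occupied_def)
  qed
  have "emeasure m (cell K j) = (\<Sum>i\<in>?J. emeasure m (cell (K + r) i))"
    by (rule emeasure_cell_subcells[OF m j])
  also have "\<dots> = (\<Sum>i\<in>?J. if i \<in> ?O then 1 else 0)" by (intro sum.cong refl 01)
  also have "\<dots> = of_nat (card (?J \<inter> ?O))" by (subst sum.If_cases) auto
  also have "?J \<inter> ?O = ?O" by (auto simp: occupied_def)
  finally show "emeasure m (cell K j) = of_nat (card ?O)" .
qed

text \<open>Reading the profile off the occupied cells can fail only if some fine cell in the window
  holds two points; the error is a union bound over these cells.\<close>

lemma profile_coarse_profile_diff:
  assumes Q: "prob_space Q" "sets Q = sets point_measure_algebra"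
    and multi: "\<And>i. i < K * 2 ^ (K + r) \<Longrightarrow>
      measure Q {m \<in> radon_point_measures. 2 \<le> emeasure m (cell (K + r) i)} \<le> e"
  shows "\<bar>measure Q {m \<in> radon_point_measures. profile K m = v}
    - (\<Sum>S | S \<subseteq> {..<K * 2 ^ (K + r)} \<and> coarse_profile K r S = v.
        measure Q {m \<in> radon_point_measures. occupied (K + r) (K * 2 ^ (K + r)) m = S})\<bar>
    \<le> real (K * 2 ^ (K + r)) * e"
proof -
  interpret prob_space Q by fact
  have sp: "space Q = radon_point_measures" using sets_eq_imp_space_eq[OF Q(2)] by simp
  let ?J = "K * 2 ^ (K + r)"
  let ?A = "{m \<in> radon_point_measures. profile K m = v}"
  let ?B = "{m \<in> radon_point_measures. coarse_profile K r (occupied (K + r) ?J m) = v}"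
  let ?D = "\<Union>i<?J. {m \<in> radon_point_measures. 2 \<le> emeasure m (cell (K + r) i)}"
  have [measurable]: "(\<lambda>m. emeasure m (cell K j)) \<in> borel_measurable Q" for K j
    by (rule borel_measurable_emeasure_point_measure[OF Q(2)]) simp
  have Dm': "{m \<in> radon_point_measures. 2 \<le> emeasure m (cell (K + r) i)} \<in> sets Q" for i
    unfolding sp[symmetric] by measurable
  have ms: "?A \<in> sets Q" "?B \<in> sets Q" "?D \<in> sets Q"
    using profile_set_measurable[of K "{v}"] occupied_measurable[OF Q(2), of "\<lambda>S. coarse_profile K r S = v"] Dm'
    by (auto simp: Q(2))
  have sub: "?A \<subseteq> ?B \<union> ?D" "?B \<subseteq> ?A \<union> ?D"
    using profile_eq_coarse_profile[of _ K r] by (force simp: not_less)+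
  have "prob ?D \<le> (\<Sum>i<?J. prob {m \<in> radon_point_measures. 2 \<le> emeasure m (cell (K + r) i)})"
    by (rule finite_measure_subadditive_finite) (use Dm' in auto)
  also have "\<dots> \<le> (\<Sum>i<?J. e)" by (intro sum_mono multi) simp
  finally have D: "prob ?D \<le> real ?J * e" by simp
  have "prob ?A \<le> prob (?B \<union> ?D)" "prob ?B \<le> prob (?A \<union> ?D)"
    using ms sub by (auto intro!: finite_measure_mono)
  moreover have "prob (?B \<union> ?D) \<le> prob ?B + prob ?D" "prob (?A \<union> ?D) \<le> prob ?A + prob ?D"
    using ms by (auto intro!: measure_Un_le)
  ultimately have "\<bar>prob ?A - prob ?B\<bar> \<le> real ?J * e" using D by linarith
  moreover have "prob ?B = (\<Sum>S | S \<subseteq> {..<?J} \<and> coarse_profile K r S = v.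
      prob {m \<in> radon_point_measures. occupied (K + r) ?J m = S})"
  proof -
    let ?\<S> = "{S. S \<subseteq> {..<?J} \<and> coarse_profile K r S = v}"
    have "?B = {m \<in> radon_point_measures. occupied (K + r) ?J m \<in> ?\<S>}"
      by (auto simp: occupied_def)
    moreover have "finite ?\<S>" by (rule finite_subset[of _ "Pow {..<?J}"]) auto
    ultimately show ?thesis by (simp only: occupied_sum[OF Q])
  qed
  ultimately show ?thesis by (simp only:)
qed

text \<open>With K fixed there are K * 2^(K+r) fine cells, each doubly occupied with probability at
  most 4^-(K+r), so the total error vanishes as r grows. First r is chosen, and then n tends to
  infinity for the finitely many occupation patterns of that level.\<close>

lemma profile_tendsto:
  assumes Q: "\<And>n. prob_space (Q n)" "\<And>n. sets (Q n) = sets point_measure_algebra"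
    and L: "prob_space L" "sets L = sets point_measure_algebra"
    and void: "\<And>K S. finite S \<Longrightarrow>
      (\<lambda>n. measure (Q n) {m \<in> radon_point_measures. emeasure m (\<Union>j\<in>S. cell K j) = 0})
        \<longlonglongrightarrow> measure L {m \<in> radon_point_measures. emeasure m (\<Union>j\<in>S. cell K j) = 0}"
    and multiQ: "\<And>K j. \<forall>\<^sub>F n in sequentially.
      measure (Q n) {m \<in> radon_point_measures. 2 \<le> emeasure m (cell K j)} \<le> 1 / 4 ^ K"
    and multiL: "\<And>K j. measure L {m \<in> radon_point_measures. 2 \<le> emeasure m (cell K j)} \<le> 1 / 4 ^ K"
  shows "(\<lambda>n. measure (Q n) {m \<in> radon_point_measures. profile K m = v})
    \<longlonglongrightarrow> measure L {m \<in> radon_point_measures. profile K m = v}"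
proof (rule LIMSEQ_I)
  fix \<epsilon> :: real assume "0 < \<epsilon>"
  have "(\<lambda>r. real (K * 2 ^ (K + r)) * (1 / 4 ^ (K + r))) \<longlonglongrightarrow> 0" by real_asymp
  then have "\<forall>\<^sub>F r in sequentially. real (K * 2 ^ (K + r)) * (1 / 4 ^ (K + r)) < \<epsilon> / 3"
    by (rule order_tendstoD(2)) (use \<open>0 < \<epsilon>\<close> in simp)
  then obtain r where r: "real (K * 2 ^ (K + r)) * (1 / 4 ^ (K + r)) < \<epsilon> / 3"
    by (auto simp: eventually_sequentially)
  let ?J = "K * 2 ^ (K + r)"
  define G where "G P = (\<Sum>S | S \<subseteq> {..<?J} \<and> coarse_profile K r S = v.
        measure P {m \<in> radon_point_measures. occupied (K + r) ?J m = S})" for P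
  have "(\<lambda>n. G (Q n)) \<longlonglongrightarrow> G L"
    unfolding G_def by (intro tendsto_sum occupied_tendsto[OF Q L void]) (auto intro: finite_subset)
  moreover have "0 < \<epsilon> / 3" using \<open>0 < \<epsilon>\<close> by simp
  ultimately have "\<forall>\<^sub>F n in sequentially. \<bar>G (Q n) - G L\<bar> < \<epsilon> / 3"
    unfolding tendsto_iff dist_real_def by blast
  moreover have "\<forall>\<^sub>F n in sequentially. \<forall>i\<in>{..<?J}.
      measure (Q n) {m \<in> radon_point_measures. 2 \<le> emeasure m (cell (K + r) i)} \<le> 1 / 4 ^ (K + r)"
    by (rule eventually_ball_finite) (use multiQ in auto)
  ultimately have "\<forall>\<^sub>F n in sequentially. norm (measure (Q n) {m \<in> radon_point_measures. profile K m = v}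
      - measure L {m \<in> radon_point_measures. profile K m = v}) < \<epsilon>"
  proof eventually_elim
    case (elim n)
    have "\<bar>measure (Q n) {m \<in> radon_point_measures. profile K m = v} - G (Q n)\<bar> \<le> real ?J * (1 / 4 ^ (K + r))"
      unfolding G_def by (rule profile_coarse_profile_diff[OF Q]) (use elim(2) in auto)
    moreover have "\<bar>measure L {m \<in> radon_point_measures. profile K m = v} - G L\<bar> \<le> real ?J * (1 / 4 ^ (K + r))"
      unfolding G_def by (rule profile_coarse_profile_diff[OF L multiL])
    ultimately show ?case using elim(1) r unfolding real_norm_def by linarith
  qed
  then show "\<exists>no. \<forall>n\<ge>no. norm (measure (Q n) {m \<in> radon_point_measures. profile K m = v}
      - measure L {m \<in> radon_point_measures. profile K m = v}) < \<epsilon>"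
    by (simp add: eventually_sequentially)
qed

text \<open>A special case of Kallenberg's theorem: avoidance probabilities and intensities determine the
  limit, because a cell of small length carries at most one point up to a quadratic error.\<close>

lemma converges_to_poisson:
  assumes L: "uniform_poisson_law L"
    and Q: "\<And>n. prob_space (Q n)" "\<And>n. sets (Q n) = sets point_measure_algebra"
    and void: "\<And>K S. finite S \<Longrightarrow>
      (\<lambda>n. measure (Q n) {m \<in> radon_point_measures. emeasure m (\<Union>j\<in>S. cell K j) = 0})
        \<longlonglongrightarrow> exp (- (real (card S) / 2 ^ K))"
    and intensity: "\<And>K j. (\<lambda>n. \<integral>\<^sup>+m. emeasure m (cell K j) \<partial>Q n) \<longlonglongrightarrow> ennreal (1 / 2 ^ K)"
    and f: "continuous_map point_measure_topology euclideanreal f" "bounded (f ` radon_point_measures)"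
  shows "(\<lambda>n. \<integral>m. f m \<partial>Q n) \<longlonglongrightarrow> (\<integral>m. f m \<partial>L)"
proof -
  have L': "prob_space L" "sets L = sets point_measure_algebra" using L by (auto simp: uniform_poisson_law_def)
  interpret L: prob_space L by fact
  interpret Q: prob_space "Q n" for n by fact
  have sp: "space (Q n) = radon_point_measures" "space L = radon_point_measures" for n
    using sets_eq_imp_space_eq[OF Q(2)] sets_eq_imp_space_eq[OF L'(2)] by simp_all
  have poisson: "measure L {m \<in> radon_point_measures. emeasure m B = of_nat j} =
      exp (- measure lborel B) * measure lborel B ^ j / fact j"
    if "B \<in> sets half_line" "emeasure lborel B < \<infinity>" for B j
    using L that unfolding uniform_poisson_law_def sp[symmetric] by blast
  have UN: "(\<Union>j\<in>S. cell K j) \<in> sets half_line" if "finite S" for S K using that by auto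
  have leb: "emeasure lborel (\<Union>j\<in>S. cell K j) = ennreal (real (card S) / 2 ^ K)" if "finite S" for S K
  proof -
    have "emeasure lborel (\<Union>j\<in>S. cell K j) = (\<Sum>j\<in>S. emeasure lborel (cell K j))"
      by (rule sum_emeasure[symmetric])
         (use that disjoint_cells[of K] in \<open>auto simp: disjoint_family_on_def cell_def\<close>)
    also have "\<dots> = ennreal (\<Sum>j\<in>S. 1 / 2 ^ K)" unfolding emeasure_lborel_cell by (rule sum_ennreal) simp
    finally show ?thesis by simp
  qed
  have voidL: "measure L {m \<in> radon_point_measures. emeasure m (\<Union>j\<in>S. cell K j) = 0}
      = exp (- (real (card S) / 2 ^ K))" if "finite S" for S K
    using poisson[OF UN[OF that], of K 0] leb[OF that] by (simp add: measure_def)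
  note em[measurable] = borel_measurable_emeasure_point_measure[OF Q(2) cell_half_line]
    borel_measurable_emeasure_point_measure[OF L'(2) cell_half_line]
  have nat01: "emeasure m (cell K j) = 0 \<or> emeasure m (cell K j) = 1 \<or> 2 \<le> emeasure m (cell K j)"
    if m: "m \<in> radon_point_measures" for m K j
  proof -
    obtain N where N: "emeasure m (cell K j) = of_nat N"
      using emeasure_radon_point_measure[OF m cell_half_line cell_bounded] by blast
    have "N = 0 \<or> N = 1 \<or> 2 \<le> N" by linarith
    moreover have "2 \<le> N \<Longrightarrow> (2::ennreal) \<le> of_nat N" by (metis of_nat_le_iff of_nat_numeral)
    ultimately show ?thesis unfolding N by auto
  qed
  have sq: "(1 / 2 ^ K)\<^sup>2 = (1 / 4 ^ K :: real)" for K
    by (simp add: power_divide power_mult[symmetric] mult.commute[of K]) (simp add: power_mult)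
  have multiL: "measure L {m \<in> radon_point_measures. 2 \<le> emeasure m (cell K j)} \<le> 1 / 4 ^ K" for K j
  proof -
    let ?x = "1 / 2 ^ K :: real"
    have "L.prob {m \<in> space L. emeasure m (cell K j) = 0} = exp (- ?x)"
      "L.prob {m \<in> space L. emeasure m (cell K j) = 1} = exp (- ?x) * ?x"
      using poisson[OF cell_half_line, of K j 0] poisson[OF cell_half_line, of K j 1]
      by (simp_all add: emeasure_lborel_cell measure_lborel_cell sp)
    moreover have "L.prob {m \<in> space L. 2 \<le> emeasure m (cell K j)}
      + (L.prob {m \<in> space L. emeasure m (cell K j) = 0} + L.prob {m \<in> space L. emeasure m (cell K j) = 1}) = 1"
    proof -
      have "L.prob {m \<in> space L. emeasure m (cell K j) = 0} + L.prob {m \<in> space L. emeasure m (cell K j) = 1}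
        = L.prob ({m \<in> space L. emeasure m (cell K j) = 0} \<union> {m \<in> space L. emeasure m (cell K j) = 1})"
        by (rule L.finite_measure_Union[symmetric]) auto
      moreover have "L.prob {m \<in> space L. 2 \<le> emeasure m (cell K j)} +
          L.prob ({m \<in> space L. emeasure m (cell K j) = 0} \<union> {m \<in> space L. emeasure m (cell K j) = 1})
        = L.prob ({m \<in> space L. 2 \<le> emeasure m (cell K j)} \<union>
          ({m \<in> space L. emeasure m (cell K j) = 0} \<union> {m \<in> space L. emeasure m (cell K j) = 1}))"
        by (rule L.finite_measure_Union[symmetric]) auto
      moreover have "{m \<in> space L. 2 \<le> emeasure m (cell K j)} \<union>
          ({m \<in> space L. emeasure m (cell K j) = 0} \<union> {m \<in> space L. emeasure m (cell K j) = 1}) = space L"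
        using nat01 by (auto simp: sp)
      ultimately show ?thesis by (simp add: L.prob_space)
    qed
    \<comment> \<open>For a Poisson count of mean x the chance of two or more points is 1 - exp(-x)
      (1 + x), and exp(-x) \<ge> 1 - x bounds it by x^2.\<close>
    moreover have "(1 - ?x) * (1 + ?x) \<le> exp (- ?x) * (1 + ?x)"
      using exp_ge_add_one_self[of "- ?x"] by (intro mult_right_mono) auto
    then have "1 - ?x\<^sup>2 \<le> exp (- ?x) + exp (- ?x) * ?x" by (simp add: power2_eq_square algebra_simps)
    ultimately show ?thesis unfolding sp sq by linarith
  qed
  \<comment> \<open>A count N of whole points is at least the indicator of N \<noteq> 0 plus that of
    N \<ge> 2, so P(N \<ge> 2) \<le> E(N) - P(N \<noteq> 0). The limit of the right side is x - 1 +
    exp(-x), strictly below x^2, and the bound therefore holds for all large n.\<close>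
  have multiQ: "\<forall>\<^sub>F n in sequentially.
      measure (Q n) {m \<in> radon_point_measures. 2 \<le> emeasure m (cell K j)} \<le> 1 / 4 ^ K" for K j
  proof -
    let ?x = "1 / 2 ^ K :: real"
    define c where "c n = \<integral>\<^sup>+m. emeasure m (cell K j) \<partial>Q n" for n
    define z where "z n = measure (Q n) {m \<in> radon_point_measures. emeasure m (cell K j) = 0}" for n
    have c: "c \<longlonglongrightarrow> ennreal ?x" using intensity[of K j] by (simp add: c_def[abs_def])
    then have "(\<lambda>n. enn2real (c n)) \<longlonglongrightarrow> ?x" by (rule tendsto_enn2real) simp
    moreover have "z \<longlonglongrightarrow> exp (- ?x)" using void[of "{j}" K] by (simp add: z_def[abs_def])
    ultimately have "(\<lambda>n. enn2real (c n) - (1 - z n)) \<longlonglongrightarrow> ?x - (1 - exp (- ?x))"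
      by (intro tendsto_diff tendsto_const)
    moreover have "?x - (1 - exp (- ?x)) < 1 / 4 ^ K"
      using exp_minus_less_quadratic[of ?x] unfolding sq by simp
    ultimately have "\<forall>\<^sub>F n in sequentially. enn2real (c n) - (1 - z n) < 1 / 4 ^ K"
      by (rule order_tendstoD(2))
    \<comment> \<open>\<open>enn2real\<close> sends \<infinity> to 0, so finiteness of the mean has
      to be secured before it is compared as a real number.\<close>
    moreover have "\<forall>\<^sub>F n in sequentially. c n < top" by (rule order_tendstoD(2)[OF c]) simp
    ultimately show ?thesis
    proof eventually_elim
      case (elim n)
      let ?two = "{m \<in> space (Q n). 2 \<le> emeasure m (cell K j)}"
      let ?pos = "{m \<in> space (Q n). emeasure m (cell K j) \<noteq> 0}"
      have "Q.prob n ?pos = 1 - z n"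
      proof -
        have "?pos = space (Q n) - {m \<in> space (Q n). emeasure m (cell K j) = 0}" by auto
        moreover have "Q.prob n (space (Q n) - {m \<in> space (Q n). emeasure m (cell K j) = 0})
            = 1 - Q.prob n {m \<in> space (Q n). emeasure m (cell K j) = 0}"
          by (rule Q.prob_compl) measurable
        ultimately show ?thesis by (simp only: z_def sp)
      qed
      moreover have "ennreal (Q.prob n ?two + Q.prob n ?pos) \<le> c n"
      proof -
        have "ennreal (Q.prob n ?two + Q.prob n ?pos) = (\<integral>\<^sup>+m. indicator ?two m \<partial>Q n) + (\<integral>\<^sup>+m. indicator ?pos m \<partial>Q n)"
          by (simp add: Q.emeasure_eq_measure)
        also have "\<dots> = (\<integral>\<^sup>+m. indicator ?two m + indicator ?pos m \<partial>Q n)"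
          by (rule nn_integral_add[symmetric]) auto
        also have "\<dots> \<le> c n"
          unfolding c_def
        proof (rule nn_integral_mono)
          fix m assume "m \<in> space (Q n)"
          then have "m \<in> radon_point_measures" by (simp add: sp)
          from nat01[OF this, of K j] show "indicator ?two m + indicator ?pos m \<le> emeasure m (cell K j)"
            by (elim disjE) (auto simp: indicator_def one_add_one)
        qed
        finally show ?thesis .
      qed
      from enn2real_mono[OF this elim(2)] have "Q.prob n ?two + Q.prob n ?pos \<le> enn2real (c n)"
        by (simp only: enn2real_ennreal add_nonneg_nonneg measure_nonneg)
      ultimately show ?case using elim(1) by (simp add: sp)
    qed
  qed
  have void': "(\<lambda>n. measure (Q n) {m \<in> radon_point_measures. emeasure m (\<Union>j\<in>S. cell K j) = 0})
        \<longlonglongrightarrow> measure L {m \<in> radon_point_measures. emeasure m (\<Union>j\<in>S. cell K j) = 0}"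
    if "finite S" for K S using void[OF that] voidL[OF that] by simp
  show ?thesis
    by (rule integral_tendsto_if_open[OF Q L' _ f])
       (rule open_liminf_if_profiles[OF Q L' profile_tendsto[OF Q L' void' multiQ multiL]])
qed

section \<open>Existence of the uniform Poisson process\<close>

text \<open>Once all lower coefficients of the difference vanish, dividing by t^n and letting t tend
  to 0 isolates the n-th one.\<close>

lemma powser_coeff_unique:
  fixes c d :: "nat \<Rightarrow> real"
  assumes "\<And>t. \<bar>t\<bar> < 1 \<Longrightarrow> (\<lambda>n. c n * t ^ n) sums f t" "\<And>t. \<bar>t\<bar> < 1 \<Longrightarrow> (\<lambda>n. d n * t ^ n) sums f t"
  shows "c n = d n"
proof (induction n rule: less_induct)
  case (less n)
  define e where "e i = c i - d i" for i
  have e0: "(\<lambda>i. e i * t ^ i) sums 0" if "\<bar>t\<bar> < 1" for t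
    using sums_diff[OF assms(1)[OF that] assms(2)[OF that]] by (simp add: e_def algebra_simps)
  have "(\<lambda>i. e (i + n) * t ^ i) sums 0" if t: "t \<noteq> 0" "norm t < 1" for t
  proof -
    have "(\<Sum>i<n. e i * t ^ i) = 0" using less by (intro sum.neutral) (simp add: e_def)
    then have "(\<lambda>i. e (i + n) * t ^ (i + n)) sums 0"
      using sums_split_initial_segment[OF e0[of t], of n] t by simp
    then have "(\<lambda>i. inverse (t ^ n) * (e (i + n) * t ^ (i + n))) sums (inverse (t ^ n) * 0)"
      by (rule sums_mult)
    then show ?thesis using t by (simp add: power_add field_simps)
  qed
  then have "((\<lambda>_. 0) \<longlongrightarrow> e (0 + n)) (at (0::real))"
    by (intro powser_limit_0_strong[of 1]) auto
  then have "e n = 0" using LIM_unique[OF _ tendsto_const] by force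
  then show ?case by (simp add: e_def)
qed

text \<open>Inversion of a joint generating function one variable at a time. In the intermediate
  expectation the coordinates in I are already fixed by indicators and the others still carry
  powers. As a function of one remaining variable it is a power series whose coefficients are the
  expectations wanted next, so uniqueness in a single variable suffices.\<close>

lemma (in prob_space) prob_eq_if_generating_functions_eq:
  fixes X :: "'j \<Rightarrow> 'a \<Rightarrow> nat" and q :: "'j \<Rightarrow> nat \<Rightarrow> real"
  assumes X: "\<And>j. j \<in> J \<Longrightarrow> X j \<in> M \<rightarrow>\<^sub>M count_space UNIV" and J: "finite J"
    and q: "\<And>j t. j \<in> J \<Longrightarrow> \<bar>t\<bar> \<le> 1 \<Longrightarrow> (\<lambda>n. q j n * t ^ n) sums G j t"
    and gen: "\<And>z. (\<And>j. j \<in> J \<Longrightarrow> \<bar>z j\<bar> \<le> 1) \<Longrightarrow>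
      expectation (\<lambda>x. \<Prod>j\<in>J. z j ^ X j x) = (\<Prod>j\<in>J. G j (z j))"
  shows "prob {x \<in> space M. \<forall>j\<in>J. X j x = k j} = (\<Prod>j\<in>J. q j (k j))"
proof -
  note X[measurable]
  have "expectation (\<lambda>x. (\<Prod>j\<in>I. of_bool (X j x = k j)) * (\<Prod>j\<in>J - I. z j ^ X j x))
      = (\<Prod>j\<in>I. q j (k j)) * (\<Prod>j\<in>J - I. G j (z j))"
    if "finite I" "I \<subseteq> J" "\<And>j. j \<in> J \<Longrightarrow> \<bar>z j\<bar> \<le> 1" for I z
    using that
  proof (induction I arbitrary: z rule: finite_induct)
    case empty
    then show ?case using gen[of z] by simp
  next
    case (insert i I)
    have i: "i \<in> J" "i \<notin> I" "I \<subseteq> J" using insert by auto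
    let ?R = "J - insert i I"
    have split: "(\<Prod>j\<in>J - I. f j) = f i * (\<Prod>j\<in>?R. f j)" for f :: "'j \<Rightarrow> real"
    proof -
      have "J - I = insert i ?R" "finite ?R" "i \<notin> ?R" using i J by auto
      then show ?thesis using prod.insert[of ?R i f] by metis
    qed
    define W where "W x = (\<Prod>j\<in>I. of_bool (X j x = k j)) * (\<Prod>j\<in>?R. z j ^ X j x)" for x
    have Wm[measurable]: "W \<in> borel_measurable M"
      unfolding W_def
      by (intro borel_measurable_times borel_measurable_prod) (use i X in \<open>auto intro!: measurable_compose[OF X]\<close>)
    have W1: "\<bar>W x\<bar> \<le> 1" for x
    proof -
      have "\<bar>\<Prod>j\<in>I. of_bool (X j x = k j) :: real\<bar> \<le> 1"
        unfolding abs_prod by (intro prod_le_1) auto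
      moreover have "\<bar>\<Prod>j\<in>?R. z j ^ X j x\<bar> \<le> 1"
        unfolding abs_prod power_abs using insert.prems by (intro prod_le_1) (auto intro!: power_le_one)
      ultimately show ?thesis unfolding W_def abs_mult by (intro mult_le_one) auto
    qed
    have Xi[measurable]: "X i \<in> M \<rightarrow>\<^sub>M count_space UNIV" using X i by simp
    have Wi: "integrable M (\<lambda>x. W x * of_bool (X i x = n))" for n
      by (rule integrable_const_bound[where B=1]) (use W1 in auto)
    define C where "C = (\<Prod>j\<in>I. q j (k j)) * (\<Prod>j\<in>?R. G j (z j))"
    define w where "w n = expectation (\<lambda>x. W x * of_bool (X i x = n))" for n
    have "w n = C * q i n" for n
    proof (rule powser_coeff_unique)
      fix t :: real assume t: "\<bar>t\<bar> < 1"
      have "\<bar>(z(i := t)) j\<bar> \<le> 1" if "j \<in> J" for j using t insert.prems(2)[OF that] by simp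
      then have "expectation (\<lambda>x. (\<Prod>j\<in>I. of_bool (X j x = k j)) * (\<Prod>j\<in>J - I. (z(i := t)) j ^ X j x))
          = (\<Prod>j\<in>I. q j (k j)) * (\<Prod>j\<in>J - I. G j ((z(i := t)) j))"
        using insert.IH[of "z(i := t)"] i by simp
      moreover have "(\<Prod>j\<in>?R. (z(i := t)) j ^ X j x) = (\<Prod>j\<in>?R. z j ^ X j x)"
        "(\<Prod>j\<in>?R. G j ((z(i := t)) j)) = (\<Prod>j\<in>?R. G j (z j))" for x
        by (auto intro!: prod.cong)
      ultimately have E: "expectation (\<lambda>x. W x * t ^ X i x) = C * G i t"
        unfolding split by (simp add: W_def C_def mult.assoc mult.left_commute mult.commute[of "t ^ _"])
      show "(\<lambda>n. C * q i n * t ^ n) sums (C * G i t)"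
        using sums_mult[OF q[OF i(1), of t], of C] t by (simp add: mult.assoc)
      have 1: "(\<lambda>n. W x * of_bool (X i x = n) * t ^ n) sums (W x * t ^ X i x)" for x
        using sums_single[of "X i x" "\<lambda>n. W x * t ^ n"] by (simp add: of_bool_def if_distrib if_distribR eq_commute cong: if_cong)
      have 2: "integrable M (\<lambda>x. W x * of_bool (X i x = n) * t ^ n)" for n
        using Wi by (intro integrable_mult_left) auto
      have s: "summable (\<lambda>n. norm (W x * of_bool (X i x = n) * t ^ n))" for x
        by (rule summable_finite[of "{X i x}"]) auto
      have si: "summable (\<lambda>n. expectation (\<lambda>x. norm (W x * of_bool (X i x = n) * t ^ n)))"
      proof (rule summable_comparison_test'[of "\<lambda>n. \<bar>t\<bar> ^ n"])
        show "summable (\<lambda>n. \<bar>t\<bar> ^ n)" using t by (intro summable_geometric) simp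
        fix n
        have "expectation (\<lambda>x. norm (W x * of_bool (X i x = n) * t ^ n)) \<le> expectation (\<lambda>x. \<bar>t\<bar> ^ n)"
        proof (rule integral_mono)
          fix x
          have "\<bar>W x\<bar> * of_bool (X i x = n) * \<bar>t\<bar> ^ n \<le> 1 * \<bar>t\<bar> ^ n"
            using W1[of x] by (intro mult_right_mono mult_le_one) auto
          then show "norm (W x * of_bool (X i x = n) * t ^ n) \<le> \<bar>t\<bar> ^ n"
            by (simp add: abs_mult power_abs)
        qed (use 2 in auto)
        then show "norm (expectation (\<lambda>x. norm (W x * of_bool (X i x = n) * t ^ n))) \<le> \<bar>t\<bar> ^ n"
          by (simp add: prob_space)
      qed
      have "(\<lambda>n. expectation (\<lambda>x. W x * of_bool (X i x = n) * t ^ n)) sums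
          expectation (\<lambda>x. \<Sum>n. W x * of_bool (X i x = n) * t ^ n)"
        using summable_integral[OF 2 _ si] integral_suminf[OF 2 _ si] s
        by (simp add: sums_iff)
      then show "(\<lambda>n. w n * t ^ n) sums (C * G i t)"
        using E sums_unique[OF 1] by (simp add: w_def)
    qed
    from this[of "k i"] have "w (k i) = C * q i (k i)" .
    then show ?case
      using insert.hyps by (simp add: w_def C_def W_def algebra_simps)
  qed
  from this[of J "\<lambda>_. 0"] J
  have *: "expectation (\<lambda>x. \<Prod>j\<in>J. of_bool (X j x = k j)) = (\<Prod>j\<in>J. q j (k j))" by simp
  have "(\<Prod>j\<in>J. of_bool (X j x = k j) :: real) = indicator {x \<in> space M. \<forall>j\<in>J. X j x = k j} x"
    if "x \<in> space M" for x
    using that J by (auto simp: indicator_def of_bool_def intro!: prod.neutral)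
  then have "expectation (\<lambda>x. \<Prod>j\<in>J. of_bool (X j x = k j)) = expectation (indicat_real {x \<in> space M. \<forall>j\<in>J. X j x = k j})"
    by (intro Bochner_Integration.integral_cong) auto
  also have "\<dots> = prob ({x \<in> space M. \<forall>j\<in>J. X j x = k j} \<inter> space M)" by simp
  also have "{x \<in> space M. \<forall>j\<in>J. X j x = k j} \<inter> space M = {x \<in> space M. \<forall>j\<in>J. X j x = k j}" by auto
  finally show ?thesis using * by simp
qed

lemma poisson_sums: "(\<lambda>n. exp (- l) * l ^ n / fact n * t ^ n) sums exp (l * (t - 1))" for l t :: real
proof -
  have "(\<lambda>n. exp (- l) * (inverse (fact n) *\<^sub>R (l * t) ^ n)) sums (exp (- l) * exp (l * t))"
    by (intro sums_mult exp_converges)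
  then show ?thesis by (simp add: exp_add[symmetric] power_mult_distrib field_simps)
qed

lemma integral_poisson_power:
  assumes "\<bar>t\<bar> \<le> (1::real)"
  shows "(\<integral>n. t ^ n \<partial>measure_pmf (poisson_pmf 1)) = exp (t - 1)"
proof -
  have "integrable (measure_pmf (poisson_pmf 1)) (\<lambda>n. t ^ n)"
    by (rule measure_pmf.integrable_const_bound[where B=1])
       (use assms in \<open>auto simp: power_abs intro!: power_le_one\<close>)
  then have int: "integrable (count_space UNIV) (\<lambda>n. pmf (poisson_pmf 1) n * t ^ n)"
    by (subst (asm) measure_pmf_eq_density) (simp add: integrable_density)
  have "(\<integral>n. t ^ n \<partial>measure_pmf (poisson_pmf 1)) = (\<integral>n. pmf (poisson_pmf 1) n * t ^ n \<partial>count_space UNIV)"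
    by (subst measure_pmf_eq_density) (simp add: integral_density)
  also have "\<dots> = (\<Sum>n. pmf (poisson_pmf 1) n * t ^ n)" by (rule integral_count_space_nat[OF int])
  also have "\<dots> = exp (t - 1)"
    using sums_unique[OF poisson_sums[of 1 t]] by (simp add: field_simps)
  finally show ?thesis .
qed

text \<open>The integrand sees the coordinates in J only; projecting to them reduces the claim to a
  finite product.\<close>

lemma (in product_prob_space) integral_PiM_prod:
  fixes f :: "'i \<Rightarrow> 'a \<Rightarrow> real"
  assumes "finite J" "J \<subseteq> I" "\<And>i. i \<in> J \<Longrightarrow> integrable (M i) (f i)"
  shows "(\<integral>x. (\<Prod>i\<in>J. f i (x i)) \<partial>PiM I M) = (\<Prod>i\<in>J. integral\<^sup>L (M i) (f i))"
proof -
  have fm: "f i \<in> borel_measurable (M i)" if "i \<in> J" for i using assms(3)[OF that] by auto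
  have "(\<Prod>i\<in>J. integral\<^sup>L (M i) (f i)) = (\<integral>x. (\<Prod>i\<in>J. f i (x i)) \<partial>PiM J M)"
    by (rule product_integral_prod[symmetric]) (use assms in auto)
  also have "PiM J M = distr (PiM I M) (PiM J M) (\<lambda>x. restrict x J)"
    by (rule distr_PiM_restrict_finite[symmetric]) (use assms in auto)
  also have "(\<integral>x. (\<Prod>i\<in>J. f i (x i)) \<partial>distr (PiM I M) (PiM J M) (\<lambda>x. restrict x J))
      = (\<integral>x. (\<Prod>i\<in>J. f i (restrict x J i)) \<partial>PiM I M)"
  proof (rule integral_distr)
    show "(\<lambda>x. restrict x J) \<in> Pi\<^sub>M I M \<rightarrow>\<^sub>M Pi\<^sub>M J M"
      by (rule measurable_restrict_subset) fact
    show "(\<lambda>x. \<Prod>i\<in>J. f i (x i)) \<in> borel_measurable (Pi\<^sub>M J M)"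
      by (intro borel_measurable_prod, rule measurable_compose[OF measurable_component_singleton]) (use fm in auto)
  qed
  also have "\<dots> = (\<integral>x. (\<Prod>i\<in>J. f i (x i)) \<partial>PiM I M)"
    by (intro Bochner_Integration.integral_cong prod.cong) auto
  finally show ?thesis ..
qed

text \<open>A Poisson number of uniform points in each unit interval, independently. The index of the
  \<open>l\<close>-th point of the \<open>i\<close>-th interval is \<open>prod_encode (i, l)\<close>.\<close>

abbreviation interval_of :: "nat \<Rightarrow> nat" where "interval_of k \<equiv> fst (prod_decode k)"
abbreviation position_of :: "nat \<Rightarrow> nat" where "position_of k \<equiv> snd (prod_decode k)"

definition unit_uniform :: "nat \<Rightarrow> real measure" where
  "unit_uniform i = restrict_space lborel {real i..<real (Suc i)}"

text \<open>Every index carries a position, used or not, and the number of used positions in each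
  interval is drawn separately. All coordinates are thereby independent, and the space is a plain
  product.\<close>

definition poisson_space :: "((nat \<Rightarrow> nat) \<times> (nat \<Rightarrow> real)) measure" where
  "poisson_space = PiM UNIV (\<lambda>_. measure_pmf (poisson_pmf 1)) \<Otimes>\<^sub>M PiM UNIV (\<lambda>k. unit_uniform (interval_of k))"

definition poisson_points :: "(nat \<Rightarrow> nat) \<times> (nat \<Rightarrow> real) \<Rightarrow> real measure" where
  "poisson_points = (\<lambda>(n, u). dirac_sum {k. position_of k < n (interval_of k)} u)"

text \<open>Restricting to the first T intervals leaves finitely many used indices for every
  outcome, so the count is a natural number even if B is unbounded.\<close>

definition point_count :: "nat \<Rightarrow> real set \<Rightarrow> (nat \<Rightarrow> nat) \<times> (nat \<Rightarrow> real) \<Rightarrow> nat" where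
  "point_count T B = (\<lambda>(n, u). card {k. interval_of k < T \<and> position_of k < n (interval_of k) \<and> u k \<in> B})"

section \<open>Basic properties of the Poisson construction\<close>

lemma prod_decode_mem_Sigma: "prod_decode k \<in> Sigma S L \<longleftrightarrow> interval_of k \<in> S \<and> position_of k \<in> L (interval_of k)"
  by (cases "prod_decode k") auto

lemma finite_row_col: "finite {k. interval_of k < T \<and> position_of k < n (interval_of k)}"
proof -
  have "{k. interval_of k < T \<and> position_of k < n (interval_of k)} \<subseteq> prod_encode ` (SIGMA i:{..<T}. {..<n i})"
  proof
    fix k assume "k \<in> {k. interval_of k < T \<and> position_of k < n (interval_of k)}"
    then show "k \<in> prod_encode ` (SIGMA i:{..<T}. {..<n i})"
      by (intro image_eqI[of _ _ "prod_decode k"]) (auto simp: prod_decode_mem_Sigma)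
  qed
  then show ?thesis by (rule finite_subset) auto
qed

lemma prob_space_unit_uniform: "prob_space (unit_uniform i)"
  by standard (simp add: unit_uniform_def emeasure_restrict_space space_restrict_space)

lemma space_unit_uniform [simp]: "space (unit_uniform i) = {real i..<real (Suc i)}"
  by (simp add: unit_uniform_def space_restrict_space)

lemma measure_unit_uniform:
  assumes "B \<in> sets borel"
  shows "measure (unit_uniform i) (B \<inter> {real i..<real (Suc i)}) = measure lborel (B \<inter> {real i..<real (Suc i)})"
  unfolding unit_uniform_def by (rule measure_restrict_space) auto

lemma product_prob_space_poisson: "product_prob_space (\<lambda>_. measure_pmf (poisson_pmf 1))"
  by (intro product_prob_spaceI measure_pmf.prob_space_axioms)

lemma product_prob_space_unit_uniform: "product_prob_space (\<lambda>k. unit_uniform (interval_of k))"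
  by (intro product_prob_spaceI prob_space_unit_uniform)

lemma prob_space_poisson_space: "prob_space poisson_space"
  unfolding poisson_space_def
  by (intro prob_space_pair prob_space_PiM measure_pmf.prob_space_axioms prob_space_unit_uniform)

lemma poisson_space_row:
  assumes "(n, u) \<in> space poisson_space"
  shows "real (interval_of k) \<le> u k" "u k < real (interval_of k) + 1"
proof -
  have "u k \<in> space (unit_uniform (interval_of k))"
    using assms by (auto simp: poisson_space_def space_pair_measure space_PiM)
  then show "real (interval_of k) \<le> u k" "u k < real (interval_of k) + 1" by auto
qed

lemma poisson_space_less_iff:
  assumes "(n, u) \<in> space poisson_space"
  shows "u k < real T \<longleftrightarrow> interval_of k < T"
  using poisson_space_row[OF assms, of k] by linarith

lemma measurable_poisson_space [measurable]:
  "(\<lambda>x. fst x i) \<in> poisson_space \<rightarrow>\<^sub>M count_space UNIV"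
  "(\<lambda>x. snd x k) \<in> borel_measurable poisson_space"
proof -
  show "(\<lambda>x. fst x i) \<in> poisson_space \<rightarrow>\<^sub>M count_space UNIV"
  proof -
    have "(\<lambda>n. n i) \<in> PiM UNIV (\<lambda>_. measure_pmf (poisson_pmf 1)) \<rightarrow>\<^sub>M measure_pmf (poisson_pmf 1)"
      by (rule measurable_component_singleton) simp
    then show ?thesis
      unfolding poisson_space_def by (intro measurable_compose[OF measurable_fst]) simp
  qed
  have "(\<lambda>u. u k) \<in> PiM UNIV (\<lambda>k. unit_uniform (interval_of k)) \<rightarrow>\<^sub>M unit_uniform (interval_of k)"
    by (rule measurable_component_singleton) simp
  moreover have "(\<lambda>x. x) \<in> borel_measurable (unit_uniform (interval_of k))"
    unfolding unit_uniform_def by (intro measurable_restrict_space1) simp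
  ultimately have "(\<lambda>u. u k) \<in> borel_measurable (PiM UNIV (\<lambda>k. unit_uniform (interval_of k)))"
    by (rule measurable_compose)
  then show "(\<lambda>x. snd x k) \<in> borel_measurable poisson_space"
    unfolding poisson_space_def by (rule measurable_compose[OF measurable_snd])
qed

lemma poisson_points_radon:
  assumes "x \<in> space poisson_space"
  shows "poisson_points x \<in> radon_point_measures"
proof -
  obtain n u where x: "x = (n, u)" by fastforce
  have "0 \<le> u k" for k using poisson_space_row(1)[OF assms[unfolded x], of k] by simp
  moreover have "finite {k \<in> {k. position_of k < n (interval_of k)}. u k \<le> c}" for c
  proof -
    obtain T where T: "c < real T" using reals_Archimedean2 by blast
    have "{k \<in> {k. position_of k < n (interval_of k)}. u k \<le> c} \<subseteq> {k. interval_of k < T \<and> position_of k < n (interval_of k)}"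
      using T poisson_space_less_iff[OF assms[unfolded x]] by force
    then show ?thesis by (rule finite_subset) (rule finite_row_col)
  qed
  ultimately show ?thesis unfolding x poisson_points_def by (simp add: dirac_sum_radon_iff)
qed

lemma emeasure_poisson_points:
  assumes "x \<in> space poisson_space" "B \<in> sets half_line"
  shows "emeasure (poisson_points x) (B \<inter> {0..<real T}) = of_nat (point_count T B x)"
proof -
  obtain n u where x: "x = (n, u)" by fastforce
  have u0: "0 \<le> u k" for k using poisson_space_row(1)[OF assms(1)[unfolded x], of k] by simp
  have "{0..<real T} \<in> sets half_line" by (auto simp: sets_half_line)
  then have "emeasure (poisson_points x) (B \<inter> {0..<real T})
      = emeasure (count_space {k. position_of k < n (interval_of k)}) {k \<in> {k. position_of k < n (interval_of k)}. u k \<in> B \<inter> {0..<real T}}"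
    unfolding x poisson_points_def using u0 assms(2) by (simp add: emeasure_dirac_sum_count sets.Int)
  also have "{k \<in> {k. position_of k < n (interval_of k)}. u k \<in> B \<inter> {0..<real T}}
      = {k. interval_of k < T \<and> position_of k < n (interval_of k) \<and> u k \<in> B}"
    using poisson_space_less_iff[OF assms(1)[unfolded x], of _ T] u0 by auto
  also have "emeasure (count_space {k. position_of k < n (interval_of k)}) {k. interval_of k < T \<and> position_of k < n (interval_of k) \<and> u k \<in> B}
      = of_nat (point_count T B x)"
  proof -
    have "finite {k. interval_of k < T \<and> position_of k < n (interval_of k) \<and> u k \<in> B}"
      by (rule finite_subset[OF _ finite_row_col[of T n]]) auto
    then show ?thesis
      by (subst emeasure_count_space_finite) (auto simp: x point_count_def)
  qed
  finally show ?thesis .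
qed

lemma emeasure_dirac_sum_measurable:
  assumes s: "\<And>k x. x \<in> space P \<Longrightarrow> k \<in> K x \<Longrightarrow> 0 \<le> s x k"
    and K: "\<And>k. {x \<in> space P. k \<in> K x} \<in> sets P"
    and sm: "\<And>k. (\<lambda>x. s x k) \<in> borel_measurable P" and B: "B \<in> sets half_line"
  shows "(\<lambda>x. emeasure (dirac_sum (K x) (s x)) B) \<in> borel_measurable P"
proof -
  note K[measurable] sm[measurable]
  have [measurable]: "B \<in> sets borel" using B by (simp add: sets_half_line)
  have "(\<lambda>x. \<Sum>k. if k \<in> K x then indicator B (s x k) else 0 :: ennreal) \<in> borel_measurable P"
    by measurable
  then show ?thesis
    by (subst measurable_cong[OF emeasure_dirac_sum]) (use s B in auto)
qed

lemma poisson_points_measurable [measurable]: "poisson_points \<in> poisson_space \<rightarrow>\<^sub>M point_measure_algebra"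
proof (rule measurable_point_measure_algebraI[OF poisson_points_radon])
  fix K j
  have "(\<lambda>x. emeasure (dirac_sum {k. position_of k < fst x (interval_of k)} (snd x)) (cell K j)) \<in> borel_measurable poisson_space"
    by (rule emeasure_dirac_sum_measurable) (use poisson_space_row(1) in \<open>force intro: order_trans[OF of_nat_0_le_iff]\<close>, measurable)
  then show "(\<lambda>x. emeasure (poisson_points x) (cell K j)) \<in> borel_measurable poisson_space"
    by (simp add: poisson_points_def split_beta)
qed

lemma point_count_measurable:
  assumes B: "B \<in> sets half_line"
  shows "point_count T B \<in> poisson_space \<rightarrow>\<^sub>M count_space UNIV"
proof (rule measurable_count_space_eq2_countable[THEN iffD2], intro conjI ballI)
  fix j
  have [measurable]: "B \<inter> {0..<real T} \<in> sets half_line" using B by (auto simp: sets_half_line)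
  have "{x \<in> space poisson_space. emeasure (poisson_points x) (B \<inter> {0..<real T}) = of_nat j} \<in> sets poisson_space"
    by measurable
  also have "{x \<in> space poisson_space. emeasure (poisson_points x) (B \<inter> {0..<real T}) = of_nat j}
      = point_count T B -` {j} \<inter> space poisson_space"
    using emeasure_poisson_points[OF _ B] by auto
  finally show "point_count T B -` {j} \<inter> space poisson_space \<in> sets poisson_space" .
qed auto

lemma sum_measure_unit_intervals:
  assumes "B \<in> sets half_line"
  shows "(\<Sum>i<T. measure lborel (B \<inter> {real i..<real (Suc i)})) = measure lborel (B \<inter> {0..<real T})"
proof -
  have B: "B \<in> sets borel" using assms by (simp add: sets_half_line)
  have fin: "emeasure lborel (B \<inter> {real i..<real (Suc i)}) \<noteq> \<infinity>" for i
  proof -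
    have "emeasure lborel (B \<inter> {real i..<real (Suc i)}) \<le> emeasure lborel {real i..<real (Suc i)}"
      by (rule emeasure_mono) auto
    also have "\<dots> < \<infinity>" by simp
    finally show ?thesis by simp
  qed
  have "B \<inter> {0..<real T} = (\<Union>i<T. B \<inter> {real i..<real (Suc i)})"
  proof (intro set_eqI iffI)
    fix x assume "x \<in> B \<inter> {0..<real T}"
    then show "x \<in> (\<Union>i<T. B \<inter> {real i..<real (Suc i)})"
      by (intro UN_I[of "nat \<lfloor>x\<rfloor>"]) (auto simp: nat_less_iff floor_less_iff, linarith)
  qed auto
  moreover have "measure lborel (\<Union>i<T. B \<inter> {real i..<real (Suc i)}) = (\<Sum>i<T. measure lborel (B \<inter> {real i..<real (Suc i)}))"
  proof (rule measure_finite_Union)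
    show "disjoint_family_on (\<lambda>i. B \<inter> {real i..<real (Suc i)}) {..<T}"
    proof -
      have "i = j" if "real i \<le> x" "x < real (Suc i)" "real j \<le> x" "x < real (Suc j)" for i j x
        using that by linarith
      then show ?thesis unfolding disjoint_family_on_def by fastforce
    qed
  qed (use B fin in auto)
  ultimately show ?thesis by simp
qed

text \<open>For fixed numbers n the integrand is a product of w(u k) over the used points, where w
  is z B on B and 1 off the sets in J. Integrating the positions gives the product of c(i)^n(i), and
  integrating the Poisson numbers gives exp(c(i) - 1) for each interval. The exponent is additive
  over the sets in J and over the intervals, so interchanging the two sums yields one factor for
  each B.\<close>

lemma point_count_generating_function:
  assumes J: "finite J" "J \<subseteq> sets half_line" "disjoint J" and z: "\<And>B. B \<in> J \<Longrightarrow> \<bar>z B\<bar> \<le> 1"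
  shows "(\<integral>x. (\<Prod>B\<in>J. z B ^ point_count T B x) \<partial>poisson_space)
    = (\<Prod>B\<in>J. exp (measure lborel (B \<inter> {0..<real T}) * (z B - 1)))"
proof -
  let ?PN = "PiM UNIV (\<lambda>_. measure_pmf (poisson_pmf 1)) :: (nat \<Rightarrow> nat) measure"
  let ?PU = "PiM UNIV (\<lambda>k. unit_uniform (interval_of k))"
  interpret PN: product_prob_space "\<lambda>_. measure_pmf (poisson_pmf 1)" UNIV by (rule product_prob_space_poisson)
  interpret PU: product_prob_space "\<lambda>k. unit_uniform (interval_of k)" UNIV by (rule product_prob_space_unit_uniform)
  interpret P: pair_prob_space ?PN ?PU ..
  have JB: "B \<in> sets borel" if "B \<in> J" for B using that J(2) by (auto simp: sets_half_line)
  define w where "w x = (\<Prod>B\<in>J. if x \<in> B then z B else 1)" for x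
  have w1: "\<bar>w x\<bar> \<le> 1" for x
    unfolding w_def abs_prod using z by (intro prod_le_1) auto
  have wm: "w \<in> borel_measurable borel"
    unfolding w_def using JB by (intro borel_measurable_prod measurable_If_set) auto
  have wmi: "w \<in> borel_measurable (unit_uniform i)" for i
    unfolding unit_uniform_def using wm by (intro measurable_restrict_space1) simp
  interpret U: prob_space "unit_uniform i" for i by (rule prob_space_unit_uniform)
  have wi: "integrable (unit_uniform i) w" for i
    by (rule U.integrable_const_bound[where B=1]) (use w1 wmi in auto)
  define c where "c i = (\<integral>x. w x \<partial>unit_uniform i)" for i
  have c1: "\<bar>c i\<bar> \<le> 1" for i
  proof -
    have "\<bar>c i\<bar> \<le> (\<integral>x. \<bar>w x\<bar> \<partial>unit_uniform i)" unfolding c_def by (rule integral_abs_bound)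
    also have "\<dots> \<le> (\<integral>x. 1 \<partial>unit_uniform i)"
      by (rule integral_mono) (use wi w1 in auto)
    finally show ?thesis using U.prob_space[of i] by simp
  qed
  \<comment> \<open>Disjointness of J enters here: at most one factor of w differs from 1, so the
    product is affine in the numbers z B - 1. This is the source of independence.\<close>
  have w_sum: "w x = 1 + (\<Sum>B\<in>J. (z B - 1) * indicator B x)" for x
  proof (cases "\<exists>B\<in>J. x \<in> B")
    case True
    then obtain B where B: "B \<in> J" "x \<in> B" by blast
    have other: "x \<notin> B'" if "B' \<in> J - {B}" for B'
      using J(3) B that unfolding disjoint_def by blast
    have "w x = z B"
      unfolding w_def using B other J(1) by (subst prod.remove[of J B]) (auto intro!: prod.neutral)
    moreover have "(\<Sum>B\<in>J. (z B - 1) * indicator B x) = z B - 1"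
      using B other J(1) by (subst sum.remove[of J B]) (auto intro!: sum.neutral)
    ultimately show ?thesis by simp
  next
    case False
    then show ?thesis unfolding w_def by (simp add: prod.neutral sum.neutral)
  qed
  have c_sum: "c i - 1 = (\<Sum>B\<in>J. (z B - 1) * measure lborel (B \<inter> {real i..<real (Suc i)}))" for i
  proof -
    have int: "integrable (unit_uniform i) (\<lambda>x. (z B - 1) * indicator B x)"
      and eq: "(\<integral>x. (z B - 1) * indicator B x \<partial>unit_uniform i) = (z B - 1) * measure lborel (B \<inter> {real i..<real (Suc i)})"
      if "B \<in> J" for B
    proof -
      have "indicat_real B \<in> borel_measurable (unit_uniform i)"
        unfolding unit_uniform_def using JB[OF that] by (intro measurable_restrict_space1) auto
      then show "integrable (unit_uniform i) (\<lambda>x. (z B - 1) * indicator B x)"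
        by (intro integrable_mult_right U.integrable_const_bound[where B=1]) auto
      have "(\<integral>x. indicator B x \<partial>unit_uniform i) = measure (unit_uniform i) (B \<inter> {real i..<real (Suc i)})"
        by simp
      then show "(\<integral>x. (z B - 1) * indicator B x \<partial>unit_uniform i) = (z B - 1) * measure lborel (B \<inter> {real i..<real (Suc i)})"
        using measure_unit_uniform[OF JB[OF that], of i] by simp
    qed
    have "c i = (\<integral>x. 1 + (\<Sum>B\<in>J. (z B - 1) * indicator B x) \<partial>unit_uniform i)"
      unfolding c_def w_sum ..
    also have "\<dots> = 1 + (\<Sum>B\<in>J. \<integral>x. (z B - 1) * indicator B x \<partial>unit_uniform i)"
      using int U.prob_space[of i] by (simp add: Bochner_Integration.integral_add Bochner_Integration.integral_sum)
    also have "\<dots> = 1 + (\<Sum>B\<in>J. (z B - 1) * measure lborel (B \<inter> {real i..<real (Suc i)}))"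
      by (intro arg_cong[where f="(+) 1"] sum.cong refl eq)
    finally show ?thesis by simp
  qed
  let ?I = "\<lambda>n. {k. interval_of k < T \<and> position_of k < n (interval_of k)}"
  have prod_w: "(\<Prod>B\<in>J. z B ^ point_count T B (n, u)) = (\<Prod>k\<in>?I n. w (u k))" for n u
  proof -
    have "z B ^ point_count T B (n, u) = (\<Prod>k\<in>?I n. if u k \<in> B then z B else 1)" for B
    proof -
      have "?I n \<inter> {k. u k \<in> B} = {k. interval_of k < T \<and> position_of k < n (interval_of k) \<and> u k \<in> B}" by auto
      then show ?thesis
        using finite_row_col[of T n] by (simp add: point_count_def prod.If_cases)
    qed
    then show ?thesis unfolding w_def by (simp add: prod.swap[of _ J])
  qed
  have interval_of: "(\<integral>u. (\<Prod>k\<in>?I n. w (u k)) \<partial>?PU) = (\<Prod>i<T. c i ^ n i)" for n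
  proof -
    have "(\<integral>u. (\<Prod>k\<in>?I n. w (u k)) \<partial>?PU) = (\<Prod>k\<in>?I n. c (interval_of k))"
      unfolding c_def by (rule PU.integral_PiM_prod) (use finite_row_col wi in auto)
    also have "\<dots> = (\<Prod>(i, l)\<in>(SIGMA i:{..<T}. {..<n i}). c i)"
      by (rule prod.reindex_bij_witness[of _ prod_encode prod_decode])
         (auto simp: prod_decode_mem_Sigma split_beta)
    also have "\<dots> = (\<Prod>i<T. \<Prod>l<n i. c i)"
      by (rule prod.Sigma[symmetric]) auto
    finally show ?thesis by simp
  qed
  have meas: "(\<lambda>x. \<Prod>B\<in>J. z B ^ point_count T B x) \<in> borel_measurable poisson_space"
  proof (rule borel_measurable_prod)
    fix B assume "B \<in> J"
    then have "point_count T B \<in> poisson_space \<rightarrow>\<^sub>M count_space UNIV"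
      using J(2) by (intro point_count_measurable) auto
    then show "(\<lambda>x. z B ^ point_count T B x) \<in> borel_measurable poisson_space"
      by (rule measurable_compose) simp
  qed
  have "integrable poisson_space (\<lambda>x. \<Prod>B\<in>J. z B ^ point_count T B x)"
  proof (rule finite_measure.integrable_const_bound[where B=1])
    show "finite_measure poisson_space"
      using prob_space_poisson_space by (simp add: prob_space.axioms)
    show "AE x in poisson_space. norm (\<Prod>B\<in>J. z B ^ point_count T B x) \<le> 1"
      unfolding real_norm_def abs_prod power_abs using z by (intro always_eventually allI prod_le_1) (auto intro!: power_le_one)
  qed (rule meas)
  then have "(\<integral>x. (\<Prod>B\<in>J. z B ^ point_count T B x) \<partial>poisson_space)
      = (\<integral>n. \<integral>u. (\<Prod>B\<in>J. z B ^ point_count T B (n, u)) \<partial>?PU \<partial>?PN)"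
    unfolding poisson_space_def by (rule P.integral_fst'[symmetric])
  also have "\<dots> = (\<integral>n. (\<Prod>i<T. c i ^ n i) \<partial>?PN)" by (simp add: prod_w interval_of)
  also have "\<dots> = (\<Prod>i<T. \<integral>m. c i ^ m \<partial>measure_pmf (poisson_pmf 1))"
  proof (rule PN.integral_PiM_prod)
    fix i
    show "integrable (measure_pmf (poisson_pmf 1)) (\<lambda>m. c i ^ m)"
      by (rule measure_pmf.integrable_const_bound[where B=1])
         (use c1 in \<open>auto simp: power_abs intro!: power_le_one\<close>)
  qed auto
  also have "\<dots> = (\<Prod>i<T. exp (c i - 1))" by (simp add: integral_poisson_power c1)
  also have "\<dots> = exp (\<Sum>i<T. \<Sum>B\<in>J. (z B - 1) * measure lborel (B \<inter> {real i..<real (Suc i)}))"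
    by (simp add: exp_sum c_sum)
  also have "(\<Sum>i<T. \<Sum>B\<in>J. (z B - 1) * measure lborel (B \<inter> {real i..<real (Suc i)}))
      = (\<Sum>B\<in>J. measure lborel (B \<inter> {0..<real T}) * (z B - 1))"
    using J(2) by (subst sum.swap)
      (auto simp: sum_distrib_left[symmetric] sum_measure_unit_intervals mult.commute simp del: of_nat_Suc intro!: sum.cong)
  also have "exp \<dots> = (\<Prod>B\<in>J. exp (measure lborel (B \<inter> {0..<real T}) * (z B - 1)))"
    by (rule exp_sum[OF J(1)])
  finally show ?thesis .
qed

text \<open>The value 0 at infinite parameter is the limit for growing parameter and says that a set
  of infinite length almost surely has no finite count. With it the joint law covers all Borel sets,
  as the independence statement requires.\<close>

definition poisson_weight :: "ennreal \<Rightarrow> nat \<Rightarrow> real" where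
  "poisson_weight l k = (if l = \<infinity> then 0 else exp (- enn2real l) * enn2real l ^ k / fact k)"

lemma poisson_weight_finite:
  "l < \<infinity> \<Longrightarrow> poisson_weight l k = exp (- enn2real l) * enn2real l ^ k / fact k"
  by (auto simp: poisson_weight_def)

lemma tendsto_poisson_weight:
  assumes f: "f \<longlonglongrightarrow> l" and fin: "\<And>T. f T < \<infinity>"
  shows "(\<lambda>T. poisson_weight (f T) k) \<longlonglongrightarrow> poisson_weight l k"
proof (cases "l = \<infinity>")
  case True
  have "filterlim (\<lambda>T. enn2real (f T)) at_top sequentially"
    unfolding filterlim_at_top
  proof
    fix Z
    have "\<forall>\<^sub>F T in sequentially. ennreal Z < f T"
      using f True by (intro order_tendstoD(1)) auto
    then show "\<forall>\<^sub>F T in sequentially. Z \<le> enn2real (f T)"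
    proof eventually_elim
      case (elim T)
      then have "ennreal Z \<le> ennreal (enn2real (f T))" using fin[of T] by simp
      then show ?case by (subst (asm) ennreal_le_iff) auto
    qed
  qed
  moreover have "((\<lambda>x::real. exp (- x) * x ^ k / fact k) \<longlongrightarrow> 0) at_top"
  proof -
    have "((\<lambda>x::real. x ^ k / exp x) \<longlongrightarrow> 0) at_top" by (rule tendsto_power_div_exp_0)
    then have "((\<lambda>x::real. x ^ k / exp x / fact k) \<longlongrightarrow> 0 / fact k) at_top" by (intro tendsto_intros) auto
    then show ?thesis by (simp add: exp_minus field_simps)
  qed
  ultimately have "(\<lambda>T. exp (- enn2real (f T)) * enn2real (f T) ^ k / fact k) \<longlonglongrightarrow> 0"
    by (rule filterlim_compose[rotated])
  moreover have "poisson_weight l k = 0" using True by (simp add: poisson_weight_def)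
  ultimately show ?thesis by (simp add: poisson_weight_finite[OF fin])
next
  case False
  have "(\<lambda>T. enn2real (f T)) \<longlonglongrightarrow> enn2real l"
    by (rule tendsto_enn2real[of f "enn2real l"]) (use f False in \<open>auto simp: less_top\<close>)
  then have "(\<lambda>T. exp (- enn2real (f T)) * enn2real (f T) ^ k / fact k) \<longlonglongrightarrow> exp (- enn2real l) * enn2real l ^ k / fact k"
    by (intro tendsto_divide tendsto_mult tendsto_exp tendsto_minus tendsto_power tendsto_const) auto
  moreover have "l < \<infinity>" using False by (simp add: less_top)
  ultimately show ?thesis by (simp add: poisson_weight_finite[OF fin] poisson_weight_finite[of l])
qed

lemma emeasure_initial_tendsto:
  assumes "sets m = sets half_line" "B \<in> sets half_line"
  shows "(\<lambda>T. emeasure m (B \<inter> {0..<real T})) \<longlonglongrightarrow> emeasure m B"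
proof -
  have "{0..<real T} \<in> sets half_line" for T by (auto simp: sets_half_line)
  then have "(\<lambda>T. emeasure m (B \<inter> {0..<real T})) \<longlonglongrightarrow> emeasure m (\<Union>T. B \<inter> {0..<real T})"
    by (intro Lim_emeasure_incseq) (use assms in \<open>auto simp: incseq_def\<close>)
  moreover have "(\<Union>T. B \<inter> {0..<real T}) = B"
    using assms(2) reals_Archimedean2 by (auto simp: sets_half_line) blast
  ultimately show ?thesis by simp
qed

text \<open>Truncation to [0,T) brings in the generating functions, and T then tends to infinity.
  The truncated counts stay below the full count and converge to it; being integers, they eventually
  equal k exactly if the full count is k. The indicators thus converge pointwise.\<close>

lemma poisson_joint_law:
  assumes J: "finite J" "J \<subseteq> sets half_line" "disjoint J"
  shows "measure poisson_space {x \<in> space poisson_space. \<forall>B\<in>J. emeasure (poisson_points x) B = of_nat (k B)}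
    = (\<Prod>B\<in>J. poisson_weight (emeasure lborel B) (k B))"
proof -
  interpret prob_space poisson_space by (rule prob_space_poisson_space)
  have lfin: "emeasure lborel (B \<inter> {0..<real T}) < \<infinity>" for B T
  proof -
    have "emeasure lborel (B \<inter> {0..<real T}) \<le> emeasure lborel {0..<real T}" by (rule emeasure_mono) auto
    also have "\<dots> < \<infinity>" by simp
    finally show ?thesis .
  qed
  have finT: "measure poisson_space {x \<in> space poisson_space. \<forall>B\<in>J. point_count T B x = k B}
      = (\<Prod>B\<in>J. poisson_weight (emeasure lborel (B \<inter> {0..<real T})) (k B))" for T
  proof -
    let ?l = "\<lambda>B. measure lborel (B \<inter> {0..<real T})"
    have "measure poisson_space {x \<in> space poisson_space. \<forall>B\<in>J. point_count T B x = k B}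
        = (\<Prod>B\<in>J. exp (- ?l B) * ?l B ^ k B / fact (k B))"
      by (rule prob_eq_if_generating_functions_eq[where G="\<lambda>B t. exp (?l B * (t - 1))"])
         (use J point_count_measurable poisson_sums point_count_generating_function[OF J] in auto)
    then show ?thesis by (simp add: poisson_weight_finite[OF lfin] measure_def)
  qed
  have em[measurable]: "(\<lambda>x. emeasure (poisson_points x) B) \<in> borel_measurable poisson_space" if "B \<in> sets half_line" for B
    by (rule measurable_compose[OF poisson_points_measurable measurable_emeasure_point_measure[OF that]])
  let ?A = "{x \<in> space poisson_space. \<forall>B\<in>J. emeasure (poisson_points x) B = of_nat (k B)}"
  let ?A' = "\<lambda>T. {x \<in> space poisson_space. \<forall>B\<in>J. point_count T B x = k B}"
  have A'm: "?A' T \<in> sets poisson_space" for T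
  proof (rule sets.sets_Collect_finite_All[OF _ J(1)])
    fix B assume "B \<in> J"
    then have [measurable]: "point_count T B \<in> poisson_space \<rightarrow>\<^sub>M count_space UNIV"
      using J(2) by (intro point_count_measurable) auto
    show "{x \<in> space poisson_space. point_count T B x = k B} \<in> sets poisson_space" by measurable
  qed
  have Am: "?A \<in> sets poisson_space"
  proof (rule sets.sets_Collect_finite_All[OF _ J(1)])
    fix B assume "B \<in> J"
    then have [measurable]: "B \<in> sets half_line" using J(2) by auto
    show "{x \<in> space poisson_space. emeasure (poisson_points x) B = of_nat (k B)} \<in> sets poisson_space"
      by measurable
  qed
  have "(\<lambda>T. expectation (indicat_real (?A' T))) \<longlonglongrightarrow> expectation (indicat_real ?A)"
  proof (rule integral_dominated_convergence[where w="\<lambda>_. 1"])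
    show "AE x in poisson_space. (\<lambda>T. indicat_real (?A' T) x) \<longlonglongrightarrow> indicat_real ?A x"
    proof (rule AE_I2)
      fix x assume x: "x \<in> space poisson_space"
      have "\<forall>\<^sub>F T in sequentially. (point_count T B x = k B \<longleftrightarrow> emeasure (poisson_points x) B = of_nat (k B))"
        if B: "B \<in> J" for B
      proof -
        let ?e = "emeasure (poisson_points x) B"
        have BH: "B \<in> sets half_line" using B J by auto
        have lim: "(\<lambda>T. of_nat (point_count T B x)) \<longlonglongrightarrow> ?e"
          using emeasure_initial_tendsto[of "poisson_points x" B] poisson_points_radon[OF x] BH
          by (simp add: emeasure_poisson_points[OF x BH])
        have le: "of_nat (point_count T B x) \<le> ?e" for T
          unfolding emeasure_poisson_points[OF x BH, symmetric]
          by (rule emeasure_mono) (use poisson_points_radon[OF x] BH in auto)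
        show ?thesis
        proof (cases "?e < of_nat (k B)")
          case True
          have "of_nat (point_count T B x) < (of_nat (k B) :: ennreal)" for T using le[of T] True by (rule order_le_less_trans)
          then have "point_count T B x < k B" for T by simp
          then show ?thesis using True by (intro always_eventually allI) (metis less_irrefl)
        next
          case False
          show ?thesis
          proof (cases "?e = of_nat (k B)")
            case True
            have "\<forall>\<^sub>F T in sequentially. k B \<le> point_count T B x"
            proof (cases "k B")
              case (Suc j)
              then have "of_nat j < ?e" using True by simp
              with lim have "\<forall>\<^sub>F T in sequentially. (of_nat j :: ennreal) < of_nat (point_count T B x)"
                by (rule order_tendstoD(1))
              then show ?thesis by eventually_elim (simp add: Suc)
            qed simp
            then show ?thesis
            proof eventually_elim
              case (elim T)
              have "point_count T B x \<le> k B" using le[of T] True by simp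
              with elim True show ?case by simp
            qed
          next
            case neq: False
            then have "of_nat (k B) < ?e" using False by simp
            with lim have "\<forall>\<^sub>F T in sequentially. (of_nat (k B) :: ennreal) < of_nat (point_count T B x)"
              by (rule order_tendstoD(1))
            then show ?thesis by eventually_elim (use neq in auto)
          qed
        qed
      qed
      then have "\<forall>\<^sub>F T in sequentially. \<forall>B\<in>J. (point_count T B x = k B \<longleftrightarrow> emeasure (poisson_points x) B = of_nat (k B))"
        by (intro eventually_ball_finite J(1)) auto
      then have "\<forall>\<^sub>F T in sequentially. indicat_real (?A' T) x = indicat_real ?A x"
        by eventually_elim (auto simp: indicator_def)
      then show "(\<lambda>T. indicat_real (?A' T) x) \<longlonglongrightarrow> indicat_real ?A x" by (rule tendsto_eventually)
    qed
  qed (use A'm Am in \<open>auto simp: indicator_def\<close>)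
  then have "(\<lambda>T. measure poisson_space (?A' T)) \<longlonglongrightarrow> measure poisson_space ?A"
    using Am A'm sets.sets_into_space by (simp add: Int_absorb2)
  moreover have "(\<lambda>T. \<Prod>B\<in>J. poisson_weight (emeasure lborel (B \<inter> {0..<real T})) (k B))
      \<longlonglongrightarrow> (\<Prod>B\<in>J. poisson_weight (emeasure lborel B) (k B))"
  proof (intro tendsto_prod tendsto_poisson_weight lfin)
    fix B assume "B \<in> J"
    then have B: "B \<in> sets borel" "B \<subseteq> {0..}" using J(2) sets_half_line[of B] by blast+
    have "(\<lambda>T. emeasure lborel (B \<inter> {0..<real T})) \<longlonglongrightarrow> emeasure lborel (\<Union>T. B \<inter> {0..<real T})"
      by (intro Lim_emeasure_incseq) (use B in \<open>auto simp: incseq_def\<close>)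
    moreover have "(\<Union>T. B \<inter> {0..<real T}) = B"
      using B reals_Archimedean2 by auto blast
    ultimately show "(\<lambda>T. emeasure lborel (B \<inter> {0..<real T})) \<longlonglongrightarrow> emeasure lborel B" by simp
  qed
  ultimately show ?thesis unfolding finT by (rule LIMSEQ_unique)
qed

section \<open>The law of the construction and its independence\<close>

definition poisson_law :: "real measure measure" where
  "poisson_law = distr poisson_space point_measure_algebra poisson_points"

lemma space_poisson_law [simp]: "space poisson_law = radon_point_measures"
  by (simp add: poisson_law_def)

lemma sets_poisson_law [simp]: "sets poisson_law = sets point_measure_algebra"
  by (simp add: poisson_law_def)

lemma prob_space_poisson_law: "prob_space poisson_law"
  unfolding poisson_law_def
  by (rule prob_space.prob_space_distr[OF prob_space_poisson_space poisson_points_measurable])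

lemma count_event:
  "B \<in> sets half_line \<Longrightarrow> {m \<in> radon_point_measures. emeasure m B = c} \<in> sets point_measure_algebra"
proof -
  assume "B \<in> sets half_line"
  then have "{m \<in> space point_measure_algebra. emeasure m B = c} \<in> sets point_measure_algebra"
    by measurable
  then show ?thesis by simp
qed

lemma poisson_law_joint:
  assumes J: "finite J" "J \<subseteq> sets half_line" "disjoint J" "J \<noteq> {}"
  shows "measure poisson_law (\<Inter>B\<in>J. {m \<in> radon_point_measures. emeasure m B = of_nat (k B)})
    = (\<Prod>B\<in>J. poisson_weight (emeasure lborel B) (k B))"
proof -
  have "(\<Inter>B\<in>J. {m \<in> radon_point_measures. emeasure m B = of_nat (k B)}) \<in> sets point_measure_algebra"
    using J count_event by (intro sets.finite_INT) auto
  then have "measure poisson_law (\<Inter>B\<in>J. {m \<in> radon_point_measures. emeasure m B = of_nat (k B)})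
    = measure poisson_space (poisson_points -` (\<Inter>B\<in>J. {m \<in> radon_point_measures. emeasure m B = of_nat (k B)}) \<inter> space poisson_space)"
    unfolding poisson_law_def by (rule measure_distr[OF poisson_points_measurable])
  also have "poisson_points -` (\<Inter>B\<in>J. {m \<in> radon_point_measures. emeasure m B = of_nat (k B)}) \<inter> space poisson_space
      = {x \<in> space poisson_space. \<forall>B\<in>J. emeasure (poisson_points x) B = of_nat (k B)}"
    using poisson_points_radon J(4) by auto
  finally show ?thesis using poisson_joint_law[OF J(1,2,3)] by simp
qed

lemma emeasure_radon_of_nat_or_top:
  assumes "m \<in> radon_point_measures" "B \<in> sets half_line"
  shows "emeasure m B = \<infinity> \<or> (\<exists>k. emeasure m B = of_nat k)"
  using assms(1)
proof (rule radon_point_measureE)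
  fix K and s :: "nat \<Rightarrow> real"
  assume s: "\<And>k. k \<in> K \<Longrightarrow> 0 \<le> s k" "m = dirac_sum K s"
  show ?thesis
    using assms(2) s by (auto simp: emeasure_dirac_sum_count emeasure_count_space)
qed

text \<open>Since counts take values in \<open>\<nat> \<union> {\<infinity>}\<close>, the events that fix a finite count form an
  intersection-stable generator, on which independence is the joint law.\<close>

lemma uniform_poisson_law_poisson_law: "uniform_poisson_law poisson_law"
  unfolding uniform_poisson_law_def
proof (intro conjI ballI allI impI)
  interpret prob_space poisson_law by (rule prob_space_poisson_law)
  show "prob_space poisson_law" by (rule prob_space_poisson_law)
  show "sets poisson_law = sets point_measure_algebra" by simp
  fix B j assume B: "B \<in> sets half_line" "emeasure lborel B < \<infinity>"
  show "prob {m \<in> space poisson_law. emeasure m B = of_nat j} =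
      exp (- measure lborel B) * measure lborel B ^ j / fact j"
    using poisson_law_joint[of "{B}" "\<lambda>_. j"] B(1) poisson_weight_finite[OF B(2)]
    by (simp add: measure_def disjoint_def)
next
  interpret prob_space poisson_law by (rule prob_space_poisson_law)
  fix \<B> :: "real set set" assume B: "finite \<B> \<and> \<B> \<subseteq> sets half_line \<and> disjoint \<B>"
  \<comment> \<open>Events for different values of one count are disjoint, so the empty set is added
    to make the generator stable under intersections.\<close>
  define G where "G B = insert {} (range (\<lambda>k::nat. {m \<in> radon_point_measures. emeasure m B = of_nat k}))" for B
  have G: "indep_sets G \<B>"
  proof (rule indep_setsI)
    fix C assume "C \<in> \<B>"
    then show "G C \<subseteq> events" using count_event B by (auto simp: G_def)
  next
    fix A J assume J: "J \<noteq> {}" "J \<subseteq> \<B>" "finite J" "\<forall>j\<in>J. A j \<in> G j"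
    show "prob (\<Inter>j\<in>J. A j) = (\<Prod>j\<in>J. prob (A j))"
    proof (cases "\<exists>j\<in>J. A j = {}")
      case True
      then obtain j where j: "j \<in> J" "A j = {}" by blast
      then have "(\<Inter>j\<in>J. A j) = {}" by blast
      moreover have "(\<Prod>j\<in>J. prob (A j)) = 0" using j by (intro prod_zero[OF J(3)] bexI[of _ j]) auto
      ultimately show ?thesis by simp
    next
      case False
      then have "\<forall>j\<in>J. \<exists>k. A j = {m \<in> radon_point_measures. emeasure m j = of_nat k}"
        using J(4) unfolding G_def by blast
      then obtain k where k: "\<And>j. j \<in> J \<Longrightarrow> A j = {m \<in> radon_point_measures. emeasure m j = of_nat (k j)}"
        by metis
      have JB: "J \<subseteq> sets half_line" "disjoint J"
        using J(2) B unfolding disjoint_def by (blast, meson subsetD)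
      have "prob (\<Inter>j\<in>J. A j) = (\<Prod>j\<in>J. poisson_weight (emeasure lborel j) (k j))"
        using poisson_law_joint[OF J(3) JB J(1), of k] k by simp
      also have "\<dots> = (\<Prod>j\<in>J. prob (A j))"
      proof (rule prod.cong[OF refl])
        fix j assume "j \<in> J"
        then show "poisson_weight (emeasure lborel j) (k j) = prob (A j)"
          using poisson_law_joint[of "{j}" k] JB k by (auto simp: disjoint_def)
      qed
      finally show ?thesis .
    qed
  qed
  have "Int_stable (G C)" for C
  proof (rule Int_stableI)
    fix a b assume "a \<in> G C" "b \<in> G C"
    then have "a = {} \<or> b = {} \<or> a = b \<or> a \<inter> b = {}" unfolding G_def by auto
    then show "a \<inter> b \<in> G C" using \<open>a \<in> G C\<close> by (auto simp: G_def)
  qed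
  then have "indep_sets (\<lambda>B. sigma_sets (space poisson_law) (G B)) \<B>"
    by (intro indep_sets_sigma G)
  then have "indep_sets (\<lambda>B. {(\<lambda>m. emeasure m B) -` A \<inter> space poisson_law | A. A \<in> sets (borel :: ennreal measure)}) \<B>"
  proof (rule indep_sets_mono_sets)
    fix C assume "C \<in> \<B>"
    then have C: "C \<in> sets half_line" using B by auto
    have alg: "sigma_algebra radon_point_measures (sigma_sets radon_point_measures (G C))"
      by (rule sigma_algebra_sigma_sets) (auto simp: G_def)
    let ?E = "\<lambda>k::nat. {m \<in> radon_point_measures. emeasure m C = of_nat k}"
    have E: "?E k \<in> sigma_sets radon_point_measures (G C)" for k
      by (rule sigma_sets.Basic) (auto simp: G_def)
    have "(\<lambda>m. emeasure m C) -` A \<inter> radon_point_measures \<in> sigma_sets radon_point_measures (G C)" for A :: "ennreal set"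
    proof -
      \<comment> \<open>The infinite count has no event of its own in the generator;
        \<open>?V\<close> recovers it as the complement of all finite counts.\<close>
      let ?U = "\<Union>k\<in>{k. of_nat k \<in> A}. ?E k" and ?V = "radon_point_measures - (\<Union>k. ?E k)"
      have U: "?U \<in> sigma_sets radon_point_measures (G C)" "(\<Union>k. ?E k) \<in> sigma_sets radon_point_measures (G C)"
        by (rule sigma_algebra.countable_UN'[OF alg]; use E in force)+
      have "?V \<in> sigma_sets radon_point_measures (G C)"
        by (rule sigma_sets.Compl) (rule U)
      then have "(if \<infinity> \<in> A then ?U \<union> ?V else ?U) \<in> sigma_sets radon_point_measures (G C)"
        using U sigma_sets_Un by auto
      moreover have "(\<lambda>m. emeasure m C) -` A \<inter> radon_point_measures = (if \<infinity> \<in> A then ?U \<union> ?V else ?U)"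
      proof (intro set_eqI)
        fix m
        show "m \<in> (\<lambda>m. emeasure m C) -` A \<inter> radon_point_measures \<longleftrightarrow> m \<in> (if \<infinity> \<in> A then ?U \<union> ?V else ?U)"
        proof (cases "m \<in> radon_point_measures")
          case True
          then show ?thesis
            using emeasure_radon_of_nat_or_top[OF True C] by (elim disjE exE) auto
        qed auto
      qed
      ultimately show ?thesis by simp
    qed
    then show "{(\<lambda>m. emeasure m C) -` A \<inter> space poisson_law | A. A \<in> sets borel} \<subseteq> sigma_sets (space poisson_law) (G C)"
      by auto
  qed
  then show "indep_vars (\<lambda>_. borel :: ennreal measure) (\<lambda>B m. emeasure m B) \<B>"
    unfolding indep_vars_def2
  proof (intro conjI ballI)
    fix C assume "C \<in> \<B>"
    then have "C \<in> sets half_line" using B by auto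
    from measurable_emeasure_point_measure[OF this]
    show "random_variable borel (\<lambda>m. emeasure m C)"
      by (simp cong: measurable_cong_sets)
  qed
qed

section \<open>The hitting time process\<close>

text \<open>The clock is nondecreasing, so the indices with clock value below b form an initial
  segment. Their sum is the last clock value before b, and the next increment, at most e, carries
  the clock to b or beyond.\<close>

lemma sum_before_time:
  fixes q :: "nat \<Rightarrow> real"
  assumes q: "\<And>k. 0 \<le> q k" "\<And>k. q k \<le> e" and T: "filterlim (\<lambda>k. \<Sum>i=1..k. q i) at_top sequentially"
    and b: "0 \<le> b"
  shows "finite {k. 1 \<le> k \<and> (\<Sum>i=1..k. q i) < b}"
    "\<bar>(\<Sum>k | 1 \<le> k \<and> (\<Sum>i=1..k. q i) < b. q k) - b\<bar> \<le> e"
proof -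
  define T where "T k = (\<Sum>i=1..k. q i)" for k
  have mono: "T k \<le> T l" if "k \<le> l" for k l
    unfolding T_def by (rule sum_mono2) (use that q in auto)
  have "\<forall>\<^sub>F k in sequentially. b \<le> T k" using T by (simp add: T_def filterlim_at_top)
  then obtain k where "b \<le> T k" by (auto simp: eventually_sequentially)
  then have j: "b \<le> T (LEAST j. b \<le> T j)" by (rule LeastI)
  define j where "j = (LEAST j. b \<le> T j)"
  have lt: "T k < b" if "k < j" for k using not_less_Least[of k "\<lambda>j. b \<le> T j"] that by (simp add: j_def)
  have set: "{k. 1 \<le> k \<and> T k < b} = {1..<j}"
  proof (intro set_eqI iffI)
    fix k assume "k \<in> {k. 1 \<le> k \<and> T k < b}"
    then show "k \<in> {1..<j}" using j mono[of j k] unfolding j_def[symmetric] by force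
  qed (use lt in auto)
  show "finite {k. 1 \<le> k \<and> (\<Sum>i=1..k. q i) < b}" using set by (simp add: T_def)
  have "\<bar>(\<Sum>k | 1 \<le> k \<and> T k < b. q k) - b\<bar> \<le> e"
  proof (cases j)
    case 0
    then have "b = 0" using j b unfolding j_def[symmetric] by (simp add: T_def)
    then show ?thesis unfolding set using 0 q[of 0] by simp
  next
    case (Suc i)
    then have "{1..<j} = {1..i}" by auto
    then have "(\<Sum>k | 1 \<le> k \<and> T k < b. q k) = T i" unfolding set by (simp add: T_def)
    moreover have "T (Suc i) = T i + q (Suc i)" by (simp add: T_def)
    ultimately show ?thesis using lt[of i] j q(2)[of "Suc i"] Suc unfolding j_def[symmetric] by simp
  qed
  then show "\<bar>(\<Sum>k | 1 \<le> k \<and> (\<Sum>i=1..k. q i) < b. q k) - b\<bar> \<le> e" by (simp add: T_def)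
qed

text \<open>The indices of a cell are the difference of two initial segments, one for each endpoint;
  each contributes an error of at most one increment.\<close>

lemma sum_in_cell:
  fixes q :: "nat \<Rightarrow> real"
  assumes q: "\<And>k. 0 \<le> q k" "\<And>k. q k \<le> e" and T: "filterlim (\<lambda>k. \<Sum>i=1..k. q i) at_top sequentially"
  shows "finite {k. 1 \<le> k \<and> (\<Sum>i=1..k. q i) \<in> cell K j}"
    "\<bar>(\<Sum>k | 1 \<le> k \<and> (\<Sum>i=1..k. q i) \<in> cell K j. q k) - 1 / 2 ^ K\<bar> \<le> 2 * e"
proof -
  let ?T = "\<lambda>k. \<Sum>i=1..k. q i"
  let ?a = "real j / 2 ^ K" and ?b = "real (Suc j) / 2 ^ K"
  have ab: "0 \<le> ?a" "?a \<le> ?b" "0 \<le> ?b" "?b - ?a = 1 / 2 ^ K"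
    by (auto simp: divide_right_mono diff_divide_distrib[symmetric])
  let ?A = "{k. 1 \<le> k \<and> ?T k < ?a}" and ?B = "{k. 1 \<le> k \<and> ?T k < ?b}"
  have eq: "{k. 1 \<le> k \<and> ?T k \<in> cell K j} = ?B - ?A" by (auto simp: cell_def)
  have sub: "?A \<subseteq> ?B" using ab(2) by (auto simp del: of_nat_Suc)
  note A = sum_before_time[OF q T ab(1)] and B = sum_before_time[OF q T ab(3)]
  show "finite {k. 1 \<le> k \<and> ?T k \<in> cell K j}" unfolding eq using B(1) by blast
  have "(\<Sum>k | 1 \<le> k \<and> ?T k \<in> cell K j. q k) = (\<Sum>k\<in>?B. q k) - (\<Sum>k\<in>?A. q k)"
    unfolding eq by (rule sum_diff[OF B(1) sub])
  then show "\<bar>(\<Sum>k | 1 \<le> k \<and> ?T k \<in> cell K j. q k) - 1 / 2 ^ K\<bar> \<le> 2 * e"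
    using A(2) B(2) ab(4) by linarith
qed

lemma sum_in_cells:
  fixes q :: "nat \<Rightarrow> real"
  assumes q: "\<And>k. 0 \<le> q k" "\<And>k. q k \<le> e" and T: "filterlim (\<lambda>k. \<Sum>i=1..k. q i) at_top sequentially"
    and S: "finite S"
  shows "finite {k. 1 \<le> k \<and> (\<Sum>i=1..k. q i) \<in> (\<Union>j\<in>S. cell K j)}"
    "\<bar>(\<Sum>k | 1 \<le> k \<and> (\<Sum>i=1..k. q i) \<in> (\<Union>j\<in>S. cell K j). q k) - real (card S) / 2 ^ K\<bar> \<le> real (card S) * (2 * e)"
proof -
  let ?T = "\<lambda>k. \<Sum>i=1..k. q i"
  let ?G = "\<lambda>j. {k. 1 \<le> k \<and> ?T k \<in> cell K j}"
  have eq: "{k. 1 \<le> k \<and> ?T k \<in> (\<Union>j\<in>S. cell K j)} = (\<Union>j\<in>S. ?G j)" by auto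
  show "finite {k. 1 \<le> k \<and> ?T k \<in> (\<Union>j\<in>S. cell K j)}"
    unfolding eq using S sum_in_cell(1)[OF q T] by blast
  have "(\<Sum>k | 1 \<le> k \<and> ?T k \<in> (\<Union>j\<in>S. cell K j). q k) = (\<Sum>j\<in>S. \<Sum>k\<in>?G j. q k)"
    unfolding eq
    by (rule sum.UNION_disjoint[OF S]) (use sum_in_cell(1)[OF q T] in \<open>auto simp: mem_cell_iff\<close>)
  then have "(\<Sum>k | 1 \<le> k \<and> ?T k \<in> (\<Union>j\<in>S. cell K j). q k) - real (card S) / 2 ^ K
      = (\<Sum>j\<in>S. (\<Sum>k\<in>?G j. q k) - 1 / 2 ^ K)"
    by (simp add: sum_subtractf)
  also have "\<bar>\<dots>\<bar> \<le> (\<Sum>j\<in>S. \<bar>(\<Sum>k\<in>?G j. q k) - 1 / 2 ^ K\<bar>)" by (rule sum_abs)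
  also have "\<dots> \<le> (\<Sum>j\<in>S. 2 * e)" by (intro sum_mono sum_in_cell(2)[OF q T])
  finally show "\<bar>(\<Sum>k | 1 \<le> k \<and> ?T k \<in> (\<Union>j\<in>S. cell K j). q k) - real (card S) / 2 ^ K\<bar> \<le> real (card S) * (2 * e)"
    by simp
qed

lemma hitting_time_greater:
  "{x \<in> seqs. hitting_time B x > enat k} = avoiding B {1..k}"
proof -
  have "enat k < hitting_time B x \<longleftrightarrow> (\<forall>i\<in>{1..k}. shift i x \<notin> B)" for x
  proof -
    have "enat k < hitting_time B x \<longleftrightarrow> enat (Suc k) \<le> hitting_time B x" by (simp add: Suc_ile_eq)
    also have "\<dots> \<longleftrightarrow> (\<forall>i. i > 0 \<and> shift i x \<in> B \<longrightarrow> Suc k \<le> i)"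
      unfolding hitting_time_def le_Inf_iff by auto
    also have "\<dots> \<longleftrightarrow> (\<forall>i\<in>{1..k}. shift i x \<notin> B)" by (auto simp: not_less_eq_eq Suc_le_eq)
    finally show ?thesis .
  qed
  then show ?thesis by (auto simp: avoiding_def)
qed

context random_sft_measure
begin

section \<open>The hitting process over a fixed base point\<close>

lemma fiber_time_eq: "fiber_time \<theta> \<mu> B \<omega> = (\<lambda>k. \<Sum>i=1..k. fm ((\<theta> ^^ i) \<omega>) B)"
  by (simp add: fiber_time_def fun_eq_iff)

text \<open>The clock depends on \<omega> and not on x. Its divergence therefore gives local
  finiteness for every x at once, with no exceptional sequences.\<close>

lemma hitting_process_radon:
  assumes "filterlim (fiber_time \<theta> \<mu> B \<omega>) at_top sequentially"
  shows "hitting_process \<theta> \<mu> B \<omega> x \<in> radon_point_measures"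
proof -
  have T0: "0 \<le> fiber_time \<theta> \<mu> B \<omega> k" for k
    unfolding fiber_time_def by (intro sum_nonneg fm_nonneg)
  have "finite {k \<in> {k. k \<ge> 1 \<and> shift k x \<in> B}. fiber_time \<theta> \<mu> B \<omega> k \<le> c}" for c
  proof -
    have "\<forall>\<^sub>F k in sequentially. c + 1 \<le> fiber_time \<theta> \<mu> B \<omega> k"
      using assms by (simp add: filterlim_at_top)
    then obtain N where "\<And>k. k \<ge> N \<Longrightarrow> c + 1 \<le> fiber_time \<theta> \<mu> B \<omega> k"
      by (auto simp: eventually_sequentially)
    then have "{k \<in> {k. k \<ge> 1 \<and> shift k x \<in> B}. fiber_time \<theta> \<mu> B \<omega> k \<le> c} \<subseteq> {..<N}"
      by (force simp: not_less[symmetric])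
    then show ?thesis by (rule finite_subset) simp
  qed
  then show ?thesis unfolding hitting_process_def by (simp add: dirac_sum_radon_iff T0)
qed

lemma point_process_hitting:
  assumes \<omega>: "\<omega> \<in> space M" and B: "B \<in> cylinder_algebra n"
    and T: "filterlim (fiber_time \<theta> \<mu> B \<omega>) at_top sequentially"
  shows "point_process (\<mu> \<omega>) (hitting_process \<theta> \<mu> B \<omega>)"
  unfolding point_process_def
proof
  show "prob_space (\<mu> \<omega>)" by (rule prob_space_fiber[OF \<omega>])
  show "hitting_process \<theta> \<mu> B \<omega> \<in> \<mu> \<omega> \<rightarrow>\<^sub>M point_measure_algebra"
  proof (rule measurable_point_measure_algebraI[OF hitting_process_radon[OF T]])
    fix K j
    show "(\<lambda>x. emeasure (hitting_process \<theta> \<mu> B \<omega> x) (cell K j)) \<in> borel_measurable (\<mu> \<omega>)"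
      unfolding hitting_process_def
    proof (rule emeasure_dirac_sum_measurable)
      fix k
      show "{x \<in> space (\<mu> \<omega>). k \<in> {k. 1 \<le> k \<and> shift k x \<in> B}} \<in> sets (\<mu> \<omega>)"
      proof (cases "1 \<le> k")
        case True
        have "{x \<in> space (\<mu> \<omega>). k \<in> {k. 1 \<le> k \<and> shift k x \<in> B}} = shift_preimage k B \<inter> space (\<mu> \<omega>)"
          using True fiber_subset_seqs by (auto simp: shift_preimage_def space_fiber[OF \<omega>])
        then show ?thesis
          using seq_algebra_fiber[OF \<omega> cylinder_algebra_seq_algebra[OF shift_preimage_in_cylinder_algebra[OF B]]]
          by simp
      qed simp
    qed (auto simp: fiber_time_def intro!: sum_nonneg fm_nonneg)
  qed
qed

lemma hitting_process_emeasure: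
  assumes "R \<in> sets half_line"
  shows "emeasure (hitting_process \<theta> \<mu> B \<omega> x) R =
    emeasure (count_space {k. k \<ge> 1 \<and> shift k x \<in> B}) {k. k \<ge> 1 \<and> shift k x \<in> B \<and> fiber_time \<theta> \<mu> B \<omega> k \<in> R}"
proof -
  have "0 \<le> fiber_time \<theta> \<mu> B \<omega> k" for k
    unfolding fiber_time_def by (intro sum_nonneg fm_nonneg)
  then show ?thesis unfolding hitting_process_def
    by (subst emeasure_dirac_sum_count) (use assms in \<open>auto intro!: arg_cong2[where f=emeasure]\<close>)
qed

text \<open>For a region R let G be the finite set of indices whose clock value lies in R. The event
  that R is void is avoidance of \<open>A n\<close> along G, and the mean count of R is the sum of
  the hit probabilities over G by equivariance. Both limits then follow from the fact that this sum
  approaches the length of R.\<close>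

lemma hitting_process_converges:
  assumes \<omega>: "\<omega> \<in> space M" and A: "\<And>n. 1 \<le> n \<Longrightarrow> A n \<in> cylinder_algebra n"
    and T: "\<And>n. 1 \<le> n \<Longrightarrow> filterlim (fiber_time \<theta> \<mu> (A n) \<omega>) at_top sequentially"
    and eqv: "\<And>n k. 1 \<le> n \<Longrightarrow> fm \<omega> (shift_preimage k (A n)) = fm ((\<theta> ^^ k) \<omega>) (A n)"
    and bound: "\<And>n k. 1 \<le> n \<Longrightarrow> fm ((\<theta> ^^ k) \<omega>) (A n) \<le> e n" and e: "e \<longlonglongrightarrow> 0"
    and avoid: "avoidance_asymptotics A \<omega>"
    and L: "uniform_poisson_law L"
  shows "converges_in_distribution (\<mu> \<omega>) (\<lambda>n. hitting_process \<theta> \<mu> (A n) \<omega>) L"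
proof -
  interpret P: prob_space "\<mu> \<omega>" by (rule prob_space_fiber[OF \<omega>])
  \<comment> \<open>\<open>A 0\<close> is unconstrained, so the sequence starts at index 1; the
    shift is undone in the last step.\<close>
  let ?N = "\<lambda>n. hitting_process \<theta> \<mu> (A (Suc n)) \<omega>"
  let ?p = "\<lambda>n k. fm ((\<theta> ^^ k) \<omega>) (A n)" and ?T = "\<lambda>n. fiber_time \<theta> \<mu> (A n) \<omega>"
  define Q where "Q n = distr (\<mu> \<omega>) point_measure_algebra (?N n)" for n
  define G where "G n R = {k. 1 \<le> k \<and> ?T n k \<in> R}" for n R
  have Nm: "?N n \<in> \<mu> \<omega> \<rightarrow>\<^sub>M point_measure_algebra" for n
    using point_process_hitting[OF \<omega> A T, of "Suc n"] by (simp add: point_process_def)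
  have Q: "prob_space (Q n)" "sets (Q n) = sets point_measure_algebra" for n
    unfolding Q_def by (auto intro: P.prob_space_distr Nm)
  have G: "finite (G n (\<Union>j\<in>S. cell K j))"
    "\<bar>(\<Sum>k\<in>G n (\<Union>j\<in>S. cell K j). ?p n k) - real (card S) / 2 ^ K\<bar> \<le> real (card S) * (2 * e n)"
    if "1 \<le> n" "finite S" for n S K
    using sum_in_cells[OF fm_nonneg bound T[unfolded fiber_time_eq], OF that(1) that(1) that(2), of K]
    unfolding G_def fiber_time_eq by auto
  have Gsum: "(\<lambda>n. \<Sum>k\<in>G (Suc n) (\<Union>j\<in>S. cell K j). ?p (Suc n) k) \<longlonglongrightarrow> real (card S) / 2 ^ K"
    if "finite S" for S K
  proof (rule Lim_null[THEN iffD2], rule Lim_null_comparison)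
    show "\<forall>\<^sub>F n in sequentially. norm ((\<Sum>k\<in>G (Suc n) (\<Union>j\<in>S. cell K j). ?p (Suc n) k) - real (card S) / 2 ^ K)
        \<le> real (card S) * (2 * e (Suc n))"
      using G(2)[OF _ that, of "Suc _"] by (intro always_eventually allI) simp
    show "(\<lambda>n. real (card S) * (2 * e (Suc n))) \<longlonglongrightarrow> 0"
      using tendsto_mult_right_zero[OF tendsto_mult_right_zero[OF LIMSEQ_Suc[OF e]]] by simp
  qed
  have void: "(\<lambda>n. measure (Q n) {m \<in> radon_point_measures. emeasure m (\<Union>j\<in>S. cell K j) = 0})
        \<longlonglongrightarrow> exp (- (real (card S) / 2 ^ K))" if S: "finite S" for K S
  proof -
    let ?R = "\<Union>j\<in>S. cell K j"
    have R: "?R \<in> sets half_line" using S by auto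
    have meas: "measure (Q n) {m \<in> radon_point_measures. emeasure m ?R = 0} = fm \<omega> (avoiding (A (Suc n)) (G (Suc n) ?R))" for n
    proof -
      have "{m \<in> radon_point_measures. emeasure m ?R = 0} \<in> sets point_measure_algebra"
        by (rule count_event[OF R])
      then have "measure (Q n) {m \<in> radon_point_measures. emeasure m ?R = 0}
          = P.prob (?N n -` {m \<in> radon_point_measures. emeasure m ?R = 0} \<inter> space (\<mu> \<omega>))"
        unfolding Q_def by (rule measure_distr[OF Nm])
      also have "?N n -` {m \<in> radon_point_measures. emeasure m ?R = 0} \<inter> space (\<mu> \<omega>)
          = avoiding (A (Suc n)) (G (Suc n) ?R) \<inter> space (\<mu> \<omega>)"
      proof -
        have "emeasure (?N n x) ?R = 0 \<longleftrightarrow> (\<forall>k\<in>G (Suc n) ?R. shift k x \<notin> A (Suc n))" for x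
          unfolding hitting_process_emeasure[OF R] G_def
          by (subst emeasure_count_space_eq_0) auto
        then show ?thesis
          using hitting_process_radon[OF T, of "Suc n"] fiber_subset_seqs[of \<omega>]
          by (auto simp: avoiding_def space_fiber[OF \<omega>])
      qed
      finally show ?thesis by (simp add: fiber_measure_def)
    qed
    \<comment> \<open>A crude bound valid at every level K, since the j-th cell of any level lies
      below j + 1.\<close>
    define d where "d = Suc (Suc (Max (insert 0 S)))"
    have Rd: "x \<le> real d" if xR: "x \<in> ?R" for x
    proof -
      obtain j where j: "j \<in> S" "x \<in> cell K j" using xR by blast
      then have "x \<le> real (Suc j)" using cell_bounded by blast
      moreover have "j \<le> Max (insert 0 S)" using j S by (intro Max_ge) auto
      then have "real (Suc j) \<le> real d" by (simp add: d_def)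
      ultimately show ?thesis by linarith
    qed
    have "(\<lambda>n. fm \<omega> (avoiding (A (Suc n)) (G (Suc n) ?R)) - exp (- (\<Sum>k\<in>G (Suc n) ?R. ?p (Suc n) k))) \<longlonglongrightarrow> 0"
    proof (rule tendstoI)
      fix \<eta> :: real assume "0 < \<eta>"
      then have \<eta>: "0 < \<eta> / 2" and d0: "0 < d" by (simp_all add: d_def)
      have "\<forall>\<^sub>F n in sequentially. \<forall>S. finite S \<longrightarrow> S \<subseteq> {k. 1 \<le> k \<and> ?T (Suc n) k \<le> real d} \<longrightarrow>
          \<bar>fm \<omega> (avoiding (A (Suc n)) S) - exp (- (\<Sum>k\<in>S. ?p (Suc n) k))\<bar> \<le> \<eta> / 2"
        by (rule eventually_compose_filterlim[OF avoid[unfolded avoidance_asymptotics_def, rule_format, OF d0 \<eta>] filterlim_Suc])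
      then show "\<forall>\<^sub>F n in sequentially. dist (fm \<omega> (avoiding (A (Suc n)) (G (Suc n) ?R))
          - exp (- (\<Sum>k\<in>G (Suc n) ?R. ?p (Suc n) k))) 0 < \<eta>"
      proof eventually_elim
        case (elim n)
        have "G (Suc n) ?R \<subseteq> {k. 1 \<le> k \<and> ?T (Suc n) k \<le> real d}" using Rd by (auto simp: G_def)
        then have "\<bar>fm \<omega> (avoiding (A (Suc n)) (G (Suc n) ?R)) - exp (- (\<Sum>k\<in>G (Suc n) ?R. ?p (Suc n) k))\<bar> \<le> \<eta> / 2"
          using elim G(1)[OF _ S, of "Suc n" K] by simp
        then show ?case using \<open>0 < \<eta>\<close> by (simp add: dist_real_def)
      qed
    qed
    moreover have "(\<lambda>n. exp (- (\<Sum>k\<in>G (Suc n) ?R. ?p (Suc n) k))) \<longlonglongrightarrow> exp (- (real (card S) / 2 ^ K))"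
      by (intro tendsto_exp tendsto_minus Gsum S)
    ultimately show ?thesis unfolding meas by (rule Lim_transform[rotated])
  qed
  have intensity: "(\<lambda>n. \<integral>\<^sup>+m. emeasure m (cell K j) \<partial>Q n) \<longlonglongrightarrow> ennreal (1 / 2 ^ K)" for K j
  proof -
    have "(\<integral>\<^sup>+m. emeasure m (cell K j) \<partial>Q n) = ennreal (\<Sum>k\<in>G (Suc n) (\<Union>j\<in>{j}. cell K j). ?p (Suc n) k)" for n
    proof -
      let ?G = "G (Suc n) (cell K j)"
      have fG: "finite ?G" using G(1)[of "Suc n" "{j}" K] by simp
      have sm: "shift_preimage k (A (Suc n)) \<inter> space (\<mu> \<omega>) \<in> sets (\<mu> \<omega>)" for k
        by (rule seq_algebra_fiber[OF \<omega> cylinder_algebra_seq_algebra[OF shift_preimage_in_cylinder_algebra[OF A]]]) simp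
      have "(\<integral>\<^sup>+m. emeasure m (cell K j) \<partial>Q n) = (\<integral>\<^sup>+x. emeasure (?N n x) (cell K j) \<partial>\<mu> \<omega>)"
        unfolding Q_def by (rule nn_integral_distr[OF Nm]) (rule borel_measurable_emeasure_point_measure, simp_all)
      \<comment> \<open>The index set \<open>?G\<close> is deterministic and finite and only the
        hits depend on x, so the mean count is computed by linearity.\<close>
      also have "\<dots> = (\<integral>\<^sup>+x. (\<Sum>k\<in>?G. indicator (shift_preimage k (A (Suc n)) \<inter> space (\<mu> \<omega>)) x) \<partial>\<mu> \<omega>)"
      proof (rule nn_integral_cong)
        fix x assume x: "x \<in> space (\<mu> \<omega>)"
        then have xs: "x \<in> seqs" using fiber_subset_seqs by (auto simp: space_fiber[OF \<omega>])
        let ?H = "{k. k \<ge> 1 \<and> shift k x \<in> A (Suc n) \<and> ?T (Suc n) k \<in> cell K j}"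
        have H: "?H = {k \<in> ?G. shift k x \<in> A (Suc n)}" by (auto simp: G_def)
        have "finite ?H" unfolding H using fG by simp
        then have "emeasure (?N n x) (cell K j) = of_nat (card ?H)"
          unfolding hitting_process_emeasure[OF cell_half_line]
          by (intro emeasure_count_space_finite) auto
        also have "\<dots> = (\<Sum>k\<in>?G. if shift k x \<in> A (Suc n) then 1 else 0)"
          using fG unfolding H by (simp add: sum.If_cases Int_def)
        also have "\<dots> = (\<Sum>k\<in>?G. indicator (shift_preimage k (A (Suc n)) \<inter> space (\<mu> \<omega>)) x)"
          by (rule sum.cong) (use x xs in \<open>auto simp: shift_preimage_def indicator_def\<close>)
        finally show "emeasure (?N n x) (cell K j) = (\<Sum>k\<in>?G. indicator (shift_preimage k (A (Suc n)) \<inter> space (\<mu> \<omega>)) x)" .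
      qed
      also have "\<dots> = (\<Sum>k\<in>?G. emeasure (\<mu> \<omega>) (shift_preimage k (A (Suc n)) \<inter> space (\<mu> \<omega>)))"
        using sm by (subst nn_integral_sum) auto
      also have "\<dots> = (\<Sum>k\<in>?G. ennreal (?p (Suc n) k))"
        using eqv[of "Suc n"] by (simp add: P.emeasure_eq_measure fiber_measure_def)
      also have "\<dots> = ennreal (\<Sum>k\<in>?G. ?p (Suc n) k)" by (intro sum_ennreal fm_nonneg)
      finally show ?thesis by simp
    qed
    moreover have "(\<lambda>n. ennreal (\<Sum>k\<in>G (Suc n) (\<Union>j\<in>{j}. cell K j). ?p (Suc n) k)) \<longlonglongrightarrow> ennreal (real (card {j}) / 2 ^ K)"
      by (intro tendsto_ennrealI Gsum) simp
    ultimately show ?thesis by simp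
  qed
  show ?thesis
    unfolding converges_in_distribution_def
  proof (intro allI impI, elim conjE)
    fix f :: "real measure \<Rightarrow> real"
    assume f: "continuous_map point_measure_topology euclideanreal f" "bounded (f ` radon_point_measures)"
    have "(\<lambda>n. \<integral>m. f m \<partial>Q n) \<longlonglongrightarrow> (\<integral>m. f m \<partial>L)"
      by (rule converges_to_poisson[OF L Q void intensity f])
    moreover have "f \<in> borel_measurable point_measure_algebra"
      by (rule continuous_point_measure_measurable[OF f(1)])
    then have "(\<integral>m. f m \<partial>Q n) = (\<integral>x. f (?N n x) \<partial>\<mu> \<omega>)" for n
      unfolding Q_def by (rule integral_distr[OF Nm])
    ultimately have "(\<lambda>n. \<integral>x. f (?N n x) \<partial>\<mu> \<omega>) \<longlonglongrightarrow> (\<integral>m. f m \<partial>L)" by simp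
    then show "(\<lambda>n. \<integral>x. f (hitting_process \<theta> \<mu> (A n) \<omega> x) \<partial>\<mu> \<omega>) \<longlonglongrightarrow> (\<integral>m. f m \<partial>L)"
      by (rule LIMSEQ_imp_Suc)
  qed
qed

text \<open>Up to clock value d the avoidance estimate with S = {1..k} is uniform in k. Beyond d
  both quantities decrease in k, so they are bounded by their values at the last index before the
  clock passes d, where both are already small.\<close>

lemma hitting_time_converges:
  assumes \<omega>: "\<omega> \<in> space M" and A: "\<And>n. 1 \<le> n \<Longrightarrow> A n \<in> cylinder_algebra n"
    and bound: "\<And>n k. 1 \<le> n \<Longrightarrow> fm ((\<theta> ^^ k) \<omega>) (A n) \<le> e n" and e: "e \<longlonglongrightarrow> 0"
    and avoid: "avoidance_asymptotics A \<omega>"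
  shows "(\<lambda>n. SUP k. \<bar>fm \<omega> {x \<in> seqs. hitting_time (A n) x > enat k}
    - exp (- (\<Sum>i=1..k. fm ((\<theta> ^^ i) \<omega>) (A n)))\<bar>) \<longlonglongrightarrow> 0"
  unfolding hitting_time_greater
proof (rule LIMSEQ_I)
  fix r :: real assume r: "0 < r"
  \<comment> \<open>The clock can pass d with its last value before only just above d - 1, because
    increments are eventually less than 1; hence d - 1 in the exponent.\<close>
  have "(\<lambda>d. exp (- (real d - 1))) \<longlonglongrightarrow> 0" by real_asymp
  then have "\<forall>\<^sub>F d in sequentially. exp (- (real d - 1)) < r / 4"
    by (rule order_tendstoD(2)) (use r in simp)
  then have "\<forall>\<^sub>F d in sequentially. 0 < d \<and> exp (- (real d - 1)) < r / 4"
    using eventually_gt_at_top[of 0] by eventually_elim simp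
  then obtain d :: nat where d: "0 < d" "exp (- (real d - 1)) < r / 4"
    by (auto simp: eventually_sequentially)
  have "0 < r / 4" using r by simp
  note avoid[unfolded avoidance_asymptotics_def, rule_format, OF d(1) this]
  moreover have "\<forall>\<^sub>F n in sequentially. e n < 1" using e by (rule order_tendstoD(2)) simp
  moreover have "\<forall>\<^sub>F n in sequentially. 1 \<le> n" by (rule eventually_ge_at_top)
  ultimately have "\<forall>\<^sub>F n in sequentially. norm ((SUP k. \<bar>fm \<omega> (avoiding (A n) {1..k})
    - exp (- (\<Sum>i=1..k. fm ((\<theta> ^^ i) \<omega>) (A n)))\<bar>) - 0) < r"
  proof eventually_elim
    case (elim n)
    let ?T = "fiber_time \<theta> \<mu> (A n) \<omega>"
    let ?f = "\<lambda>k. \<bar>fm \<omega> (avoiding (A n) {1..k}) - exp (- ?T k)\<bar>"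
    have mono: "?T k \<le> ?T l" if "k \<le> l" for k l
      unfolding fiber_time_def by (rule sum_mono2) (use that fm_nonneg in auto)
    have ap: "?f k \<le> r / 4" if "?T k \<le> real d" for k
    proof -
      have "?T j \<le> real d" if "j \<in> {1..k}" for j
        using mono[of j k] that \<open>?T k \<le> real d\<close> by simp
      then have "{1..k} \<subseteq> {k. 1 \<le> k \<and> ?T k \<le> real d}" by auto
      then show ?thesis using elim(1)[rule_format, of "{1..k}"] by (simp add: fiber_time_def)
    qed
    have le: "?f k \<le> r / 2" for k
    proof (cases "?T k \<le> real d")
      case True
      then show ?thesis using ap[of k] r by simp
    next
      case False
      define j where "j = (LEAST j. real d < ?T j)"
      have j: "real d < ?T j" unfolding j_def by (rule LeastI[of _ k]) (use False in simp)
      have jk: "j \<le> k" unfolding j_def by (rule Least_le) (use False in simp)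
      have "j \<noteq> 0"
      proof
        assume "j = 0"
        then show False using j by (simp add: fiber_time_def)
      qed
      then obtain i where i: "j = Suc i" by (cases j) auto
      have Ti: "?T i \<le> real d" using not_less_Least[of i "\<lambda>j. real d < ?T j"] i by (simp add: j_def[symmetric] not_less)
      have "?T j = ?T i + fm ((\<theta> ^^ j) \<omega>) (A n)" using i by (simp add: fiber_time_def)
      then have "real d - 1 < ?T i" using j bound[of n j] elim(2,3) by simp
      then have "exp (- ?T i) < r / 4" using d(2) by (intro order_less_trans[OF _ d(2)]) simp
      moreover have "exp (- ?T k) \<le> exp (- ?T i)" using mono[of i k] i jk by simp
      moreover have "fm \<omega> (avoiding (A n) {1..k}) \<le> fm \<omega> (avoiding (A n) {1..i})"
        by (rule fm_mono[OF \<omega> avoiding_seq_algebra[OF A]]) (use elim(3) i jk in \<open>auto simp: avoiding_def\<close>)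
      moreover have "0 \<le> fm \<omega> (avoiding (A n) {1..k})" "0 \<le> exp (- ?T k)" using fm_nonneg by auto
      ultimately show ?thesis using ap[OF Ti] by linarith
    qed
    have bdd: "bdd_above (range ?f)" using le by (intro bdd_aboveI[of _ "r / 2"]) auto
    have "(SUP k. ?f k) \<le> r / 2" by (rule cSUP_least) (use le in auto)
    moreover have "0 \<le> (SUP k. ?f k)" by (rule cSUP_upper2[OF bdd, of 0]) auto
    ultimately show ?case using r by (simp add: fiber_time_def)
  qed
  then show "\<exists>no. \<forall>n\<ge>no. norm ((SUP k. \<bar>fm \<omega> (avoiding (A n) {1..k})
    - exp (- (\<Sum>i=1..k. fm ((\<theta> ^^ i) \<omega>) (A n)))\<bar>) - 0) < r"
    by (simp add: eventually_sequentially)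
qed

end

theorem theorem9:
  fixes M :: "'a measure" and \<theta> :: "'a \<Rightarrow> 'a"
    and b :: "'a \<Rightarrow> nat" and a :: "'a \<Rightarrow> nat \<Rightarrow> nat \<Rightarrow> nat"
    and \<nu> :: "('a \<times> (nat \<Rightarrow> enat)) measure" and \<mu> :: "'a \<Rightarrow> (nat \<Rightarrow> enat) measure"
    and A :: "nat \<Rightarrow> (nat \<Rightarrow> enat) set"
    and D :: "'a \<Rightarrow> real" and p :: real
    and \<beta>\<^sub>0 \<beta>\<^sub>1 \<alpha> \<phi> :: "nat \<Rightarrow> real"
  assumes sft: "random_sft M \<theta> b a"
    and inv: "invariant_measure_over M \<theta> b a \<nu>"
    and dis: "disintegration M \<theta> b a \<nu> \<mu>"
    and A: "\<forall>n\<ge>1. A n \<in> cylinder_algebra n"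
    and p: "0 < p" "p \<le> 1"
    and D: "D \<in> borel_measurable M" "\<forall>\<omega>\<in>space M. 0 < D \<omega>"
      "integrable M (\<lambda>\<omega>. D \<omega> powr p)"
    and I: "\<forall>n\<ge>1. AE \<omega> in M.
        (\<forall>j\<le>n. fiber_measure \<mu> \<omega> (A n \<inter> shift_preimage j (A n))
                  \<le> fiber_measure \<mu> \<omega> (A n) * \<beta>\<^sub>0 j) \<and>
        (\<forall>k\<ge>n. fiber_measure \<mu> \<omega> (A n \<inter> shift_preimage k (A n))
                  \<le> fiber_measure \<mu> \<omega> (A n) * \<beta>\<^sub>1 n)"
    and II: "(\<lambda>n. ess_sup_measure M \<mu> (A n)) \<longlonglongrightarrow> 0"
      "\<forall>n\<ge>1. ess_sup_measure M \<mu> (A n) \<noteq> 0"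
    and III: "uniform_fibered_mixing {1..} M \<theta> \<mu> D \<alpha> \<or> fibered_phi_mixing {1..} M \<theta> \<mu> \<phi>"
    and IV: "AE \<omega> in M. \<forall>R. finite_interval_union R \<longrightarrow>
        (\<lambda>n. INF h :: nat.
            ereal (real h * \<beta>\<^sub>1 n) + ereal (\<Sum>j=first_overlap (A n)..n. \<beta>\<^sub>0 j)
            + mixing_error M \<theta> \<mu> D p \<alpha> \<phi> h (last_time_in \<theta> \<mu> (A n) \<omega> R)
            + ereal (real (h + n) * ess_sup_measure M \<mu> (A n))) \<longlonglongrightarrow> 0"
  shows "(\<exists>L. uniform_poisson_law L \<and>
           (AE \<omega> in M. (\<forall>n\<ge>1. point_process (\<mu> \<omega>) (hitting_process \<theta> \<mu> (A n) \<omega>)) \<and>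
              converges_in_distribution (\<mu> \<omega>) (\<lambda>n. hitting_process \<theta> \<mu> (A n) \<omega>) L)) \<and>
         (AE \<omega> in M.
           (\<lambda>n. SUP k :: nat.
              \<bar>fiber_measure \<mu> \<omega> {x \<in> seqs. hitting_time (A n) x > enat k}
                - exp (- (\<Sum>i=1..k. fiber_measure \<mu> ((\<theta> ^^ i) \<omega>) (A n)))\<bar>) \<longlonglongrightarrow> 0)"
proof -
  interpret random_sft_measure M \<theta> b a \<nu> \<mu>
    by standard (fact sft inv dis)+
  have An: "A n \<in> cylinder_algebra n" if "1 \<le> n" for n using A that by simp
  note As = cylinder_algebra_seq_algebra[OF An]
  have time: "AE \<omega> in M. \<forall>n\<in>{1..}. filterlim (fiber_time \<theta> \<mu> (A n) \<omega>) at_top sequentially"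
    by (simp only: AE_ball_countable[OF countableI_type], intro ballI fiber_time_at_top As) (use II in auto)
  have eqv: "AE \<omega> in M. \<forall>n\<in>{1..}. \<forall>k. fm \<omega> (shift_preimage k (A n)) = fm ((\<theta> ^^ k) \<omega>) (A n)"
  proof (simp only: AE_ball_countable[OF countableI_type] AE_all_countable, intro ballI allI)
    fix n k assume "n \<in> {1::nat..}"
    then show "AE \<omega> in M. fm \<omega> (shift_preimage k (A n)) = fm ((\<theta> ^^ k) \<omega>) (A n)"
      by (intro fm_shift_preimage[OF An]) simp
  qed
  have "AE \<omega> in M. \<forall>n\<in>{1..}. fm \<omega> (A n) \<le> ess_sup_measure M \<mu> (A n)"
    by (simp only: AE_ball_countable[OF countableI_type], intro ballI AE_fm_le_ess_sup As) simp
  then have bound: "AE \<omega> in M. \<forall>k. \<forall>n\<in>{1..}. fm ((\<theta> ^^ k) \<omega>) (A n) \<le> ess_sup_measure M \<mu> (A n)"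
    by (rule AE_all_iterates[OF theta(1)])
  note avoid = AE_avoidance_asymptotics[OF A p D(2,3) I II IV]
  \<comment> \<open>The law is fixed before \<omega>, so a single L serves almost every base
    point.\<close>
  have "AE \<omega> in M. (\<forall>n\<ge>1. point_process (\<mu> \<omega>) (hitting_process \<theta> \<mu> (A n) \<omega>)) \<and>
      converges_in_distribution (\<mu> \<omega>) (\<lambda>n. hitting_process \<theta> \<mu> (A n) \<omega>) poisson_law"
    using time eqv bound avoid AE_space
  proof eventually_elim
    case (elim \<omega>)
    note T = elim(1)[rule_format] and \<omega> = elim(5)
    have "point_process (\<mu> \<omega>) (hitting_process \<theta> \<mu> (A n) \<omega>)" if "1 \<le> n" for n
      by (rule point_process_hitting[OF \<omega> An[OF that] T]) (use that in simp)
    moreover have "converges_in_distribution (\<mu> \<omega>) (\<lambda>n. hitting_process \<theta> \<mu> (A n) \<omega>) poisson_law"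
      by (rule hitting_process_converges[OF \<omega> An _ _ _ II(1) _ uniform_poisson_law_poisson_law])
         (use elim in auto)
    ultimately show ?case by blast
  qed
  moreover have "AE \<omega> in M. (\<lambda>n. SUP k :: nat.
              \<bar>fm \<omega> {x \<in> seqs. hitting_time (A n) x > enat k}
                - exp (- (\<Sum>i=1..k. fm ((\<theta> ^^ i) \<omega>) (A n)))\<bar>) \<longlonglongrightarrow> 0"
    using bound avoid AE_space
  proof eventually_elim
    case (elim \<omega>)
    show ?case
      by (rule hitting_time_converges[OF elim(3) An _ II(1)]) (use elim in auto)
  qed
  ultimately show ?thesis using uniform_poisson_law_poisson_law by blast
qed

end
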